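(* Let $\overline{\boldsymbol x}_t = \frac{1}{t+1}\sum_{k=0}^t \boldsymbol x_k$ and $\overline{\boldsymbol u}_t = \frac{1}{t+1}\sum_{k=0}^t \boldsymbol u_k$ be the averaged iterates of the VR-TOS algorithm (described in the context). Then VR-TOS converges for any step size $0<\gamma \le 1/(3L_f)$, in the sense that $\limsup_{t\to\infty}\mathbb E[\mathcal L(\overline{\boldsymbol x}_t,\boldsymbol u)-\mathcal L(\boldsymbol x,\overline{\boldsymbol u}_t)]\le 0$ for all $(\boldsymbol x,\boldsymbol u)\in\operatorname{dom} g\times\operatorname{dom} h^*$. Moreover, for $\gamma = 1/(3L_f)$, every $t\ge 0$, every $(\boldsymbol x,\boldsymbol u)\in \operatorname{dom} g\times \operatorname{dom} h^*$ and every $\boldsymbol y^\star\in\operatorname{Fix}(\boldsymbol G_\gamma)$, setting $\boldsymbol y = \boldsymbol x+\gamma\boldsymbol u$, $$\mathbb E\left[\mathcal L(\overline{\boldsymbol x}_t,\boldsymbol u)-\mathcal L(\boldsymbol x,\overline{\boldsymbol u}_t)\right]\le \frac{10n}{q(t+1)}\left[\frac{3L_fq}{20n}\|\boldsymbol y_0-\boldsymbol y\|^2+\frac{3L_fq}{2n}\|\boldsymbol y_0-\boldsymbol y^\star\|^2+H_0\right].$$ Furthermore, if $h$ is $\beta_h$-Lipschitz, then for $\gamma=1/(3L_f)$, $$\mathbb E[\mathcal P(\overline{\boldsymbol x}_t)]-\mathcal P(\boldsymbol x^\star)\le \frac{10n}{q(t+1)}\left[\frac{6L_fq}{20n}\|\boldsymbol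 z_0-\boldsymbol x^\star\|^2+\frac{3L_fq}{2n}\|\boldsymbol y_0-\boldsymbol y^\star\|^2+\frac{q}{15nL_f}\beta_h^2+H_0\right].$$
   Context: Problem: minimize over $\boldsymbol x\in\mathbb R^p$ the function $\mathcal P(\boldsymbol x)=f(\boldsymbol x)+g(\boldsymbol x)+h(\boldsymbol x)$, with $f=\frac1n\sum_{i=1}^n\psi_i+\omega$. Each $\psi_i:\mathbb R^p\to\mathbb R$ is convex and $L_\psi$-smooth, $\omega:\mathbb R^p\to\mathbb R$ is convex and $L_\omega$-smooth ($L$-smooth: differentiable with $L$-Lipschitz gradient), $g,h:\mathbb R^p\to(-\infty,+\infty]$ are proper, lower semicontinuous and convex, and the relative interiors of $\operatorname{dom} g$ and $\operatorname{dom} h$ intersect. Set $L_f=L_\psi+L_\omega$. $\boldsymbol x^\star$ denotes an arbitrary minimizer of $\mathcal P$ (assumed to exist). $^*$ on a function denotes the Fenchel conjugate. The proximal operator is $\operatorname{prox}_{\gamma\varphi}(\boldsymbol x)=\arg\min_{\boldsymbol z}\{\varphi(\boldsymbol z)+\frac1{2\gamma}\|\boldsymbol x-\boldsymbol z\|^2\}$. VR-TOS algorithm: given deterministic $\boldsymbol y_0\in\mathbb R^p$, $\boldsymbol\alpha_0=(\boldsymbol\alpha_{1,0},\dots,\boldsymbol\alpha_{n,0})\in\mathbb R^{n\times p}$ and $\gamma>0$, for $t=0,1,\dots$: $\boldsymbol z_t=\operatorname{prox}_{\gamma h}(\boldsymbol y_t)$; sample $i\in\{1,\dots,n\}$ uniformly,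 independently of the past; $\boldsymbol v_t=\nabla\psi_i(\boldsymbol z_t)-\boldsymbol\alpha_{i,t}+\overline{\boldsymbol\alpha}_t+\nabla\omega(\boldsymbol z_t)$ with $\overline{\boldsymbol\alpha}_t=\frac1n\sum_j\boldsymbol\alpha_{j,t}$; $\boldsymbol x_t=\operatorname{prox}_{\gamma g}(2\boldsymbol z_t-\boldsymbol y_t-\gamma\boldsymbol v_t)$; $\boldsymbol y_{t+1}=\boldsymbol y_t+\boldsymbol x_t-\boldsymbol z_t$; update the memory by uniform $q$-memorization: a random index set $J_t$ is selected (possibly depending on $i$) such that, conditionally on the past up to iteration $t$, every $j$ belongs to $J_t$ with the same probability $q/n$ ($q>0$ fixed), and $\boldsymbol\alpha_{j,t+1}=\nabla\psi_j(\boldsymbol z_t)$ if $j\in J_t$, $\boldsymbol\alpha_{j,t+1}=\boldsymbol\alpha_{j,t}$ otherwise. (Examples: $J_t=\{i\}$, so $q=1$; or $J_t=\{1,\dots,n\}$ with probability $q/n$ and $\varnothing$ otherwise.) Further notation: $\boldsymbol u_t=(\boldsymbol y_t-\boldsymbol z_t)/\gamma$; $\mathcal L(\boldsymbol x,\boldsymbol u)=f(\boldsymbol x)+g(\boldsymbol x)+\langle\boldsymbol x,\boldsymbol u\rangle-h^*(\boldsymbol u)$; $\boldsymbol G_\gamma(\boldsymbol y)=\boldsymbol y-\boldsymbol z_{\boldsymbol y}+\operatorname{prox}_{\gamma g}(2\boldsymbol z_{\boldsymbol y}-\boldsymbol y-\gamma\nabla f(\boldsymbol z_{\boldsymbol y}))$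 with $\boldsymbol z_{\boldsymbol y}=\operatorname{prox}_{\gamma h}(\boldsymbol y)$, and $\operatorname{Fix}(\boldsymbol G_\gamma)$ is its set of fixed points; $H_0=\frac{1}{2nL_f}\sum_{i=1}^n\|\boldsymbol\alpha_{i,0}-\nabla\psi_i(\boldsymbol x^\star)\|^2$. $\mathbb E$ is the full expectation over all randomness. *)

theory Defs
  imports "HOL-Probability.Probability"
begin

text \<open>
  Extended-real-valued convex functions are rendered as functions into \<^typ>\<open>ereal\<close>. The value
  \<open>-\<infinity>\<close> is excluded by properness, and \<open>0 * \<infinity> = 0\<close> in \<^typ>\<open>ereal\<close>, so the end points \<open>a = 0\<close>
  and \<open>b = 0\<close> in the convexity inequality are harmless.
\<close>

definition domain_of :: "('a \<Rightarrow> ereal) \<Rightarrow> 'a set" where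
  "domain_of \<phi> = {x. \<phi> x < \<infinity>}"

definition proper :: "('a \<Rightarrow> ereal) \<Rightarrow> bool" where
  "proper \<phi> \<longleftrightarrow> domain_of \<phi> \<noteq> {} \<and> (\<forall>x. \<phi> x \<noteq> -\<infinity>)"

definition lower_semicontinuous :: "('a::topological_space \<Rightarrow> ereal) \<Rightarrow> bool" where
  "lower_semicontinuous \<phi> \<longleftrightarrow> (\<forall>x. \<phi> x \<le> Liminf (at x) \<phi>)"

definition ereal_convex :: "('a::real_vector \<Rightarrow> ereal) \<Rightarrow> bool" where
  "ereal_convex \<phi> \<longleftrightarrow>
     (\<forall>x y. \<forall>a\<ge>0. \<forall>b\<ge>0. a + b = 1 \<longrightarrow>
        \<phi> (a *\<^sub>R x + b *\<^sub>R y) \<le> ereal a * \<phi> x + ereal b * \<phi> y)"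

text \<open>
  A Lipschitz function is finite everywhere; the finiteness clause is needed because
  \<^const>\<open>real_of_ereal\<close> sends infinite values to \<open>0\<close>.
\<close>

definition ereal_lipschitz :: "real \<Rightarrow> ('a::metric_space \<Rightarrow> ereal) \<Rightarrow> bool" where
  "ereal_lipschitz \<beta> \<phi> \<longleftrightarrow>
     (\<forall>x. \<bar>\<phi> x\<bar> \<noteq> \<infinity>) \<and> lipschitz_on \<beta> UNIV (\<lambda>x. real_of_ereal (\<phi> x))"

definition fenchel_conjugate :: "('a::real_inner \<Rightarrow> ereal) \<Rightarrow> 'a \<Rightarrow> ereal" where
  "fenchel_conjugate \<phi> u = (SUP x. ereal (x \<bullet> u) - \<phi> x)"

definition prox :: "real \<Rightarrow> ('a::real_normed_vector \<Rightarrow> ereal) \<Rightarrow> 'a \<Rightarrow> 'a" where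
  "prox \<gamma> \<phi> x = arg_min (\<lambda>z. \<phi> z + ereal (1 / (2 * \<gamma>) * (norm (x - z))\<^sup>2)) (\<lambda>_. True)"

definition gradient :: "('a::euclidean_space \<Rightarrow> real) \<Rightarrow> 'a \<Rightarrow> 'a" where
  "gradient \<phi> x = (THE d. GDERIV \<phi> x :> d)"

definition smooth :: "real \<Rightarrow> ('a::euclidean_space \<Rightarrow> real) \<Rightarrow> bool" where
  "smooth L \<phi> \<longleftrightarrow> (\<forall>x. \<phi> differentiable (at x)) \<and> lipschitz_on L UNIV (gradient \<phi>)"

definition lagrangian ::
    "('a::real_inner \<Rightarrow> real) \<Rightarrow> ('a \<Rightarrow> ereal) \<Rightarrow> ('a \<Rightarrow> ereal) \<Rightarrow> 'a \<Rightarrow> 'a \<Rightarrow> ereal" where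
  "lagrangian f g h x u = ereal (f x) + g x + ereal (x \<bullet> u) - fenchel_conjugate h u"

definition tos_operator ::
    "real \<Rightarrow> ('a::euclidean_space \<Rightarrow> real) \<Rightarrow> ('a \<Rightarrow> ereal) \<Rightarrow> ('a \<Rightarrow> ereal) \<Rightarrow> 'a \<Rightarrow> 'a" where
  "tos_operator \<gamma> f g h y =
     (let z = prox \<gamma> h y
      in y - z + prox \<gamma> g (2 *\<^sub>R z - y - \<gamma> *\<^sub>R gradient f z))"

definition fixed_points :: "('a \<Rightarrow> 'a) \<Rightarrow> 'a set" where
  "fixed_points F = {y. F y = y}"

text \<open>
  Expectation of an extended-real-valued random variable. In \<^typ>\<open>ereal\<close> one has
  \<open>\<infinity> - \<infinity> = \<infinity>\<close>, so an undefined expectation can never satisfy a finite upper bound.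
\<close>

definition ereal_expectation :: "'w measure \<Rightarrow> ('w \<Rightarrow> ereal) \<Rightarrow> ereal" where
  "ereal_expectation M X =
     enn2ereal (\<integral>\<^sup>+ \<xi>. e2ennreal (X \<xi>) \<partial>M) - enn2ereal (\<integral>\<^sup>+ \<xi>. e2ennreal (- X \<xi>) \<partial>M)"

lemma ereal_expectation_eq_integral:
  assumes "integrable M X"
  shows "ereal_expectation M (\<lambda>\<xi>. ereal (X \<xi>)) = ereal (integral\<^sup>L M X)"
proof -
  have fin: "(\<integral>\<^sup>+ \<xi>. ennreal (X \<xi>) \<partial>M) \<noteq> \<infinity>" "(\<integral>\<^sup>+ \<xi>. ennreal (- X \<xi>) \<partial>M) \<noteq> \<infinity>"
    using assms by (auto simp: real_integrable_def)
  have conv: "enn2ereal a = ereal (enn2real a)" if "a \<noteq> \<infinity>" for a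
    using that by (cases a) (auto simp: enn2ereal_ennreal)
  show ?thesis
    unfolding ereal_expectation_def real_lebesgue_integral_def[OF assms]
    using fin by (simp add: conv e2ennreal_ereal)
qed

text \<open>
  The past up to iteration \<open>t\<close> consists of the sampled indices and the memorized index sets of all
  iterations before \<open>t\<close>; the starting point is deterministic.
\<close>

definition history :: "(nat \<Rightarrow> 'w \<Rightarrow> nat) \<Rightarrow> (nat \<Rightarrow> 'w \<Rightarrow> nat set) \<Rightarrow> nat \<Rightarrow> 'w \<Rightarrow> nat \<Rightarrow> nat \<times> nat set" where
  "history I J t \<xi> = (\<lambda>s\<in>{..<t}. (I s \<xi>, J s \<xi>))"

definition history_space :: "nat \<Rightarrow> nat \<Rightarrow> (nat \<Rightarrow> nat \<times> nat set) measure" where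
  "history_space n t = Pi\<^sub>M {..<t} (\<lambda>_. count_space ({1..n} \<times> Pow {1..n}))"

definition past_algebra ::
    "'w measure \<Rightarrow> nat \<Rightarrow> (nat \<Rightarrow> 'w \<Rightarrow> nat) \<Rightarrow> (nat \<Rightarrow> 'w \<Rightarrow> nat set) \<Rightarrow> nat \<Rightarrow> 'w measure" where
  "past_algebra M n I J t = vimage_algebra (space M) (history I J t) (history_space n t)"

text \<open>
  Independence of the past and the memorization probability are imposed separately, so the index
  set memorized at an iteration may depend on the index sampled at that same iteration.
\<close>

definition uniform_sampling ::
    "'w measure \<Rightarrow> nat \<Rightarrow> (nat \<Rightarrow> 'w \<Rightarrow> nat) \<Rightarrow> (nat \<Rightarrow> 'w \<Rightarrow> nat set) \<Rightarrow> bool" where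
  "uniform_sampling M n I J \<longleftrightarrow>
     (\<forall>t. I t \<in> measurable M (count_space {1..n}) \<and>
          distr M (count_space {1..n}) (I t) = uniform_count_measure {1..n} \<and>
          prob_space.indep_set M (sets (vimage_algebra (space M) (I t) (count_space {1..n})))
            (sets (past_algebra M n I J t)))"

definition uniform_memorization ::
    "'w measure \<Rightarrow> nat \<Rightarrow> real \<Rightarrow> (nat \<Rightarrow> 'w \<Rightarrow> nat) \<Rightarrow> (nat \<Rightarrow> 'w \<Rightarrow> nat set) \<Rightarrow> bool" where
  "uniform_memorization M n q I J \<longleftrightarrow>
     (\<forall>t. J t \<in> measurable M (count_space (Pow {1..n})) \<and>
          (\<forall>j\<in>{1..n}. AE \<xi> in M.
             real_cond_exp M (past_algebra M n I J t) (indicator {\<xi> \<in> space M. j \<in> J t \<xi>}) \<xi>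
               = q / real n))"

end

theory Submission
  imports Defs
begin

text \<open>
  Write \<open>d = x\<^sub>t - z\<^sub>t = y\<^sub>t\<^sub>+\<^sub>1 - y\<^sub>t\<close>. The proximal steps make \<open>u\<^sub>t\<close> a subgradient of \<open>h\<close> at \<open>z\<^sub>t\<close> and
  \<open>-(u\<^sub>t + v\<^sub>t) - d/\<gamma>\<close> a subgradient of \<open>g\<close> at \<open>x\<^sub>t\<close>. Inserting these into the Lagrangian gap, the terms that
  contain the dual variable combine with \<open>d/\<gamma>\<close> into a telescoping difference of squared distances of
  \<open>y\<^sub>t\<close> to \<open>Y = x + \<gamma> u\<close>, minus \<open>|d|\<^sup>2/(2\<gamma>)\<close>. What is left is the noise \<open>\<nabla>f(z\<^sub>t) - v\<^sub>t\<close>: its product with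
  \<open>z\<^sub>t - x\<close> has mean zero, and for \<open>\<gamma> \<le> 1/(3L)\<close> its product with \<open>d\<close> is absorbed by \<open>|d|\<^sup>2/(2\<gamma>)\<close> up to
  \<open>|\<nabla>f(z\<^sub>t) - v\<^sub>t|\<^sup>2/(4L)\<close> (\<open>splitting_step_gap\<close>).

  It remains to see that the noise has finite total variance. Fix a primal-dual solution \<open>(xs, us)\<close>. Two
  quantities bound the conditional variance: \<open>S\<^sub>t = \<langle>z\<^sub>t - xs, \<nabla>f(z\<^sub>t) - \<nabla>f(xs)\<rangle>\<close>, which by cocoercivity
  controls the distance of the component gradients from those at \<open>xs\<close>, and the memory error \<open>H\<^sub>t\<close>. Monotonicity of
  the subdifferentials shows that \<open>E|y\<^sub>t - ys|\<^sup>2/(2\<gamma>)\<close>, with \<open>ys = xs + \<gamma> us\<close>, changes in one iteration by at most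
  \<open>-2/3 E S\<^sub>t + 2/3 E H\<^sub>t\<close> (\<open>expected_distance_step\<close>); memorization with probability \<open>q/n\<close> gives
  \<open>E H\<^sub>t\<^sub>+\<^sub>1 \<le> E H\<^sub>t + (q/n) (E S\<^sub>t / 2 - E H\<^sub>t)\<close> (\<open>expected_memory_error_step\<close>). Summing the second recursion bounds the
  total of \<open>H\<close> by \<open>(n/q) H\<^sub>0\<close> plus half the total of \<open>S\<close>, so the first one bounds both totals
  (\<open>total_noise_le\<close>). Jensen's inequality then yields an \<open>O(1/t)\<close> bound for the averaged iterates.

  If \<open>h\<close> is Lipschitz, the objective is compared at \<open>x\<^sub>t\<close> for \<open>f + g\<close> and at \<open>z\<^sub>t\<close> for \<open>h\<close>, which is the gap above
  with \<open>u = 0\<close>. Moving \<open>h\<close> from the averaged \<open>z\<close> to the averaged \<open>x\<close> costs \<open>\<beta> |y\<^sub>t\<^sub>+\<^sub>1 - y\<^sub>0|/(t+1)\<close>, and the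
  displacement of \<open>y\<close> is bounded in mean square by the distance recursion. This avoids a supremum over random dual
  points and keeps the coefficient of \<open>\<beta>\<^sup>2\<close> small.

  For an arbitrary fixed point of the operator the pair \<open>(xs, us)\<close> is read off from its proximal point; its component
  gradients agree with those at the given minimizer (\<open>minimizer_gradients_agree\<close>), so \<open>H\<^sub>0\<close> does not depend on the
  choice. For the limit statement the qualification condition supplies a dual solution at the minimizer by
  separation (\<open>minimizer_of_sum_subgradients\<close>).
\<close>

section \<open>Inner products and averages\<close>

lemma norm_add_squared_le: "(norm (a + b))\<^sup>2 \<le> 2 * (norm a)\<^sup>2 + 2 * (norm b)\<^sup>2" for a b :: "'a::real_inner"
proof -
  have "0 \<le> (norm (a - b))\<^sup>2"
    by simp
  then show ?thesis
    by (simp add: power2_norm_eq_inner algebra_simps inner_commute)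
qed

lemma norm_diff_squared_le: "(norm (a - b))\<^sup>2 \<le> 2 * (norm a)\<^sup>2 + 2 * (norm b)\<^sup>2" for a b :: "'a::real_inner"
  using norm_add_squared_le[of a "- b"] by simp

text \<open>
  Young's inequality, with the weight that completes the square \<open>|a - c b|\<^sup>2\<close>.
\<close>

lemma inner_le_weighted_squares:
  fixes a b :: "'a::real_inner"
  assumes "0 < c"
  shows "a \<bullet> b \<le> 1 / (2 * c) * (norm a)\<^sup>2 + c / 2 * (norm b)\<^sup>2"
proof -
  have "0 \<le> (norm (a - c *\<^sub>R b))\<^sup>2"
    by simp
  then have "2 * c * (a \<bullet> b) \<le> (norm a)\<^sup>2 + c * c * (norm b)\<^sup>2"
    by (simp add: power2_norm_eq_inner algebra_simps inner_commute)
  then show ?thesis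
    using assms by (simp add: field_simps power2_eq_square)
qed

lemma variance_le_second_moment:
  fixes X :: "nat \<Rightarrow> 'a::real_inner"
  assumes "1 \<le> n"
  shows "(1 / real n) * (\<Sum>i=1..n. (norm (X i - (1 / real n) *\<^sub>R (\<Sum>j=1..n. X j)))\<^sup>2)
    \<le> (1 / real n) * (\<Sum>i=1..n. (norm (X i))\<^sup>2)"
proof -
  define m where "m = (1 / real n) *\<^sub>R (\<Sum>j=1..n. X j)"
  have m: "(\<Sum>j=1..n. X j) = real n *\<^sub>R m"
    using assms by (simp add: m_def)
  have "(\<Sum>i=1..n. (norm (X i - m))\<^sup>2) = (\<Sum>i=1..n. (norm (X i))\<^sup>2 - 2 * (X i \<bullet> m) + m \<bullet> m)"
    by (intro sum.cong refl) (simp add: power2_norm_eq_inner algebra_simps inner_commute)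
  also have "\<dots> = (\<Sum>i=1..n. (norm (X i))\<^sup>2) - 2 * ((\<Sum>i=1..n. X i) \<bullet> m) + real n * (m \<bullet> m)"
    by (simp add: sum.distrib sum_subtractf sum_distrib_left inner_sum_left)
  also have "\<dots> = (\<Sum>i=1..n. (norm (X i))\<^sup>2) - real n * (m \<bullet> m)"
    unfolding m by simp
  also have "\<dots> \<le> (\<Sum>i=1..n. (norm (X i))\<^sup>2)"
    by simp
  finally show ?thesis
    unfolding m_def[symmetric] by (intro mult_left_mono) auto
qed

definition average :: "nat \<Rightarrow> (nat \<Rightarrow> 'a::real_vector) \<Rightarrow> 'a" where
  "average t p = (1 / real (t + 1)) *\<^sub>R (\<Sum>k=0..t. p k)"

lemma jensen_average:
  assumes "convex_on S \<phi>" "\<And>k. p k \<in> S"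
  shows "average t p \<in> S" "\<phi> (average t p) \<le> 1 / real (t + 1) * (\<Sum>k=0..t. \<phi> (p k))"
proof -
  have avg: "average t p = (\<Sum>k=0..t. (1 / real (t + 1)) *\<^sub>R p k)"
    by (simp add: average_def scaleR_sum_right)
  show "average t p \<in> S"
    unfolding avg using assms convex_on_imp_convex by (intro convex_sum) auto
  show "\<phi> (average t p) \<le> 1 / real (t + 1) * (\<Sum>k=0..t. \<phi> (p k))"
    unfolding avg sum_distrib_left using assms by (intro convex_on_sum[of _ S]) auto
qed

lemma average_inner_left: "average t p \<bullet> b = 1 / real (t + 1) * (\<Sum>k=0..t. p k \<bullet> b)" for b :: "'c::real_inner"
  by (simp add: average_def inner_sum_left)

lemma convex_on_sum_functions:
  fixes \<phi> :: "'i \<Rightarrow> 'a::real_vector \<Rightarrow> real"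
  assumes "finite A" "convex S" "\<And>j. j \<in> A \<Longrightarrow> convex_on S (\<phi> j)"
  shows "convex_on S (\<lambda>x. \<Sum>j\<in>A. \<phi> j x)"
  using assms(1,3)
proof (induction A rule: finite_induct)
  case empty
  then show ?case
    using assms(2) by (simp add: convex_on_const)
next
  case (insert j A)
  then show ?case
    by (auto intro!: convex_on_add)
qed

section \<open>Smooth convex functions\<close>

lemma GDERIV_unique:
  assumes "GDERIV \<phi> x :> d" "GDERIV \<phi> x :> e"
  shows "d = e"
proof -
  have "(\<lambda>k. k \<bullet> d) = (\<lambda>k. k \<bullet> e)"
    using assms unfolding gderiv_def by (rule has_derivative_unique)
  then show ?thesis
    by (metis vector_eq_ldot)
qed

lemma gradient_eqI:
  assumes "GDERIV \<phi> x :> d"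
  shows "gradient \<phi> x = d"
  unfolding gradient_def using assms GDERIV_unique by blast

lemma GDERIV_gradient:
  fixes \<phi> :: "'a::euclidean_space \<Rightarrow> real"
  assumes "\<phi> differentiable (at x)"
  shows "GDERIV \<phi> x :> gradient \<phi> x"
proof -
  obtain D where D: "(\<phi> has_derivative D) (at x)"
    using assms by (auto simp: differentiable_def)
  have "linear D"
    using D by (rule has_derivative_linear)
  then have "D = (\<lambda>k. k \<bullet> adjoint D 1)"
    by (auto simp: adjoint_works)
  then have "GDERIV \<phi> x :> adjoint D 1"
    using D by (simp add: gderiv_def)
  then show ?thesis
    using gradient_eqI by metis
qed

lemma smooth_GDERIV: "smooth L \<phi> \<Longrightarrow> GDERIV \<phi> x :> gradient \<phi> x"
  by (simp add: smooth_def GDERIV_gradient)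

lemma smooth_lipschitz:
  "smooth L \<phi> \<Longrightarrow> norm (gradient \<phi> x - gradient \<phi> y) \<le> L * norm (x - y)"
  unfolding smooth_def using lipschitz_onD[of L UNIV "gradient \<phi>" x y] by (simp add: dist_norm)

lemma smoothI:
  assumes "0 \<le> L" "\<And>x. GDERIV \<phi> x :> G x" "\<And>x y. norm (G x - G y) \<le> L * norm (x - y)"
  shows "smooth L \<phi>"
proof -
  have "\<phi> differentiable (at x)" for x
    using assms(2)[of x] unfolding gderiv_def differentiable_def by blast
  moreover have "gradient \<phi> = G"
    using assms(2) gradient_eqI by blast
  ultimately show ?thesis
    unfolding smooth_def using assms by (auto intro!: lipschitz_onI simp: dist_norm)
qed

lemma smooth_nonneg: "smooth L \<phi> \<Longrightarrow> 0 \<le> L"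
  unfolding smooth_def using lipschitz_on_nonneg by blast

lemma smooth_weaken:
  assumes "smooth L \<phi>" "L \<le> L'"
  shows "smooth L' \<phi>"
  using assms lipschitz_on_le unfolding smooth_def by blast

lemma GDERIV_sum:
  assumes "\<And>j. j \<in> A \<Longrightarrow> GDERIV (\<phi> j) x :> G j"
  shows "GDERIV (\<lambda>x. \<Sum>j\<in>A. \<phi> j x) x :> (\<Sum>j\<in>A. G j)"
  using assms unfolding gderiv_def inner_sum_right by (intro has_derivative_sum) auto

lemma smooth_add:
  assumes "smooth L1 \<phi>" "smooth L2 \<theta>"
  shows "smooth (L1 + L2) (\<lambda>x. \<phi> x + \<theta> x)"
    and "gradient (\<lambda>x. \<phi> x + \<theta> x) x = gradient \<phi> x + gradient \<theta> x"
proof -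
  have G: "GDERIV (\<lambda>x. \<phi> x + \<theta> x) x :> gradient \<phi> x + gradient \<theta> x" for x
    using assms by (intro GDERIV_add smooth_GDERIV)
  have "norm (gradient \<phi> x + gradient \<theta> x - (gradient \<phi> y + gradient \<theta> y))
      \<le> (L1 + L2) * norm (x - y)" for x y
    using norm_triangle_ineq[of "gradient \<phi> x - gradient \<phi> y" "gradient \<theta> x - gradient \<theta> y"]
      smooth_lipschitz[OF assms(1), of x y] smooth_lipschitz[OF assms(2), of x y]
    by (simp add: algebra_simps)
  then show "smooth (L1 + L2) (\<lambda>x. \<phi> x + \<theta> x)"
    using G add_nonneg_nonneg[OF smooth_nonneg[OF assms(1)] smooth_nonneg[OF assms(2)]]
    by (intro smoothI) auto
  show "gradient (\<lambda>x. \<phi> x + \<theta> x) x = gradient \<phi> x + gradient \<theta> x"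
    using G by (rule gradient_eqI)
qed

lemma smooth_mean:
  fixes \<phi> :: "nat \<Rightarrow> 'a::euclidean_space \<Rightarrow> real"
  assumes "1 \<le> n" "\<And>j. j \<in> {1..n} \<Longrightarrow> smooth L (\<phi> j)"
  shows "smooth L (\<lambda>x. (1 / real n) * (\<Sum>j=1..n. \<phi> j x))"
    and "gradient (\<lambda>x. (1 / real n) * (\<Sum>j=1..n. \<phi> j x)) x
           = (1 / real n) *\<^sub>R (\<Sum>j=1..n. gradient (\<phi> j) x)"
proof -
  let ?G = "\<lambda>x. (1 / real n) *\<^sub>R (\<Sum>j=1..n. gradient (\<phi> j) x)"
  have G: "GDERIV (\<lambda>x. (1 / real n) * (\<Sum>j=1..n. \<phi> j x)) x :> ?G x" for x
  proof -
    have "GDERIV (\<lambda>x. \<Sum>j=1..n. \<phi> j x) x :> (\<Sum>j=1..n. gradient (\<phi> j) x)"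
      using assms by (intro GDERIV_sum smooth_GDERIV) auto
    from GDERIV_mult[OF GDERIV_const[of "1 / real n" x] this] show ?thesis
      by simp
  qed
  have "norm (?G x - ?G y) \<le> L * norm (x - y)" for x y
  proof -
    have "norm (?G x - ?G y) = (1 / real n) * norm (\<Sum>j=1..n. gradient (\<phi> j) x - gradient (\<phi> j) y)"
      unfolding sum_subtractf scaleR_diff_right[symmetric] norm_scaleR by simp
    also have "\<dots> \<le> (1 / real n) * (\<Sum>j=1..n. L * norm (x - y))"
      using assms by (intro mult_left_mono sum_norm_le smooth_lipschitz) auto
    also have "\<dots> = L * norm (x - y)"
      using assms by simp
    finally show ?thesis .
  qed
  then show "smooth L (\<lambda>x. (1 / real n) * (\<Sum>j=1..n. \<phi> j x))"
    using G assms smooth_nonneg[OF assms(2)[of 1]] by (intro smoothI) auto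
  show "gradient (\<lambda>x. (1 / real n) * (\<Sum>j=1..n. \<phi> j x)) x = ?G x"
    using G by (rule gradient_eqI)
qed

lemma GDERIV_line:
  assumes "GDERIV \<phi> (x + s *\<^sub>R d) :> D"
  shows "((\<lambda>s. \<phi> (x + s *\<^sub>R d)) has_real_derivative D \<bullet> d) (at s)"
proof -
  have "((\<lambda>s. x + s *\<^sub>R d) has_derivative (\<lambda>s. s *\<^sub>R d)) (at s)"
    by (auto intro!: derivative_eq_intros)
  from has_derivative_compose[OF this assms[unfolded gderiv_def]]
  show ?thesis
    unfolding has_field_derivative_def
    by (rule has_derivative_eq_rhs) (auto simp: inner_commute mult.commute)
qed

lemma convex_gradient_le:
  fixes \<phi> :: "'a::euclidean_space \<Rightarrow> real"
  assumes "convex_on UNIV \<phi>" "smooth L \<phi>"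
  shows "\<phi> x + gradient \<phi> x \<bullet> (y - x) \<le> \<phi> y"
proof -
  let ?k = "\<lambda>s. \<phi> (x + s *\<^sub>R (y - x))"
  have "convex_on UNIV ?k"
  proof (rule convex_onI)
    fix t a b :: real
    assume t: "0 < t" "t < 1"
    have "x + ((1 - t) *\<^sub>R a + t *\<^sub>R b) *\<^sub>R (y - x)
        = (1 - t) *\<^sub>R (x + a *\<^sub>R (y - x)) + t *\<^sub>R (x + b *\<^sub>R (y - x))"
      by (simp add: algebra_simps)
    then show "?k ((1 - t) *\<^sub>R a + t *\<^sub>R b) \<le> (1 - t) * ?k a + t * ?k b"
      using convex_onD[OF assms(1), of t "x + a *\<^sub>R (y - x)" "x + b *\<^sub>R (y - x)"] t by simp
  qed simp
  moreover have "(?k has_real_derivative gradient \<phi> x \<bullet> (y - x)) (at 0)"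
    using GDERIV_line[of \<phi> x 0 "y - x" "gradient \<phi> x"] smooth_GDERIV[OF assms(2)] by simp
  ultimately show ?thesis
    using convex_on_imp_above_tangent[of UNIV ?k 0 1 "gradient \<phi> x \<bullet> (y - x)"] by simp
qed

text \<open>The descent lemma: along the segment, the gradient departs from its initial value at most linearly.\<close>

lemma smooth_upper_bound:
  fixes \<phi> :: "'a::euclidean_space \<Rightarrow> real"
  assumes "smooth L \<phi>"
  shows "\<phi> y \<le> \<phi> x + gradient \<phi> x \<bullet> (y - x) + L / 2 * (norm (y - x))\<^sup>2"
proof -
  let ?d = "y - x"
  let ?k = "\<lambda>s. \<phi> (x + s *\<^sub>R ?d) - s * (gradient \<phi> x \<bullet> ?d) - L / 2 * s\<^sup>2 * (norm ?d)\<^sup>2"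
  have "?k 1 \<le> ?k 0"
  proof (rule DERIV_nonpos_imp_nonincreasing[of 0 1 ?k])
    fix s :: real
    assume s: "0 \<le> s" "s \<le> 1"
    let ?D = "gradient \<phi> (x + s *\<^sub>R ?d) \<bullet> ?d - gradient \<phi> x \<bullet> ?d - L * s * (norm ?d)\<^sup>2"
    have "(?k has_real_derivative ?D) (at s)"
      by (auto intro!: derivative_eq_intros GDERIV_line smooth_GDERIV[OF assms])
    moreover have "(gradient \<phi> (x + s *\<^sub>R ?d) - gradient \<phi> x) \<bullet> ?d \<le> L * s * (norm ?d)\<^sup>2"
    proof -
      have "(gradient \<phi> (x + s *\<^sub>R ?d) - gradient \<phi> x) \<bullet> ?d
          \<le> norm (gradient \<phi> (x + s *\<^sub>R ?d) - gradient \<phi> x) * norm ?d"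
        by (rule norm_cauchy_schwarz)
      also have "\<dots> \<le> (L * norm (s *\<^sub>R ?d)) * norm ?d"
        using smooth_lipschitz[OF assms, of "x + s *\<^sub>R ?d" x] by (intro mult_right_mono) auto
      also have "\<dots> = L * s * (norm ?d)\<^sup>2"
        using s by (simp add: power2_eq_square)
      finally show ?thesis .
    qed
    ultimately show "\<exists>D. (?k has_real_derivative D) (at s) \<and> D \<le> 0"
      by (intro exI[of _ ?D]) (simp add: inner_diff_left)
  qed simp
  then show ?thesis
    by simp
qed

text \<open>
  The tangent at \<open>x\<close> bounds \<open>\<phi>\<close> from below at \<open>w\<close>, and the descent lemma at \<open>y\<close> bounds it from above there;
  \<open>w\<close> is the minimizer of the difference of the two bounds.
\<close>

lemma convex_smooth_lower_bound:
  fixes \<phi> :: "'a::euclidean_space \<Rightarrow> real"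
  assumes "convex_on UNIV \<phi>" "smooth L \<phi>" "0 < L"
  shows "\<phi> x + gradient \<phi> x \<bullet> (y - x) + 1 / (2 * L) * (norm (gradient \<phi> y - gradient \<phi> x))\<^sup>2 \<le> \<phi> y"
proof -
  define G where "G = gradient \<phi> y - gradient \<phi> x"
  define w where "w = y - (1 / L) *\<^sub>R G"
  have "\<phi> x + gradient \<phi> x \<bullet> (w - x) \<le> \<phi> w"
    using assms by (intro convex_gradient_le)
  moreover have "\<phi> w \<le> \<phi> y + gradient \<phi> y \<bullet> (w - y) + L / 2 * (norm (w - y))\<^sup>2"
    using assms by (intro smooth_upper_bound)
  moreover have "L / 2 * (norm (w - y))\<^sup>2 = 1 / (2 * L) * (norm G)\<^sup>2"
    using assms by (simp add: w_def power_divide power2_eq_square)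
  moreover have "gradient \<phi> x \<bullet> (w - x) - gradient \<phi> y \<bullet> (w - y)
      = gradient \<phi> x \<bullet> (y - x) + 1 / L * (norm G)\<^sup>2"
    by (simp add: w_def G_def power2_norm_eq_inner algebra_simps inner_commute)
  ultimately show ?thesis
    by (simp add: G_def[symmetric] field_simps)
qed

lemma convex_smooth_cocoercive:
  fixes \<phi> :: "'a::euclidean_space \<Rightarrow> real"
  assumes "convex_on UNIV \<phi>" "smooth L \<phi>" "0 < L"
  shows "(norm (gradient \<phi> x - gradient \<phi> y))\<^sup>2 \<le> L * ((gradient \<phi> x - gradient \<phi> y) \<bullet> (x - y))"
proof -
  have "1 / L * (norm (gradient \<phi> x - gradient \<phi> y))\<^sup>2 \<le> (gradient \<phi> x - gradient \<phi> y) \<bullet> (x - y)"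
    using convex_smooth_lower_bound[OF assms, of x y] convex_smooth_lower_bound[OF assms, of y x]
    by (simp add: norm_minus_commute algebra_simps)
  then show ?thesis
    using assms(3) by (simp add: field_simps)
qed

lemma convex_gradient_monotone:
  fixes \<phi> :: "'a::euclidean_space \<Rightarrow> real"
  assumes "convex_on UNIV \<phi>" "smooth L \<phi>"
  shows "0 \<le> (gradient \<phi> x - gradient \<phi> y) \<bullet> (x - y)"
  using convex_gradient_le[OF assms, of x y] convex_gradient_le[OF assms, of y x]
  by (simp add: algebra_simps)

section \<open>Subgradients, proximal points and conjugates\<close>

text \<open>
  On the domain of a proper function the values are handled as reals, so that convex combinations and
  subgradient inequalities become linear arithmetic.
\<close>

lemma proper_domain_real: "proper \<phi> \<Longrightarrow> x \<in> domain_of \<phi> \<Longrightarrow> ereal (real_of_ereal (\<phi> x)) = \<phi> x"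
  unfolding proper_def domain_of_def by (auto simp: ereal_real)

lemma ereal_convex_real:
  assumes "proper \<phi>" "ereal_convex \<phi>"
  shows "convex_on (domain_of \<phi>) (\<lambda>x. real_of_ereal (\<phi> x))"
proof -
  have *: "(1 - t) *\<^sub>R x + t *\<^sub>R y \<in> domain_of \<phi> \<and>
      real_of_ereal (\<phi> ((1 - t) *\<^sub>R x + t *\<^sub>R y))
        \<le> (1 - t) * real_of_ereal (\<phi> x) + t * real_of_ereal (\<phi> y)"
    if xy: "x \<in> domain_of \<phi>" "y \<in> domain_of \<phi>" and t: "0 \<le> t" "t \<le> 1" for x y and t :: real
  proof -
    let ?w = "(1 - t) *\<^sub>R x + t *\<^sub>R y"
    have "\<phi> ?w \<le> ereal (1 - t) * \<phi> x + ereal t * \<phi> y"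
      using assms(2) t unfolding ereal_convex_def by auto
    also have "\<dots> = ereal ((1 - t) * real_of_ereal (\<phi> x) + t * real_of_ereal (\<phi> y))"
      using proper_domain_real[OF assms(1) xy(1)] proper_domain_real[OF assms(1) xy(2)]
      by (metis plus_ereal.simps(1) times_ereal.simps(1))
    finally have le: "\<phi> ?w \<le> ereal ((1 - t) * real_of_ereal (\<phi> x) + t * real_of_ereal (\<phi> y))" .
    then have "\<phi> ?w < \<infinity>"
      by (rule order.strict_trans1) simp
    then have w: "?w \<in> domain_of \<phi>"
      by (simp add: domain_of_def)
    show ?thesis
      using le w proper_domain_real[OF assms(1) w] by (metis ereal_less_eq(3))
  qed
  show ?thesis
    using * by (intro convex_onI) (auto simp: convex_alt)
qed

lemma ereal_convex_domain: "proper \<phi> \<Longrightarrow> ereal_convex \<phi> \<Longrightarrow> convex (domain_of \<phi>)"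
  using ereal_convex_real convex_on_imp_convex by blast

definition subgradient :: "('a::real_inner \<Rightarrow> ereal) \<Rightarrow> 'a \<Rightarrow> 'a \<Rightarrow> bool" where
  "subgradient \<phi> s p \<longleftrightarrow> p \<in> domain_of \<phi> \<and> (\<forall>y. \<phi> p + ereal (s \<bullet> (y - p)) \<le> \<phi> y)"

lemma subgradient_domain: "subgradient \<phi> s p \<Longrightarrow> p \<in> domain_of \<phi>"
  by (simp add: subgradient_def)

lemma subgradient_le:
  assumes "proper \<phi>" "subgradient \<phi> s p" "y \<in> domain_of \<phi>"
  shows "real_of_ereal (\<phi> p) + s \<bullet> (y - p) \<le> real_of_ereal (\<phi> y)"
proof -
  have "\<phi> p + ereal (s \<bullet> (y - p)) \<le> \<phi> y"
    using assms(2) by (simp add: subgradient_def)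
  then show ?thesis
    using proper_domain_real[OF assms(1,3)]
      proper_domain_real[OF assms(1) subgradient_domain[OF assms(2)]]
    by (metis ereal_less_eq(3) plus_ereal.simps(1))
qed

lemma subgradientI:
  assumes "proper \<phi>" "p \<in> domain_of \<phi>"
    and "\<And>y. y \<in> domain_of \<phi> \<Longrightarrow> real_of_ereal (\<phi> p) + s \<bullet> (y - p) \<le> real_of_ereal (\<phi> y)"
  shows "subgradient \<phi> s p"
  unfolding subgradient_def
proof (intro conjI allI)
  fix y
  show "\<phi> p + ereal (s \<bullet> (y - p)) \<le> \<phi> y"
  proof (cases "y \<in> domain_of \<phi>")
    case True
    then show ?thesis
      using assms(3)[OF True] proper_domain_real[OF assms(1,2)] proper_domain_real[OF assms(1) True]
      by (metis ereal_less_eq(3) plus_ereal.simps(1))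
  qed (simp add: domain_of_def)
qed fact

lemma subgradient_monotone:
  assumes "proper \<phi>" "subgradient \<phi> s p" "subgradient \<phi> t r"
  shows "0 \<le> (s - t) \<bullet> (p - r)"
  using subgradient_le[OF assms(1,2) subgradient_domain[OF assms(3)]]
    subgradient_le[OF assms(1,3) subgradient_domain[OF assms(2)]]
  by (simp add: algebra_simps)

lemma lower_semicontinuous_iff:
  "lower_semicontinuous \<phi> \<longleftrightarrow> (\<forall>x c. c < \<phi> x \<longrightarrow> (\<forall>\<^sub>F y in nhds x. c < \<phi> y))"
  unfolding lower_semicontinuous_def le_Liminf_iff eventually_at_filter
  by (auto elim!: eventually_mono)

lemma lower_semicontinuous_sublevel_closed:
  assumes "lower_semicontinuous \<phi>"
  shows "closed {x. \<phi> x \<le> c}"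
proof -
  have "open {x. c < \<phi> x}"
    using assms unfolding lower_semicontinuous_iff
    by (subst open_subopen) (auto simp: eventually_nhds subset_eq)
  moreover have "- {x. \<phi> x \<le> c} = {x. c < \<phi> x}"
    by auto
  ultimately show ?thesis
    by (simp add: closed_def)
qed

text \<open>
  The sublevel sets of the values attained on \<open>K\<close> are closed and have the finite intersection property.
\<close>

lemma lower_semicontinuous_attains_min:
  fixes \<phi> :: "'a::topological_space \<Rightarrow> ereal"
  assumes "lower_semicontinuous \<phi>" "compact K" "K \<noteq> {}"
  shows "\<exists>p\<in>K. \<forall>y\<in>K. \<phi> p \<le> \<phi> y"
proof -
  have "K \<inter> (\<Inter>y\<in>K. {x. \<phi> x \<le> \<phi> y}) \<noteq> {}"
  proof (rule compact_imp_fip_image[OF assms(2)])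
    fix Y
    assume Y: "finite Y" "Y \<subseteq> K"
    show "K \<inter> (\<Inter>y\<in>Y. {x. \<phi> x \<le> \<phi> y}) \<noteq> {}"
    proof (cases "Y = {}")
      case False
      then have "Min (\<phi> ` Y) \<in> \<phi> ` Y"
        using Y by (intro Min_in) auto
      then obtain p where "p \<in> Y" "\<phi> p = Min (\<phi> ` Y)"
        by auto
      then have "p \<in> K \<inter> (\<Inter>y\<in>Y. {x. \<phi> x \<le> \<phi> y})"
        using Y by auto
      then show ?thesis
        by blast
    qed (use assms in auto)
  qed (use assms lower_semicontinuous_sublevel_closed in auto)
  then show ?thesis
    by auto
qed

lemma lower_semicontinuous_add_continuous:
  fixes \<phi> :: "'a::t2_space \<Rightarrow> ereal" and r :: "'a \<Rightarrow> real"
  assumes "lower_semicontinuous \<phi>" "\<And>x. \<phi> x \<noteq> -\<infinity>" "continuous_on UNIV r"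
  shows "lower_semicontinuous (\<lambda>x. \<phi> x + ereal (r x))"
  unfolding lower_semicontinuous_iff
proof (intro allI impI)
  fix x c
  assume c: "c < \<phi> x + ereal (r x)"
  show "\<forall>\<^sub>F y in nhds x. c < \<phi> y + ereal (r y)"
  proof (cases c)
    case (real k)
    then have "ereal (k - r x) < \<phi> x"
      using c by (cases "\<phi> x") auto
    then obtain m where m: "ereal (k - r x) < m" "m < \<phi> x"
      using ereal_dense2 by blast
    then obtain e where e: "m = ereal e"
      by (cases m) auto
    have "\<forall>\<^sub>F y in nhds x. m < \<phi> y"
      using assms(1) m(2) unfolding lower_semicontinuous_iff by blast
    moreover have "\<forall>\<^sub>F y in nhds x. k - e < r y"
    proof (rule order_tendstoD(1))
      have "isCont r x"
        using assms(3) by (simp add: continuous_on_eq_continuous_at)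
      then show "(r \<longlongrightarrow> r x) (nhds x)"
        by (simp add: isCont_def tendsto_at_iff_tendsto_nhds)
      show "k - e < r x"
        using m e by simp
    qed
    ultimately show ?thesis
    proof eventually_elim
      case (elim y)
      then show ?case
        using real e by (cases "\<phi> y") auto
    qed
  next
    case MInf
    have "-\<infinity> < \<phi> y + ereal (r y)" for y
      using assms(2)[of y] by (cases "\<phi> y") auto
    then show ?thesis
      using MInf by simp
  qed (use c in auto)
qed

text \<open>
  A convex function cannot decrease faster than linearly: its slope along a ray from a point of its
  domain is at least the slope over the first unit of length, where lower semicontinuity provides a
  lower bound.
\<close>

lemma convex_linear_minorant:
  fixes \<phi> :: "'a::euclidean_space \<Rightarrow> ereal"
  assumes "proper \<phi>" "lower_semicontinuous \<phi>" "ereal_convex \<phi>" "x0 \<in> domain_of \<phi>"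
  obtains m c where "0 \<le> c" "\<And>z. z \<in> domain_of \<phi> \<Longrightarrow> m - c * norm (z - x0) \<le> real_of_ereal (\<phi> z)"
proof -
  let ?R = "\<lambda>x. real_of_ereal (\<phi> x)"
  obtain p where p: "p \<in> cball x0 1" "\<And>y. y \<in> cball x0 1 \<Longrightarrow> \<phi> p \<le> \<phi> y"
    using lower_semicontinuous_attains_min[OF assms(2), of "cball x0 1"] by auto
  have pd: "p \<in> domain_of \<phi>"
    using p(2)[of x0] assms(4) unfolding domain_of_def by auto
  have pR: "?R p \<le> ?R y" if "y \<in> cball x0 1" "y \<in> domain_of \<phi>" for y
    using p(2)[OF that(1)] proper_domain_real[OF assms(1) pd] proper_domain_real[OF assms(1) that(2)]
    by (metis ereal_less_eq(3))
  have x0: "?R p \<le> ?R x0"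
    using pR[of x0] assms(4) by simp
  have "?R p - (?R x0 - ?R p) * norm (z - x0) \<le> ?R z" if z: "z \<in> domain_of \<phi>" for z
  proof (cases "norm (z - x0) \<le> 1")
    case True
    then have "?R p \<le> ?R z"
      using pR[of z] z by (simp add: dist_norm norm_minus_commute)
    then show ?thesis
      using x0 by (smt (verit) mult_nonneg_nonneg norm_ge_zero)
  next
    case False
    define r where "r = norm (z - x0)"
    define w where "w = (1 - 1 / r) *\<^sub>R x0 + (1 / r) *\<^sub>R z"
    have r: "1 < r"
      using False by (simp add: r_def)
    have "x0 - w = (1 / r) *\<^sub>R (x0 - z)"
      by (simp add: w_def algebra_simps)
    then have "w \<in> cball x0 1"
      using r by (simp add: dist_norm r_def norm_minus_commute)
    moreover have "w \<in> domain_of \<phi>"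
      using ereal_convex_domain[OF assms(1,3)] assms(4) z r unfolding w_def convex_alt by auto
    ultimately have "?R p \<le> ?R w"
      by (rule pR)
    also have "\<dots> \<le> (1 - 1 / r) * ?R x0 + (1 / r) * ?R z"
      using convex_onD[OF ereal_convex_real[OF assms(1,3)], of "1 / r" x0 z] assms(4) z r
      by (simp add: w_def)
    finally have "r * ?R p \<le> r * ((1 - 1 / r) * ?R x0 + (1 / r) * ?R z)"
      using r by (intro mult_left_mono) auto
    also have "\<dots> = (r - 1) * ?R x0 + ?R z"
      using r by (simp add: field_simps)
    finally have "r * ?R p \<le> (r - 1) * ?R x0 + ?R z" .
    then show ?thesis
      using x0 by (simp add: r_def[symmetric] algebra_simps)
  qed
  then show ?thesis
    using that[of "?R x0 - ?R p" "?R p"] x0 by auto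
qed

text \<open>
  The linear minorant makes the proximal objective coercive, so its minimum over a large ball is global; hence the choice in
  the definition of the proximal point is one of an actual minimizer.
\<close>

lemma prox_is_arg_min:
  fixes \<phi> :: "'a::euclidean_space \<Rightarrow> ereal"
  assumes "proper \<phi>" "lower_semicontinuous \<phi>" "ereal_convex \<phi>" "0 < \<gamma>"
  shows "\<phi> (prox \<gamma> \<phi> x) + ereal (1 / (2 * \<gamma>) * (norm (x - prox \<gamma> \<phi> x))\<^sup>2)
           \<le> \<phi> z + ereal (1 / (2 * \<gamma>) * (norm (x - z))\<^sup>2)"
proof -
  let ?R = "\<lambda>x. real_of_ereal (\<phi> x)"
  let ?r = "\<lambda>z. 1 / (2 * \<gamma>) * (norm (x - z))\<^sup>2"
  let ?\<Phi> = "\<lambda>z. \<phi> z + ereal (?r z)"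
  obtain x0 where x0: "x0 \<in> domain_of \<phi>"
    using assms(1) unfolding proper_def by auto
  obtain m c where c: "0 \<le> c" "\<And>z. z \<in> domain_of \<phi> \<Longrightarrow> m - c * norm (z - x0) \<le> ?R z"
    using convex_linear_minorant[OF assms(1-3) x0] by blast
  define C where "C = \<bar>?R x0 + ?r x0 - m + c * norm (x - x0)\<bar>"
  \<comment> \<open>Beyond this radius the quadratic term beats the linear minorant.\<close>
  define \<rho> where "\<rho> = max (norm (x - x0)) (2 * \<gamma> * (c + C) + 1)"
  have lsc: "lower_semicontinuous ?\<Phi>"
    using assms by (intro lower_semicontinuous_add_continuous continuous_intros) (auto simp: proper_def)
  obtain p where p: "p \<in> cball x \<rho>" "\<And>y. y \<in> cball x \<rho> \<Longrightarrow> ?\<Phi> p \<le> ?\<Phi> y"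
    using lower_semicontinuous_attains_min[OF lsc, of "cball x \<rho>"]
    by (auto simp: \<rho>_def le_max_iff_disj)
  have "x0 \<in> cball x \<rho>"
    by (simp add: \<rho>_def dist_norm)
  have "?\<Phi> p \<le> ?\<Phi> y" for y
  proof (cases "y \<in> cball x \<rho> \<or> y \<notin> domain_of \<phi>")
    case True
    then show ?thesis
      using p(2)[of y] by (auto simp: domain_of_def)
  next
    case False
    define s where "s = norm (x - y)"
    have s: "2 * \<gamma> * (c + C) + 1 < s"
      using False by (auto simp: \<rho>_def dist_norm s_def)
    have C0: "0 \<le> C"
      by (simp add: C_def)
    have s1: "1 \<le> s"
      using s mult_nonneg_nonneg[of "2 * \<gamma>" "c + C"] assms(4) c(1) C0 by linarith
    have "norm (y - x0) \<le> s + norm (x - x0)"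
      using norm_triangle_ineq[of "y - x" "x - x0"] by (simp add: s_def norm_minus_commute)
    then have "c * norm (y - x0) \<le> c * s + c * norm (x - x0)"
      using mult_left_mono[OF _ c(1)] by (fastforce simp: algebra_simps)
    then have "m - c * s - c * norm (x - x0) \<le> ?R y"
      using c(2)[of y] False by auto
    moreover have "C \<le> s * (s / (2 * \<gamma>) - c)"
    proof -
      have "c + C \<le> s / (2 * \<gamma>)"
        using s assms(4) by (simp add: field_simps)
      then have "1 * C \<le> s * (s / (2 * \<gamma>) - c)"
        using s1 C0 by (intro mult_mono) auto
      then show ?thesis
        by simp
    qed
    moreover have "s * (s / (2 * \<gamma>) - c) = ?r y - c * s"
      by (simp add: s_def power2_eq_square right_diff_distrib mult.commute)
    moreover have "?R x0 + ?r x0 - m + c * norm (x - x0) \<le> C"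
      unfolding C_def by (rule abs_ge_self)
    ultimately have "?R x0 + ?r x0 \<le> ?R y + ?r y"
      by linarith
    then have "?\<Phi> x0 \<le> ?\<Phi> y"
      using proper_domain_real[OF assms(1) x0] proper_domain_real[OF assms(1), of y] False
      by (metis ereal_less_eq(3) plus_ereal.simps(1))
    then show ?thesis
      using p(2)[OF \<open>x0 \<in> cball x \<rho>\<close>] by (rule order_trans[rotated])
  qed
  then have "is_arg_min ?\<Phi> (\<lambda>_. True) p"
    by (auto simp: is_arg_min_def not_less)
  then have "is_arg_min ?\<Phi> (\<lambda>_. True) (prox \<gamma> \<phi> x)"
    unfolding prox_def arg_min_def by (rule someI)
  then show ?thesis
    by (auto simp: is_arg_min_def not_less)
qed

lemma le_zero_if_le_small_multiples:
  fixes A B :: real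
  assumes "\<And>s. 0 < s \<Longrightarrow> s < 1 \<Longrightarrow> A \<le> s * B"
  shows "A \<le> 0"
proof (rule tendsto_lowerbound)
  show "((\<lambda>s. s * B) \<longlongrightarrow> 0) (at_right 0)"
    by (auto intro!: tendsto_eq_intros)
  show "\<forall>\<^sub>F s in at_right 0. A \<le> s * B"
    unfolding eventually_at_right_field using assms by (intro exI[of _ 1]) auto
qed simp

text \<open>
  The optimality condition of the problem that defines the proximal point: it is compared with the
  points a small fraction \<open>s\<close> of the way towards \<open>y\<close>, where the quadratic term changes linearly up to \<open>O(s\<^sup>2)\<close>.
\<close>

lemma prox_subgradient:
  fixes \<phi> :: "'a::euclidean_space \<Rightarrow> ereal"
  assumes "proper \<phi>" "lower_semicontinuous \<phi>" "ereal_convex \<phi>" "0 < \<gamma>"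
  shows "subgradient \<phi> ((1 / \<gamma>) *\<^sub>R (x - prox \<gamma> \<phi> x)) (prox \<gamma> \<phi> x)"
proof -
  let ?R = "\<lambda>x. real_of_ereal (\<phi> x)"
  define p where "p = prox \<gamma> \<phi> x"
  have min: "\<phi> p + ereal (1 / (2 * \<gamma>) * (norm (x - p))\<^sup>2) \<le> \<phi> z + ereal (1 / (2 * \<gamma>) * (norm (x - z))\<^sup>2)" for z
    unfolding p_def using assms by (rule prox_is_arg_min)
  obtain x0 where x0: "x0 \<in> domain_of \<phi>"
    using assms(1) unfolding proper_def by auto
  have pd: "p \<in> domain_of \<phi>"
    using min[of x0] x0 by (auto simp: domain_of_def)
  have minR: "?R p + 1 / (2 * \<gamma>) * (norm (x - p))\<^sup>2 \<le> ?R z + 1 / (2 * \<gamma>) * (norm (x - z))\<^sup>2"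
    if "z \<in> domain_of \<phi>" for z
    using min[of z] proper_domain_real[OF assms(1) pd] proper_domain_real[OF assms(1) that]
    by (metis ereal_less_eq(3) plus_ereal.simps(1))
  have "subgradient \<phi> ((1 / \<gamma>) *\<^sub>R (x - p)) p"
  proof (rule subgradientI[OF assms(1) pd])
    fix y
    assume y: "y \<in> domain_of \<phi>"
    have "?R p + 1 / \<gamma> * ((x - p) \<bullet> (y - p)) - ?R y \<le> s * (1 / (2 * \<gamma>) * (norm (y - p))\<^sup>2)"
      if s: "0 < s" "s < 1" for s
    proof -
      let ?w = "(1 - s) *\<^sub>R p + s *\<^sub>R y"
      have "?w \<in> domain_of \<phi>"
        using ereal_convex_domain[OF assms(1,3)] pd y s unfolding convex_alt by auto
      then have "?R p + 1 / (2 * \<gamma>) * (norm (x - p))\<^sup>2 \<le> ?R ?w + 1 / (2 * \<gamma>) * (norm (x - ?w))\<^sup>2"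
        by (rule minR)
      also have "?R ?w \<le> (1 - s) * ?R p + s * ?R y"
        using convex_onD[OF ereal_convex_real[OF assms(1,3)], of s p y] pd y s by simp
      finally have *: "s * (?R p - ?R y) \<le> 1 / (2 * \<gamma>) * ((norm (x - ?w))\<^sup>2 - (norm (x - p))\<^sup>2)"
        by (simp add: algebra_simps)
      have "x - ?w = (x - p) - s *\<^sub>R (y - p)"
        by (simp add: algebra_simps)
      then have "(norm (x - ?w))\<^sup>2 - (norm (x - p))\<^sup>2
          = s * (s * (norm (y - p))\<^sup>2 - 2 * ((x - p) \<bullet> (y - p)))"
        by (simp only: power2_norm_eq_inner) (simp add: algebra_simps inner_commute)
      then have "s * (?R p - ?R y)
          \<le> s * (1 / (2 * \<gamma>) * (s * (norm (y - p))\<^sup>2 - 2 * ((x - p) \<bullet> (y - p))))"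
        using * by (simp add: mult.left_commute)
      then have "?R p - ?R y \<le> 1 / (2 * \<gamma>) * (s * (norm (y - p))\<^sup>2 - 2 * ((x - p) \<bullet> (y - p)))"
        by (rule mult_left_le_imp_le[OF _ s(1)])
      moreover have "1 / (2 * \<gamma>) * (s * (norm (y - p))\<^sup>2 - 2 * ((x - p) \<bullet> (y - p)))
          = s * (1 / (2 * \<gamma>) * (norm (y - p))\<^sup>2) - 1 / \<gamma> * ((x - p) \<bullet> (y - p))"
        by (simp add: right_diff_distrib)
      ultimately show ?thesis
        by linarith
    qed
    then have "?R p + 1 / \<gamma> * ((x - p) \<bullet> (y - p)) - ?R y \<le> 0"
      by (rule le_zero_if_le_small_multiples)
    then show "?R p + ((1 / \<gamma>) *\<^sub>R (x - p)) \<bullet> (y - p) \<le> ?R y"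
      by simp
  qed
  then show ?thesis
    by (simp add: p_def)
qed

lemma fenchel_young: "ereal (z \<bullet> u) - \<phi> z \<le> fenchel_conjugate \<phi> u"
  unfolding fenchel_conjugate_def by (rule SUP_upper) simp

lemma fenchel_conjugate_subgradient:
  assumes "proper \<phi>" "subgradient \<phi> u z"
  shows "fenchel_conjugate \<phi> u = ereal (z \<bullet> u - real_of_ereal (\<phi> z))"
proof (rule antisym)
  have z: "\<phi> z = ereal (real_of_ereal (\<phi> z))"
    using proper_domain_real[OF assms(1) subgradient_domain[OF assms(2)]] by simp
  show "ereal (z \<bullet> u - real_of_ereal (\<phi> z)) \<le> fenchel_conjugate \<phi> u"
    using fenchel_young[of z u \<phi>] z by (metis ereal_minus(1))
  show "fenchel_conjugate \<phi> u \<le> ereal (z \<bullet> u - real_of_ereal (\<phi> z))"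
    unfolding fenchel_conjugate_def
  proof (rule SUP_least)
    fix y
    show "ereal (y \<bullet> u) - \<phi> y \<le> ereal (z \<bullet> u - real_of_ereal (\<phi> z))"
    proof (cases "y \<in> domain_of \<phi>")
      case True
      have "y \<bullet> u - real_of_ereal (\<phi> y) \<le> z \<bullet> u - real_of_ereal (\<phi> z)"
        using subgradient_le[OF assms True] by (simp add: inner_diff_right inner_commute)
      then show ?thesis
        using proper_domain_real[OF assms(1) True] by (metis ereal_less_eq(3) ereal_minus(1))
    qed (simp add: domain_of_def)
  qed
qed

lemma fenchel_conjugate_proper:
  assumes "proper \<phi>" "b \<in> domain_of (fenchel_conjugate \<phi>)"
  shows "ereal (real_of_ereal (fenchel_conjugate \<phi> b)) = fenchel_conjugate \<phi> b"
proof -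
  obtain x0 where x0: "x0 \<in> domain_of \<phi>"
    using assms(1) unfolding proper_def by auto
  have "- \<infinity> < ereal (x0 \<bullet> b) - \<phi> x0"
    by (subst proper_domain_real[OF assms(1) x0, symmetric]) simp
  also have "\<dots> \<le> fenchel_conjugate \<phi> b"
    by (rule fenchel_young)
  finally show ?thesis
    using assms(2) by (auto simp: domain_of_def ereal_real)
qed

lemma fenchel_young_real:
  assumes "proper \<phi>" "z \<in> domain_of \<phi>" "b \<in> domain_of (fenchel_conjugate \<phi>)"
  shows "z \<bullet> b - real_of_ereal (\<phi> z) \<le> real_of_ereal (fenchel_conjugate \<phi> b)"
  using fenchel_young[of z b \<phi>] proper_domain_real[OF assms(1,2)] fenchel_conjugate_proper[OF assms(1,3)]
  by (metis ereal_less_eq(3) ereal_minus(1))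

text \<open>
  A supremum of affine functions is convex; in real arithmetic each affine minorant is convexly combined separately.
\<close>

lemma fenchel_conjugate_convex:
  assumes "proper \<phi>"
  shows "convex_on (domain_of (fenchel_conjugate \<phi>)) (\<lambda>u. real_of_ereal (fenchel_conjugate \<phi> u))"
proof -
  let ?c = "fenchel_conjugate \<phi>"
  have *: "(1 - t) *\<^sub>R u + t *\<^sub>R w \<in> domain_of ?c \<and>
      real_of_ereal (?c ((1 - t) *\<^sub>R u + t *\<^sub>R w)) \<le> (1 - t) * real_of_ereal (?c u) + t * real_of_ereal (?c w)"
    if uw: "u \<in> domain_of ?c" "w \<in> domain_of ?c" and t: "0 \<le> t" "t \<le> 1" for u w and t :: real
  proof -
    let ?k = "(1 - t) * real_of_ereal (?c u) + t * real_of_ereal (?c w)"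
    have le: "?c ((1 - t) *\<^sub>R u + t *\<^sub>R w) \<le> ereal ?k"
      unfolding fenchel_conjugate_def[of \<phi> "(1 - t) *\<^sub>R u + t *\<^sub>R w"]
    proof (rule SUP_least)
      fix y
      show "ereal (y \<bullet> ((1 - t) *\<^sub>R u + t *\<^sub>R w)) - \<phi> y \<le> ereal ?k"
      proof (cases "y \<in> domain_of \<phi>")
        case True
        have "(1 - t) * (y \<bullet> u - real_of_ereal (\<phi> y)) + t * (y \<bullet> w - real_of_ereal (\<phi> y)) \<le> ?k"
          using t fenchel_young_real[OF assms True] uw by (intro add_mono mult_left_mono) auto
        then have "y \<bullet> ((1 - t) *\<^sub>R u + t *\<^sub>R w) - real_of_ereal (\<phi> y) \<le> ?k"
          by (simp add: algebra_simps)
        then show ?thesis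
          using proper_domain_real[OF assms True] by (metis ereal_less_eq(3) ereal_minus(1))
      qed (simp add: domain_of_def)
    qed
    then have "?c ((1 - t) *\<^sub>R u + t *\<^sub>R w) < \<infinity>"
      by (rule order.strict_trans1) simp
    then have d: "(1 - t) *\<^sub>R u + t *\<^sub>R w \<in> domain_of ?c"
      by (simp add: domain_of_def)
    then show ?thesis
      using le fenchel_conjugate_proper[OF assms d] by (metis ereal_less_eq(3))
  qed
  show ?thesis
    using * by (intro convex_onI) (auto simp: convex_alt)
qed

lemma lagrangian_real:
  assumes "proper g" "proper h" "a \<in> domain_of g" "b \<in> domain_of (fenchel_conjugate h)"
  shows "lagrangian f g h a b
    = ereal (f a + real_of_ereal (g a) + a \<bullet> b - real_of_ereal (fenchel_conjugate h b))"
proof -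
  obtain r s where "g a = ereal r" "fenchel_conjugate h b = ereal s"
    using proper_domain_real[OF assms(1,3), symmetric] fenchel_conjugate_proper[OF assms(2,4), symmetric]
    by blast
  then show ?thesis
    by (simp add: lagrangian_def)
qed

lemma ereal_lipschitz_finite:
  assumes "ereal_lipschitz \<beta> h"
  shows "domain_of h = UNIV" "proper h"
proof -
  have "h x < \<infinity> \<and> h x \<noteq> - \<infinity>" for x
    using assms by (cases "h x") (auto simp: ereal_lipschitz_def dest: spec[of _ x])
  then show "domain_of h = UNIV" "proper h"
    by (auto simp: domain_of_def proper_def)
qed

lemma subgradient_norm_le_lipschitz:
  fixes h :: "'a::real_inner \<Rightarrow> ereal"
  assumes "ereal_lipschitz \<beta> h" "subgradient h s p"
  shows "norm s \<le> \<beta>"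
proof -
  let ?H = "\<lambda>x. real_of_ereal (h x)"
  have lip: "\<beta>-lipschitz_on UNIV ?H"
    using assms(1) by (simp add: ereal_lipschitz_def)
  have "?H p + s \<bullet> (p + s - p) \<le> ?H (p + s)"
    using ereal_lipschitz_finite[OF assms(1)] assms(2) by (intro subgradient_le) auto
  moreover have "\<bar>?H (p + s) - ?H p\<bar> \<le> \<beta> * norm s"
    using lipschitz_onD[OF lip, of "p + s" p] by (simp add: dist_norm)
  ultimately have "norm s * norm s \<le> \<beta> * norm s"
    by (simp add: power2_norm_eq_inner[symmetric] power2_eq_square)
  then show ?thesis
    using lipschitz_on_nonneg[OF lip] by (cases "s = 0") auto
qed

section \<open>Multipliers at a minimizer\<close>

text \<open>
  The Moreau-Rockafellar theorem at a minimizer. Minimality of \<open>p\<close> says that the origin is outside the convex set of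
  pairs \<open>(y - z, r)\<close> with \<open>\<phi>(y) + \<theta>(z) - \<phi>(p) - \<theta>(p) < r\<close>. A separating functional \<open>(w, s)\<close> with \<open>s > 0\<close> gives the
  multiplier \<open>w/s\<close>: fixing \<open>z = p\<close> or \<open>y = p\<close> yields the two subgradient inequalities. Choosing the functional in the
  span of the set makes the separation proper, and this is what rules out \<open>s = 0\<close> under the relative interior
  condition.
\<close>

lemma minimizer_of_sum_subgradients:
  fixes \<phi> \<theta> :: "'a::euclidean_space \<Rightarrow> ereal"
  assumes \<phi>: "proper \<phi>" "ereal_convex \<phi>" and \<theta>: "proper \<theta>" "ereal_convex \<theta>"
    and ri: "rel_interior (domain_of \<phi>) \<inter> rel_interior (domain_of \<theta>) \<noteq> {}"
    and p: "p \<in> domain_of \<phi>" "p \<in> domain_of \<theta>"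
    and min: "\<And>y. y \<in> domain_of \<phi> \<Longrightarrow> y \<in> domain_of \<theta> \<Longrightarrow>
      real_of_ereal (\<phi> p) + real_of_ereal (\<theta> p) \<le> real_of_ereal (\<phi> y) + real_of_ereal (\<theta> y)"
  obtains u where "subgradient \<phi> (- u) p" "subgradient \<theta> u p"
proof -
  define gap where "gap = (\<lambda>y z. real_of_ereal (\<phi> y) + real_of_ereal (\<theta> z)
    - (real_of_ereal (\<phi> p) + real_of_ereal (\<theta> p)))"
  define C where "C = {(y - z, r) | y z r. y \<in> domain_of \<phi> \<and> z \<in> domain_of \<theta> \<and> gap y z < r}"
  have dom_convex: "convex (domain_of \<phi>)" "convex (domain_of \<theta>)"
    using \<phi> \<theta> ereal_convex_domain by auto
  have gap_convex: "gap ((1 - t) *\<^sub>R y + t *\<^sub>R y') ((1 - t) *\<^sub>R z + t *\<^sub>R z')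
      \<le> (1 - t) * gap y z + t * gap y' z'"
    if "y \<in> domain_of \<phi>" "y' \<in> domain_of \<phi>" "z \<in> domain_of \<theta>" "z' \<in> domain_of \<theta>" "0 \<le> t" "t \<le> 1"
    for y y' z z' and t :: real
    using convex_onD[OF ereal_convex_real[OF \<phi>], of t y y']
      convex_onD[OF ereal_convex_real[OF \<theta>], of t z z'] that
    by (simp add: gap_def algebra_simps)
  have "convex C"
    unfolding convex_alt
  proof (intro ballI allI impI)
    fix c c' and t :: real
    assume "c \<in> C" "c' \<in> C" and t: "0 \<le> t \<and> t \<le> 1"
    then obtain y z r y' z' r' where c: "c = (y - z, r)" "y \<in> domain_of \<phi>" "z \<in> domain_of \<theta>" "gap y z < r"
      and c': "c' = (y' - z', r')" "y' \<in> domain_of \<phi>" "z' \<in> domain_of \<theta>" "gap y' z' < r'"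
      unfolding C_def by blast
    let ?y = "(1 - t) *\<^sub>R y + t *\<^sub>R y'" and ?z = "(1 - t) *\<^sub>R z + t *\<^sub>R z'"
    have "gap ?y ?z \<le> (1 - t) * gap y z + t * gap y' z'"
      using c c' t by (intro gap_convex) auto
    also have "\<dots> < (1 - t) * r + t * r'"
    proof (cases "t = 0")
      case False
      then have "t * gap y' z' < t * r'"
        using t c'(4) by simp
      moreover have "(1 - t) * gap y z \<le> (1 - t) * r"
        using t c(4) by (intro mult_left_mono) auto
      ultimately show ?thesis
        by linarith
    qed (use c in simp)
    finally have "gap ?y ?z < (1 - t) * r + t * r'" .
    moreover have "?y \<in> domain_of \<phi>" "?z \<in> domain_of \<theta>"
      using dom_convex c c' t unfolding convex_alt by blast+
    moreover have "(1 - t) *\<^sub>R c + t *\<^sub>R c' = (?y - ?z, (1 - t) * r + t * r')"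
      by (simp add: c(1) c'(1) algebra_simps)
    ultimately show "(1 - t) *\<^sub>R c + t *\<^sub>R c' \<in> C"
      unfolding C_def by blast
  qed
  moreover have "(p - p, 1) \<in> C"
    unfolding C_def using p by (force simp: gap_def)
  moreover have "0 \<notin> C"
    unfolding C_def using min by (auto simp: zero_prod_def gap_def not_less)
  ultimately obtain a where a: "a \<in> span C" "a \<noteq> 0" "\<And>c. c \<in> C \<Longrightarrow> 0 \<le> a \<bullet> c"
    using separating_hyperplane_set_0_inspan[of C] by blast
  obtain w s where ws: "a = (w, s)"
    by (cases a)
  have sep: "0 \<le> w \<bullet> (y - z) + s * r"
    if "y \<in> domain_of \<phi>" "z \<in> domain_of \<theta>" "gap y z < r" for y z r
    using a(3)[of "(y - z, r)"] that unfolding C_def ws by (auto simp: inner_prod_def)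
  have "0 \<le> s"
    using sep[of p p 1] p by (simp add: gap_def)
  moreover have "s \<noteq> 0"
  proof
    assume s0: "s = 0"
    obtain x0 where x0: "x0 \<in> rel_interior (domain_of \<phi>)" "x0 \<in> rel_interior (domain_of \<theta>)"
      using ri by blast
    then have x0d: "x0 \<in> domain_of \<phi>" "x0 \<in> domain_of \<theta>"
      using rel_interior_subset by blast+
    have wpos: "0 \<le> w \<bullet> (y - z)" if "y \<in> domain_of \<phi>" "z \<in> domain_of \<theta>" for y z
      using sep[OF that, of "gap y z + 1"] s0 by simp
    \<comment> \<open>Both domains can be prolonged beyond \<open>x0\<close>, so the separating functional vanishes on them.\<close>
    have w\<phi>: "w \<bullet> (y - x0) = 0" if y: "y \<in> domain_of \<phi>" for y
    proof -
      obtain e where e: "1 < e" "(1 - e) *\<^sub>R y + e *\<^sub>R x0 \<in> domain_of \<phi>"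
        using convex_rel_interior_iff[OF dom_convex(1), of x0] x0(1) y by blast
      have "(1 - e) *\<^sub>R y + e *\<^sub>R x0 - x0 = (1 - e) *\<^sub>R (y - x0)"
        by (simp add: algebra_simps)
      then have "0 \<le> (1 - e) * (w \<bullet> (y - x0))"
        using wpos[OF e(2) x0d(2)] by simp
      then have "w \<bullet> (y - x0) \<le> 0"
        using e(1) by (simp add: zero_le_mult_iff)
      then show ?thesis
        using wpos[OF y x0d(2)] by simp
    qed
    have w\<theta>: "w \<bullet> (x0 - z) = 0" if z: "z \<in> domain_of \<theta>" for z
    proof -
      obtain e where e: "1 < e" "(1 - e) *\<^sub>R z + e *\<^sub>R x0 \<in> domain_of \<theta>"
        using convex_rel_interior_iff[OF dom_convex(2), of x0] x0(2) z by blast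
      have "x0 - ((1 - e) *\<^sub>R z + e *\<^sub>R x0) = (1 - e) *\<^sub>R (x0 - z)"
        by (simp add: algebra_simps)
      then have "0 \<le> (1 - e) * (w \<bullet> (x0 - z))"
        using wpos[OF x0d(1) e(2)] by simp
      then have "w \<bullet> (x0 - z) \<le> 0"
        using e(1) by (simp add: zero_le_mult_iff)
      then show ?thesis
        using wpos[OF x0d(1) z] by simp
    qed
    have "orthogonal a c" if "c \<in> C" for c
    proof -
      obtain y z r where c: "c = (y - z, r)" "y \<in> domain_of \<phi>" "z \<in> domain_of \<theta>"
        using \<open>c \<in> C\<close> unfolding C_def by auto
      have "w \<bullet> (y - z) = w \<bullet> (y - x0) + w \<bullet> (x0 - z)"
        by (simp add: algebra_simps)
      then show ?thesis
        using w\<phi>[OF c(2)] w\<theta>[OF c(3)] by (simp add: orthogonal_def ws c(1) s0 inner_prod_def)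
    qed
    then have "orthogonal a a"
      using orthogonal_to_span[OF a(1)] by blast
    then show False
      using a(2) by (simp add: orthogonal_self)
  qed
  ultimately have s: "0 < s"
    by simp
  have sep0: "- ((1 / s) *\<^sub>R w \<bullet> (y - z)) \<le> gap y z" if yz: "y \<in> domain_of \<phi>" "z \<in> domain_of \<theta>" for y z
  proof -
    have "- (w \<bullet> (y - z) + s * gap y z) \<le> t * s" if "0 < t" "t < 1" for t
      using sep[OF yz, of "gap y z + t"] that by (simp add: algebra_simps)
    then have "- (w \<bullet> (y - z) + s * gap y z) \<le> 0"
      by (rule le_zero_if_le_small_multiples)
    then show ?thesis
      using s by (simp add: field_simps)
  qed
  show ?thesis
  proof (rule that[of "(1 / s) *\<^sub>R w"])
    show "subgradient \<phi> (- ((1 / s) *\<^sub>R w)) p"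
      using sep0[OF _ p(2)] by (intro subgradientI \<phi> p) (force simp: gap_def)
    show "subgradient \<theta> ((1 / s) *\<^sub>R w) p"
    proof (intro subgradientI \<theta> p)
      fix z
      assume "z \<in> domain_of \<theta>"
      moreover have "- ((1 / s) *\<^sub>R w \<bullet> (p - z)) = (1 / s) *\<^sub>R w \<bullet> (z - p)"
        by (simp add: inner_diff_right diff_divide_distrib)
      ultimately show "real_of_ereal (\<theta> p) + ((1 / s) *\<^sub>R w) \<bullet> (z - p) \<le> real_of_ereal (\<theta> z)"
        using sep0[OF p(1), of z] by (simp add: gap_def)
    qed
  qed
qed

lemma composite_minimizer_real:
  fixes f :: "'a \<Rightarrow> real" and g h :: "'a \<Rightarrow> ereal"
  assumes g: "proper g" and h: "proper h" and x0: "x0 \<in> domain_of g" "x0 \<in> domain_of h"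
    and min: "is_arg_min (\<lambda>a. ereal (f a) + g a + h a) (\<lambda>_. True) p"
  shows "p \<in> domain_of g" "p \<in> domain_of h"
    and "\<And>y. y \<in> domain_of g \<Longrightarrow> y \<in> domain_of h \<Longrightarrow>
      f p + real_of_ereal (g p) + real_of_ereal (h p) \<le> f y + real_of_ereal (g y) + real_of_ereal (h y)"
proof -
  have minP: "ereal (f p) + g p + h p \<le> ereal (f y) + g y + h y" for y
    using min by (auto simp: is_arg_min_def not_less)
  have "ereal (f x0) + g x0 + h x0 < \<infinity>"
    using x0 by (simp add: domain_of_def)
  then have "ereal (f p) + g p + h p < \<infinity>"
    using minP[of x0] by (rule order.strict_trans1[rotated])
  then show p: "p \<in> domain_of g" "p \<in> domain_of h"
    using g h by (auto simp: domain_of_def proper_def)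
  fix y
  assume y: "y \<in> domain_of g" "y \<in> domain_of h"
  obtain a b c d where e: "g p = ereal a" "h p = ereal b" "g y = ereal c" "h y = ereal d"
    using proper_domain_real[OF g p(1), symmetric] proper_domain_real[OF h p(2), symmetric]
      proper_domain_real[OF g y(1), symmetric] proper_domain_real[OF h y(2), symmetric]
    by blast
  show "f p + real_of_ereal (g p) + real_of_ereal (h p) \<le> f y + real_of_ereal (g y) + real_of_ereal (h y)"
    using minP[of y] by (simp add: e)
qed

text \<open>
  A minimizer remains one after the smooth term is replaced by its linearization: moving a fraction \<open>t\<close> towards
  another point changes the smooth term by its linearization up to \<open>O(t\<^sup>2)\<close>, while the convex terms change at most
  linearly in \<open>t\<close>.
\<close>

lemma minimizer_with_smooth_term_subgradients:
  fixes f :: "'a::euclidean_space \<Rightarrow> real" and g h :: "'a \<Rightarrow> ereal"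
  assumes f: "smooth L f"
    and g: "proper g" "ereal_convex g" and h: "proper h" "ereal_convex h"
    and ri: "rel_interior (domain_of g) \<inter> rel_interior (domain_of h) \<noteq> {}"
    and min: "is_arg_min (\<lambda>a. ereal (f a) + g a + h a) (\<lambda>_. True) p"
  obtains u where "subgradient g (- (u + gradient f p)) p" "subgradient h u p"
proof -
  let ?G = "\<lambda>x. real_of_ereal (g x)" and ?H = "\<lambda>x. real_of_ereal (h x)"
  let ?c = "gradient f p"
  obtain x0 where x0: "x0 \<in> domain_of g" "x0 \<in> domain_of h"
    using ri rel_interior_subset by blast
  note p = composite_minimizer_real(1,2)[OF g(1) h(1) x0 min]
  note minR = composite_minimizer_real(3)[OF g(1) h(1) x0 min]
  define \<phi> where "\<phi> = (\<lambda>x. g x + ereal (?c \<bullet> x))"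
  have dom: "domain_of \<phi> = domain_of g"
    by (auto simp: domain_of_def \<phi>_def)
  have \<phi>: "proper \<phi>"
    using g(1) unfolding proper_def dom by (auto simp: \<phi>_def)
  have R\<phi>: "real_of_ereal (\<phi> x) = ?G x + ?c \<bullet> x" if "x \<in> domain_of g" for x
    unfolding \<phi>_def by (subst proper_domain_real[OF g(1) that, symmetric]) simp
  have "ereal_convex \<phi>"
    unfolding ereal_convex_def
  proof (intro allI impI)
    fix x y and a b :: real
    assume ab: "0 \<le> a" "0 \<le> b" "a + b = 1"
    have "g (a *\<^sub>R x + b *\<^sub>R y) \<le> ereal a * g x + ereal b * g y"
      using g(2) ab unfolding ereal_convex_def by blast
    then have "\<phi> (a *\<^sub>R x + b *\<^sub>R y) \<le> ereal a * g x + ereal b * g y + ereal (?c \<bullet> (a *\<^sub>R x + b *\<^sub>R y))"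
      unfolding \<phi>_def by (rule add_right_mono)
    also have "\<dots> = ereal a * \<phi> x + ereal b * \<phi> y"
      unfolding \<phi>_def using g(1) ab
      by (cases "g x"; cases "g y"; cases "a = 0"; cases "b = 0") (auto simp: proper_def algebra_simps)
    finally show "\<phi> (a *\<^sub>R x + b *\<^sub>R y) \<le> ereal a * \<phi> x + ereal b * \<phi> y" .
  qed
  moreover have "real_of_ereal (\<phi> p) + ?H p \<le> real_of_ereal (\<phi> y) + ?H y"
    if y: "y \<in> domain_of \<phi>" "y \<in> domain_of h" for y
  proof -
    have yg: "y \<in> domain_of g"
      using y(1) dom by simp
    have "?G p + ?H p - (?c \<bullet> (y - p) + ?G y + ?H y) \<le> t * (L / 2 * (norm (y - p))\<^sup>2)"
      if t: "0 < t" "t < 1" for t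
    proof -
      let ?w = "(1 - t) *\<^sub>R p + t *\<^sub>R y"
      have wp: "?w - p = t *\<^sub>R (y - p)"
        by (simp add: algebra_simps)
      have "f ?w \<le> f p + ?c \<bullet> (?w - p) + L / 2 * (norm (?w - p))\<^sup>2"
        using f by (rule smooth_upper_bound)
      then have fw: "f ?w \<le> f p + t * (?c \<bullet> (y - p)) + t * (t * (L / 2 * (norm (y - p))\<^sup>2))"
        unfolding wp by (simp add: power_mult_distrib power2_eq_square mult_ac)
      have "?w \<in> domain_of g" "?w \<in> domain_of h"
        using ereal_convex_domain[OF g] ereal_convex_domain[OF h] p y yg t unfolding convex_alt by auto
      then have "f p + ?G p + ?H p \<le> f ?w + ?G ?w + ?H ?w"
        by (rule minR)
      moreover have "?G ?w \<le> (1 - t) * ?G p + t * ?G y"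
        using convex_onD[OF ereal_convex_real[OF g], of t p y] p yg t by simp
      moreover have "?H ?w \<le> (1 - t) * ?H p + t * ?H y"
        using convex_onD[OF ereal_convex_real[OF h], of t p y] p y t by simp
      ultimately have "t * (?G p + ?H p - (?c \<bullet> (y - p) + ?G y + ?H y))
          \<le> t * (t * (L / 2 * (norm (y - p))\<^sup>2))"
        using fw by (simp add: algebra_simps)
      then show ?thesis
        by (rule mult_left_le_imp_le[OF _ t(1)])
    qed
    then have "?G p + ?H p - (?c \<bullet> (y - p) + ?G y + ?H y) \<le> 0"
      by (rule le_zero_if_le_small_multiples)
    then show ?thesis
      using R\<phi>[OF p(1)] R\<phi>[OF yg] by (simp add: inner_diff_right)
  qed
  ultimately obtain u where u: "subgradient \<phi> (- u) p" "subgradient h u p"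
    using minimizer_of_sum_subgradients[OF \<phi> _ h, of p] ri p unfolding dom by blast
  have "subgradient g (- (u + ?c)) p"
  proof (rule subgradientI[OF g(1) p(1)])
    fix y
    assume y: "y \<in> domain_of g"
    have "real_of_ereal (\<phi> p) + (- u) \<bullet> (y - p) \<le> real_of_ereal (\<phi> y)"
      using subgradient_le[OF \<phi> u(1)] y dom by simp
    then show "?G p + (- (u + ?c)) \<bullet> (y - p) \<le> ?G y"
      using R\<phi>[OF p(1)] R\<phi>[OF y] by (simp add: algebra_simps)
  qed
  with u(2) show ?thesis
    using that by blast
qed

section \<open>Expectations along the index process\<close>

locale index_process = prob_space M for M :: "'w measure" +
  fixes n :: nat and q :: real and I :: "nat \<Rightarrow> 'w \<Rightarrow> nat" and J :: "nat \<Rightarrow> 'w \<Rightarrow> nat set"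
  assumes n: "1 \<le> n"
    and sampling: "uniform_sampling M n I J"
    and memorization: "uniform_memorization M n q I J"
begin

text \<open>
  Measurability with respect to the past. Since the history takes finitely many values, every function of it is simple,
  so it suffices to ask that equal histories give equal values, for values in an arbitrary type.
\<close>

definition adapted :: "nat \<Rightarrow> ('w \<Rightarrow> 'b) \<Rightarrow> bool" where
  "adapted t F \<longleftrightarrow>
     (\<forall>\<xi>\<in>space M. \<forall>\<eta>\<in>space M. history I J t \<xi> = history I J t \<eta> \<longrightarrow> F \<xi> = F \<eta>)"

lemma history_Suc_eq:
  "history I J (Suc t) \<xi> = history I J (Suc t) \<eta> \<longleftrightarrow>
     history I J t \<xi> = history I J t \<eta> \<and> I t \<xi> = I t \<eta> \<and> J t \<xi> = J t \<eta>"
  unfolding history_def fun_eq_iff restrict_def by (auto simp: less_Suc_eq)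

lemma I_measurable: "I t \<in> measurable M (count_space {1..n})"
  using sampling unfolding uniform_sampling_def by blast

lemma J_measurable: "J t \<in> measurable M (count_space (Pow {1..n}))"
  using memorization unfolding uniform_memorization_def by blast

lemma I_range: "\<xi> \<in> space M \<Longrightarrow> I t \<xi> \<in> {1..n}"
  using measurable_space[OF I_measurable] by simp

lemma J_range: "\<xi> \<in> space M \<Longrightarrow> J t \<xi> \<subseteq> {1..n}"
  using measurable_space[OF J_measurable] by auto

lemma history_range: "\<xi> \<in> space M \<Longrightarrow> history I J t \<xi> \<in> (\<Pi>\<^sub>E s\<in>{..<t}. {1..n} \<times> Pow {1..n})"
  unfolding history_def using I_range J_range by auto

lemma finite_histories: "finite (history I J t ` space M)"
proof (rule finite_subset)
  show "history I J t ` space M \<subseteq> (\<Pi>\<^sub>E s\<in>{..<t}. {1..n} \<times> Pow {1..n})"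
    using history_range by auto
qed (auto intro!: finite_PiE)

definition atom :: "nat \<Rightarrow> (nat \<Rightarrow> nat \<times> nat set) \<Rightarrow> 'w set" where
  "atom t s = {\<xi> \<in> space M. history I J t \<xi> = s}"

lemma past_indep:
  "indep_set (sets (vimage_algebra (space M) (I t) (count_space {1..n}))) (sets (past_algebra M n I J t))"
  using sampling unfolding uniform_sampling_def by blast

lemma past_events: "sets (past_algebra M n I J t) \<subseteq> events"
  using past_indep by (rule indep_setD_ev2)

lemma atom_past:
  assumes "s \<in> history I J t ` space M"
  shows "atom t s \<in> sets (past_algebra M n I J t)"
proof -
  have s: "s \<in> (\<Pi>\<^sub>E s\<in>{..<t}. {1..n} \<times> Pow {1..n})"
    using assms history_range by auto
  have "(\<Pi>\<^sub>E i\<in>{..<t}. {s i}) \<in> sets (history_space n t)"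
    unfolding history_space_def using s by (intro sets_PiM_I_finite) (auto dest: PiE_mem)
  moreover have "(\<Pi>\<^sub>E i\<in>{..<t}. {s i}) = {s}"
    using s by (intro PiE_singleton) (auto simp: PiE_def)
  ultimately have "{s} \<in> sets (history_space n t)"
    by simp
  then have "history I J t -` {s} \<inter> space M \<in> sets (past_algebra M n I J t)"
    unfolding past_algebra_def by (rule in_vimage_algebra)
  also have "history I J t -` {s} \<inter> space M = atom t s"
    by (auto simp: atom_def)
  finally show ?thesis .
qed

lemma adapted_Suc: "adapted t F \<Longrightarrow> adapted (Suc t) F"
  unfolding adapted_def history_Suc_eq by blast

lemma adapted_expansion:
  fixes F :: "'w \<Rightarrow> real"
  assumes "adapted t F"
  obtains c where "\<And>\<xi>. \<xi> \<in> space M \<Longrightarrow>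
    F \<xi> = (\<Sum>s\<in>history I J t ` space M. c s * indicator (atom t s) \<xi>)"
proof (rule that)
  fix \<xi>
  assume \<xi>: "\<xi> \<in> space M"
  let ?c = "\<lambda>s. F (SOME \<eta>. \<eta> \<in> space M \<and> history I J t \<eta> = s)"
  have "(\<Sum>s\<in>history I J t ` space M. ?c s * indicator (atom t s) \<xi>)
      = (\<Sum>s\<in>{history I J t \<xi>}. ?c s * indicator (atom t s) \<xi>)"
    using \<xi> finite_histories by (intro sum.mono_neutral_right) (auto simp: atom_def)
  also have "\<dots> = ?c (history I J t \<xi>)"
    using \<xi> by (simp add: atom_def)
  also have "\<dots> = F \<xi>"
    using assms \<xi> someI[of "\<lambda>\<eta>. \<eta> \<in> space M \<and> history I J t \<eta> = history I J t \<xi>" \<xi>]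
    unfolding adapted_def by blast
  finally show "F \<xi> = (\<Sum>s\<in>history I J t ` space M. ?c s * indicator (atom t s) \<xi>)" ..
qed

lemma integrable_adapted:
  fixes F :: "'w \<Rightarrow> real"
  assumes "adapted t F"
  shows "integrable M F"
proof -
  obtain c where c: "\<And>\<xi>. \<xi> \<in> space M \<Longrightarrow>
      F \<xi> = (\<Sum>s\<in>history I J t ` space M. c s * indicator (atom t s) \<xi>)"
    using adapted_expansion[OF assms] by blast
  have "integrable M (\<lambda>\<xi>. \<Sum>s\<in>history I J t ` space M. c s * indicator (atom t s) \<xi>)"
    using atom_past past_events
    by (intro Bochner_Integration.integrable_sum integrable_mult_right integrable_real_indicator)
      (auto simp: less_top[symmetric])
  then show ?thesis
    using c by (subst Bochner_Integration.integrable_cong[OF refl]) auto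
qed

text \<open>
  Independence of the past enters only through its atoms, so one argument serves both the sampled
  index and the memorized index sets.
\<close>

lemma expectation_indicator_adapted:
  fixes F :: "'w \<Rightarrow> real"
  assumes "adapted t F" and B: "B \<in> events"
    and indep: "\<And>A. A \<in> sets (past_algebra M n I J t) \<Longrightarrow> prob (A \<inter> B) = c * prob A"
  shows "integrable M (\<lambda>\<xi>. indicator B \<xi> * F \<xi>)"
    and "expectation (\<lambda>\<xi>. indicator B \<xi> * F \<xi>) = c * expectation F"
proof -
  obtain d where d: "\<And>\<xi>. \<xi> \<in> space M \<Longrightarrow>
      F \<xi> = (\<Sum>s\<in>history I J t ` space M. d s * indicator (atom t s) \<xi>)"
    using adapted_expansion[OF assms(1)] by blast
  have ev: "atom t s \<in> events" if "s \<in> history I J t ` space M" for s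
    using atom_past[OF that] past_events by blast
  have int: "integrable M (indicator A :: 'w \<Rightarrow> real)" if "A \<in> events" for A
    using that by (intro integrable_real_indicator) (auto simp: less_top[symmetric])
  show "integrable M (\<lambda>\<xi>. indicator B \<xi> * F \<xi>)"
    using integrable_mult_indicator[OF B integrable_adapted[OF assms(1)]] by simp
  have "expectation (\<lambda>\<xi>. indicator B \<xi> * F \<xi>)
      = expectation (\<lambda>\<xi>. \<Sum>s\<in>history I J t ` space M. d s * indicator (atom t s \<inter> B) \<xi>)"
    using d by (intro Bochner_Integration.integral_cong refl)
      (auto simp: sum_distrib_left indicator_inter_arith ac_simps)
  also have "\<dots> = (\<Sum>s\<in>history I J t ` space M. d s * prob (atom t s \<inter> B))"
    using ev B int by (subst Bochner_Integration.integral_sum) (auto intro!: sum.cong)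
  also have "\<dots> = c * (\<Sum>s\<in>history I J t ` space M. d s * prob (atom t s))"
    by (simp add: sum_distrib_left indep[OF atom_past] mult.left_commute)
  also have "(\<Sum>s\<in>history I J t ` space M. d s * prob (atom t s))
      = expectation (\<lambda>\<xi>. \<Sum>s\<in>history I J t ` space M. d s * indicator (atom t s) \<xi>)"
    using ev int by (subst Bochner_Integration.integral_sum) (auto intro!: sum.cong)
  also have "\<dots> = expectation F"
    using d by (intro Bochner_Integration.integral_cong refl) auto
  finally show "expectation (\<lambda>\<xi>. indicator B \<xi> * F \<xi>) = c * expectation F" .
qed

text \<open>
  The sampled index may be averaged out first, because the family it selects from depends only on the past.
\<close>

lemma expectation_sampled:
  fixes F :: "nat \<Rightarrow> 'w \<Rightarrow> real"
  assumes "\<And>i. i \<in> {1..n} \<Longrightarrow> adapted t (F i)"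
  shows "expectation (\<lambda>\<xi>. F (I t \<xi>) \<xi>) = expectation (\<lambda>\<xi>. (1 / real n) * (\<Sum>i=1..n. F i \<xi>))"
proof -
  define B where "B = (\<lambda>i. I t -` {i} \<inter> space M)"
  have B: "B i \<in> events" if "i \<in> {1..n}" for i
    unfolding B_def using that by (intro measurable_sets[OF I_measurable]) auto
  have indep: "prob (A \<inter> B i) = 1 / real n * prob A"
    if A: "A \<in> sets (past_algebra M n I J t)" and i: "i \<in> {1..n}" for A i
  proof -
    have "prob (B i) = measure (distr M (count_space {1..n}) (I t)) {i}"
      unfolding B_def using i by (subst measure_distr[OF I_measurable]) auto
    also have "distr M (count_space {1..n}) (I t) = uniform_count_measure {1..n}"
      using sampling unfolding uniform_sampling_def by blast
    also have "measure (uniform_count_measure {1..n}) {i} = 1 / real n"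
      using i by (subst measure_uniform_count_measure) auto
    finally have Bi: "prob (B i) = 1 / real n" .
    have "B i \<in> sets (vimage_algebra (space M) (I t) (count_space {1..n}))"
      unfolding B_def using i by (intro in_vimage_algebra) auto
    from indep_setD[OF past_indep this A] show ?thesis
      using Bi by (simp add: Int_commute)
  qed
  have "expectation (\<lambda>\<xi>. F (I t \<xi>) \<xi>) = expectation (\<lambda>\<xi>. \<Sum>i=1..n. indicator (B i) \<xi> * F i \<xi>)"
  proof (intro Bochner_Integration.integral_cong refl)
    fix \<xi>
    assume \<xi>: "\<xi> \<in> space M"
    have "(\<Sum>i=1..n. indicator (B i) \<xi> * F i \<xi>) = (\<Sum>i\<in>{I t \<xi>}. indicator (B i) \<xi> * F i \<xi>)"
      using I_range[OF \<xi>] by (intro sum.mono_neutral_right) (auto simp: B_def)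
    then show "F (I t \<xi>) \<xi> = (\<Sum>i=1..n. indicator (B i) \<xi> * F i \<xi>)"
      using \<xi> by (simp add: B_def)
  qed
  also have "\<dots> = (\<Sum>i=1..n. expectation (\<lambda>\<xi>. indicator (B i) \<xi> * F i \<xi>))"
    using expectation_indicator_adapted(1)[OF assms B indep]
    by (intro Bochner_Integration.integral_sum) auto
  also have "\<dots> = (\<Sum>i=1..n. 1 / real n * expectation (F i))"
    using expectation_indicator_adapted(2)[OF assms B indep] by (intro sum.cong) auto
  also have "\<dots> = (1 / real n) * expectation (\<lambda>\<xi>. \<Sum>i=1..n. F i \<xi>)"
    using assms integrable_adapted
    by (subst Bochner_Integration.integral_sum) (auto simp: sum_distrib_left)
  also have "\<dots> = expectation (\<lambda>\<xi>. (1 / real n) * (\<Sum>i=1..n. F i \<xi>))"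
    by simp
  finally show ?thesis .
qed

lemma expectation_memorized:
  fixes F :: "'w \<Rightarrow> real"
  assumes "adapted t F" "j \<in> {1..n}"
  shows "expectation (\<lambda>\<xi>. if j \<in> J t \<xi> then F \<xi> else 0) = q / real n * expectation F"
proof -
  define B where "B = {\<xi> \<in> space M. j \<in> J t \<xi>}"
  have "B = J t -` {S \<in> Pow {1..n}. j \<in> S} \<inter> space M"
    using J_range by (auto simp: B_def)
  also have "\<dots> \<in> events"
    by (intro measurable_sets[OF J_measurable]) auto
  finally have B: "B \<in> events" .
  have "subalgebra M (past_algebra M n I J t)"
    unfolding subalgebra_def using past_events by (simp add: past_algebra_def)
  then interpret sub: finite_measure_subalgebra M "past_algebra M n I J t"
    by unfold_locales
  have indep: "prob (A \<inter> B) = q / real n * prob A" if A: "A \<in> sets (past_algebra M n I J t)" for A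
  proof -
    have AE: "A \<in> events"
      using A past_events by blast
    have sub: "A \<inter> B \<inter> space M = A \<inter> B" "A \<inter> space M = A"
      using AE sets.sets_into_space by blast+
    have "prob (A \<inter> B) = expectation (indicator (A \<inter> B))"
      by (simp add: sub)
    also have "\<dots> = (\<integral>\<xi>\<in>A. indicator B \<xi> \<partial>M)"
      unfolding set_lebesgue_integral_def indicator_inter_arith by simp
    also have "\<dots> = (\<integral>\<xi>\<in>A. real_cond_exp M (past_algebra M n I J t) (indicator B) \<xi> \<partial>M)"
      using B A by (intro sub.real_cond_exp_intA integrable_real_indicator) (auto simp: less_top[symmetric])
    also have "\<dots> = (\<integral>\<xi>\<in>A. q / real n \<partial>M)"
    proof -
      have "AE \<xi> in M. real_cond_exp M (past_algebra M n I J t) (indicator B) \<xi> = q / real n"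
        using memorization assms(2) unfolding uniform_memorization_def B_def by blast
      then show ?thesis
        unfolding set_lebesgue_integral_def using AE
        by (intro integral_cong_AE) (auto intro: borel_measurable_scaleR)
    qed
    also have "\<dots> = q / real n * prob A"
      by (simp add: set_lebesgue_integral_def sub mult.commute)
    finally show ?thesis .
  qed
  have "expectation (\<lambda>\<xi>. if j \<in> J t \<xi> then F \<xi> else 0) = expectation (\<lambda>\<xi>. indicator B \<xi> * F \<xi>)"
    by (intro Bochner_Integration.integral_cong refl) (simp add: B_def)
  then show ?thesis
    using expectation_indicator_adapted(2)[OF assms(1) B indep] by simp
qed

lemma adapted_comp: "adapted t F \<Longrightarrow> adapted t (\<lambda>\<xi>. K (F \<xi>))"
  unfolding adapted_def by metis

lemma adapted_comp2: "adapted t F \<Longrightarrow> adapted t G \<Longrightarrow> adapted t (\<lambda>\<xi>. K (F \<xi>) (G \<xi>))"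
  unfolding adapted_def by metis

lemma adapted_sampled:
  assumes "\<And>i. i \<in> {1..n} \<Longrightarrow> adapted t (F i)"
  shows "adapted (Suc t) (\<lambda>\<xi>. F (I t \<xi>) \<xi>)"
  unfolding adapted_def history_Suc_eq
proof (intro ballI impI)
  fix \<xi> \<eta>
  assume \<xi>: "\<xi> \<in> space M" "\<eta> \<in> space M"
    and e: "history I J t \<xi> = history I J t \<eta> \<and> I t \<xi> = I t \<eta> \<and> J t \<xi> = J t \<eta>"
  have "F (I t \<xi>) \<xi> = F (I t \<xi>) \<eta>"
    using assms[OF I_range[OF \<xi>(1)]] \<xi> e unfolding adapted_def by blast
  then show "F (I t \<xi>) \<xi> = F (I t \<eta>) \<eta>"
    using e by simp
qed

lemma adapted_memorized:
  assumes "adapted t F"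
  shows "adapted (Suc t) (\<lambda>\<xi>. if j \<in> J t \<xi> then F \<xi> else c)"
  unfolding adapted_def history_Suc_eq
proof (intro ballI impI)
  fix \<xi> \<eta>
  assume \<xi>: "\<xi> \<in> space M" "\<eta> \<in> space M"
    and e: "history I J t \<xi> = history I J t \<eta> \<and> I t \<xi> = I t \<eta> \<and> J t \<xi> = J t \<eta>"
  have "F \<xi> = F \<eta>"
    using assms \<xi> e unfolding adapted_def by blast
  then show "(if j \<in> J t \<xi> then F \<xi> else c) = (if j \<in> J t \<eta> then F \<eta> else c)"
    using e by simp
qed

lemma adapted_sum:
  assumes "\<And>k. k \<in> A \<Longrightarrow> adapted t (F k)"
  shows "adapted t (\<lambda>\<xi>. \<Sum>k\<in>A. F k \<xi>)"
  unfolding adapted_def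
proof (intro ballI impI sum.cong[OF refl])
  fix \<xi> \<eta> k
  assume \<xi>: "\<xi> \<in> space M" "\<eta> \<in> space M" "history I J t \<xi> = history I J t \<eta>" and "k \<in> A"
  then have "adapted t (F k)"
    using assms by simp
  then show "F k \<xi> = F k \<eta>"
    using \<xi> unfolding adapted_def by blast
qed

lemma ereal_expectation_adapted:
  assumes "adapted t F" "\<And>\<xi>. \<xi> \<in> space M \<Longrightarrow> X \<xi> = ereal (F \<xi>)"
  shows "ereal_expectation M X = ereal (expectation F)"
proof -
  have "ereal_expectation M X = ereal_expectation M (\<lambda>\<xi>. ereal (F \<xi>))"
    unfolding ereal_expectation_def using assms(2) by (simp cong: nn_integral_cong)
  then show ?thesis
    using ereal_expectation_eq_integral[OF integrable_adapted[OF assms(1)]] by simp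
qed

end

section \<open>Inequalities for one splitting step\<close>

text \<open>
  The identity behind all telescoping sums: it turns the product with the displacement into squared distances.
\<close>

lemma three_point_identity:
  fixes y d Y :: "'a::real_inner"
  shows "(norm (y - Y))\<^sup>2 - (norm (y + d - Y))\<^sup>2 - (norm d)\<^sup>2 = 2 * (d \<bullet> (Y - y - d))"
  by (simp add: power2_norm_eq_inner algebra_simps inner_commute)

text \<open>
  Adding the subgradient inequality of \<open>g\<close> at \<open>x\<close> to the upper and lower bounds of \<open>f\<close> around \<open>z\<close> leaves, besides the noise
  and \<open>L/2 |x - z|\<^sup>2\<close>, only \<open>\<langle>x - z, Y - (y + x - z)\<rangle>/\<gamma>\<close> with \<open>Y = a + \<gamma> b\<close>, which telescopes. The term \<open>|x - z|\<^sup>2/(2\<gamma>)\<close> that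
  telescoping sets free pays for \<open>L/2 |x - z|\<^sup>2\<close> of the descent lemma and for the \<open>L |x - z|\<^sup>2\<close> of Young's inequality,
  which is where \<open>\<gamma> \<le> 1/(3L)\<close> is needed.
\<close>

lemma splitting_step_gap:
  fixes f :: "'a::euclidean_space \<Rightarrow> real" and g :: "'a \<Rightarrow> ereal"
  assumes f: "convex_on UNIV f" "smooth L f" and L: "0 < L" and g: "proper g"
    and \<gamma>: "0 < \<gamma>" "\<gamma> \<le> 1 / (3 * L)"
    and x: "subgradient g (- (u + v) - (1 / \<gamma>) *\<^sub>R (x - z)) x"
    and y: "y = z + \<gamma> *\<^sub>R u"
    and a: "a \<in> domain_of g"
  shows "f x + real_of_ereal (g x) + x \<bullet> b - (f a + real_of_ereal (g a) + a \<bullet> u) + z \<bullet> (u - b)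
    \<le> (gradient f z - v) \<bullet> (z - a) + 1 / (4 * L) * (norm (gradient f z - v))\<^sup>2
       + 1 / (2 * \<gamma>) * ((norm (y - (a + \<gamma> *\<^sub>R b)))\<^sup>2 - (norm (y + x - z - (a + \<gamma> *\<^sub>R b)))\<^sup>2)"
proof -
  define d where "d = x - z"
  define Y where "Y = a + \<gamma> *\<^sub>R b"
  have x_eq: "x = z + d"
    by (simp add: d_def)
  have "real_of_ereal (g x) + (- (u + v) - (1 / \<gamma>) *\<^sub>R d) \<bullet> (a - x) \<le> real_of_ereal (g a)"
    using subgradient_le[OF g x a] by (simp add: d_def)
  then have gx: "real_of_ereal (g x) - (u + v) \<bullet> (a - x) - 1 / \<gamma> * (d \<bullet> (a - x)) \<le> real_of_ereal (g a)"
    by (simp add: inner_diff_left inner_add_left inner_minus_left)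
  have fx: "f x \<le> f z + gradient f z \<bullet> d + L / 2 * (norm d)\<^sup>2"
    using smooth_upper_bound[OF f(2), of x z] by (simp add: d_def)
  have fa: "f z + gradient f z \<bullet> (a - z) \<le> f a"
    using f by (rule convex_gradient_le)
  have "Y - y - d = (a - x) + \<gamma> *\<^sub>R (b - u)"
    by (simp add: Y_def y x_eq algebra_simps)
  then have "1 / (2 * \<gamma>) * ((norm (y - Y))\<^sup>2 - (norm (y + d - Y))\<^sup>2 - (norm d)\<^sup>2)
      = 1 / \<gamma> * (d \<bullet> (a - x)) + d \<bullet> (b - u)"
    unfolding three_point_identity using \<gamma>(1) by (simp add: inner_add_right add_divide_distrib)
  then have tele: "1 / \<gamma> * (d \<bullet> (a - x)) + d \<bullet> (b - u)
      = 1 / (2 * \<gamma>) * ((norm (y - Y))\<^sup>2 - (norm (y + d - Y))\<^sup>2) - 1 / (2 * \<gamma>) * (norm d)\<^sup>2"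
    by (simp only: right_diff_distrib)
  have young: "(gradient f z - v) \<bullet> d \<le> 1 / (4 * L) * (norm (gradient f z - v))\<^sup>2 + L * (norm d)\<^sup>2"
    using inner_le_weighted_squares[of "2 * L" "gradient f z - v" d] L by simp
  have "3 * L / 2 \<le> 1 / (2 * \<gamma>)"
    using \<gamma> L by (simp add: field_simps)
  then have "3 * L / 2 * (norm d)\<^sup>2 \<le> 1 / (2 * \<gamma>) * (norm d)\<^sup>2"
    by (intro mult_right_mono) auto
  then have quad: "L / 2 * (norm d)\<^sup>2 + L * (norm d)\<^sup>2 \<le> 1 / (2 * \<gamma>) * (norm d)\<^sup>2"
    by simp
  have "f x + real_of_ereal (g x) + x \<bullet> b - (f a + real_of_ereal (g a) + a \<bullet> u) + z \<bullet> (u - b)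
    \<le> gradient f z \<bullet> d + L / 2 * (norm d)\<^sup>2 - gradient f z \<bullet> (a - z) + (u + v) \<bullet> (a - x)
       + 1 / \<gamma> * (d \<bullet> (a - x)) + x \<bullet> b - a \<bullet> u + z \<bullet> (u - b)"
    using gx fx fa by linarith
  also have "\<dots> = (gradient f z - v) \<bullet> (z - a) + (gradient f z - v) \<bullet> d + L / 2 * (norm d)\<^sup>2
       + (1 / \<gamma> * (d \<bullet> (a - x)) + d \<bullet> (b - u))"
    by (simp add: x_eq inner_simps inner_commute)
  also have "\<dots> \<le> (gradient f z - v) \<bullet> (z - a) + 1 / (4 * L) * (norm (gradient f z - v))\<^sup>2
       + 1 / (2 * \<gamma>) * ((norm (y - Y))\<^sup>2 - (norm (y + d - Y))\<^sup>2)"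
    using young quad tele by linarith
  finally show ?thesis
    by (simp add: Y_def d_def add_diff_eq)
qed

text \<open>
  With the solution itself as comparison point only monotonicity of the two subdifferentials is used. There is no
  descent-lemma term to pay for, so all of \<open>|x - z|\<^sup>2/(2\<gamma>)\<close> is available to absorb the error of \<open>v\<close>.
\<close>

lemma splitting_step_contraction:
  fixes g h :: "'a::euclidean_space \<Rightarrow> ereal"
  assumes g: "proper g" and h: "proper h" and \<gamma>: "0 < \<gamma>"
    and x: "subgradient g (- (u + v) - (1 / \<gamma>) *\<^sub>R (x - z)) x" and z: "subgradient h u z"
    and y: "y = z + \<gamma> *\<^sub>R u"
    and sol: "subgradient g (- (us + c)) xs" "subgradient h us xs"
  shows "1 / (2 * \<gamma>) * (norm (y + x - z - (xs + \<gamma> *\<^sub>R us)))\<^sup>2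
    \<le> 1 / (2 * \<gamma>) * (norm (y - (xs + \<gamma> *\<^sub>R us)))\<^sup>2 - (z - xs) \<bullet> (v - c) + \<gamma> / 2 * (norm (v - c))\<^sup>2"
proof -
  define d where "d = x - z"
  define Y where "Y = xs + \<gamma> *\<^sub>R us"
  have x_eq: "x = z + d"
    by (simp add: d_def)
  have gm: "0 \<le> (us + c - (u + v)) \<bullet> (x - xs) - 1 / \<gamma> * (d \<bullet> (x - xs))"
    using subgradient_monotone[OF g x sol(1)]
    by (simp add: d_def[symmetric] inner_diff_left inner_add_left)
  have hm: "0 \<le> (u - us) \<bullet> (z - xs)"
    using h z sol(2) by (rule subgradient_monotone)
  have "Y - y - d = (xs - x) + \<gamma> *\<^sub>R (us - u)"
    by (simp add: Y_def y x_eq algebra_simps)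
  then have "1 / (2 * \<gamma>) * ((norm (y - Y))\<^sup>2 - (norm (y + d - Y))\<^sup>2 - (norm d)\<^sup>2)
      = 1 / \<gamma> * (d \<bullet> (xs - x)) + d \<bullet> (us - u)"
    unfolding three_point_identity using \<gamma> by (simp add: inner_add_right add_divide_distrib)
  then have tele: "1 / \<gamma> * (d \<bullet> (xs - x)) + d \<bullet> (us - u)
      = 1 / (2 * \<gamma>) * (norm (y - Y))\<^sup>2 - 1 / (2 * \<gamma>) * (norm (y + d - Y))\<^sup>2 - 1 / (2 * \<gamma>) * (norm d)\<^sup>2"
    by (simp only: right_diff_distrib)
  have young: "(c - v) \<bullet> d \<le> \<gamma> / 2 * (norm (v - c))\<^sup>2 + 1 / (2 * \<gamma>) * (norm d)\<^sup>2"
    using inner_le_weighted_squares[of "1 / \<gamma>" "c - v" d] \<gamma> by (simp add: norm_minus_commute)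
  have split: "(us + c - (u + v)) \<bullet> (x - xs) - 1 / \<gamma> * (d \<bullet> (x - xs)) + (u - us) \<bullet> (z - xs)
      = (1 / \<gamma> * (d \<bullet> (xs - x)) + d \<bullet> (us - u)) + (c - v) \<bullet> d - (z - xs) \<bullet> (v - c)"
  proof -
    have "1 / \<gamma> * (d \<bullet> (xs - x)) = - (1 / \<gamma> * (d \<bullet> (x - xs)))"
      by (simp add: inner_diff_right diff_divide_distrib)
    moreover have "(us + c - (u + v)) \<bullet> (x - xs) + (u - us) \<bullet> (z - xs)
        = d \<bullet> (us - u) + (c - v) \<bullet> d - (z - xs) \<bullet> (v - c)"
      by (simp add: x_eq inner_simps inner_commute)
    ultimately show ?thesis
      by linarith
  qed
  have "1 / (2 * \<gamma>) * (norm (y + d - Y))\<^sup>2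
      \<le> 1 / (2 * \<gamma>) * (norm (y - Y))\<^sup>2 - (z - xs) \<bullet> (v - c) + \<gamma> / 2 * (norm (v - c))\<^sup>2"
    using gm hm tele young split by linarith
  then show ?thesis
    by (simp add: Y_def d_def add_diff_eq)
qed

section \<open>The averaged iterates of VR-TOS\<close>

locale vr_tos = index_process M n q I J
  for M :: "'w measure" and n q I J +
  fixes \<psi> :: "nat \<Rightarrow> 'a::euclidean_space \<Rightarrow> real" and \<omega> :: "'a \<Rightarrow> real" and g h :: "'a \<Rightarrow> ereal"
    and L\<^sub>\<psi> L\<^sub>\<omega> \<gamma> :: real and y\<^sub>0 :: 'a and \<alpha>\<^sub>0 :: "nat \<Rightarrow> 'a"
    and x y z u v :: "nat \<Rightarrow> 'w \<Rightarrow> 'a" and \<alpha> :: "nat \<Rightarrow> nat \<Rightarrow> 'w \<Rightarrow> 'a"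
  assumes \<psi>: "\<And>j. j \<in> {1..n} \<Longrightarrow> convex_on UNIV (\<psi> j) \<and> smooth L\<^sub>\<psi> (\<psi> j)"
    and \<omega>: "convex_on UNIV \<omega>" "smooth L\<^sub>\<omega> \<omega>"
    and g: "proper g" "lower_semicontinuous g" "ereal_convex g"
    and h: "proper h" "lower_semicontinuous h" "ereal_convex h"
    and L_pos: "0 < L\<^sub>\<psi> + L\<^sub>\<omega>"
    and step_size: "0 < \<gamma>" "\<gamma> \<le> 1 / (3 * (L\<^sub>\<psi> + L\<^sub>\<omega>))"
    and q: "0 < q"
    and y_init: "\<And>\<xi>. \<xi> \<in> space M \<Longrightarrow> y 0 \<xi> = y\<^sub>0"
    and \<alpha>_init: "\<And>j \<xi>. j \<in> {1..n} \<Longrightarrow> \<xi> \<in> space M \<Longrightarrow> \<alpha> j 0 \<xi> = \<alpha>\<^sub>0 j"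
    and z_step: "\<And>t \<xi>. \<xi> \<in> space M \<Longrightarrow> z t \<xi> = prox \<gamma> h (y t \<xi>)"
    and u_step: "\<And>t \<xi>. \<xi> \<in> space M \<Longrightarrow> u t \<xi> = (1 / \<gamma>) *\<^sub>R (y t \<xi> - z t \<xi>)"
    and v_step: "\<And>t \<xi>. \<xi> \<in> space M \<Longrightarrow>
          v t \<xi> = gradient (\<psi> (I t \<xi>)) (z t \<xi>) - \<alpha> (I t \<xi>) t \<xi>
                  + (1 / real n) *\<^sub>R (\<Sum>j=1..n. \<alpha> j t \<xi>) + gradient \<omega> (z t \<xi>)"
    and x_step: "\<And>t \<xi>. \<xi> \<in> space M \<Longrightarrow>
          x t \<xi> = prox \<gamma> g (2 *\<^sub>R z t \<xi> - y t \<xi> - \<gamma> *\<^sub>R v t \<xi>)"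
    and y_step: "\<And>t \<xi>. \<xi> \<in> space M \<Longrightarrow> y (Suc t) \<xi> = y t \<xi> + x t \<xi> - z t \<xi>"
    and \<alpha>_step: "\<And>j t \<xi>. j \<in> {1..n} \<Longrightarrow> \<xi> \<in> space M \<Longrightarrow>
          \<alpha> j (Suc t) \<xi> = (if j \<in> J t \<xi> then gradient (\<psi> j) (z t \<xi>) else \<alpha> j t \<xi>)"
begin

definition L :: real where "L = L\<^sub>\<psi> + L\<^sub>\<omega>"

lemma L_gt_0: "0 < L"
  using L_pos by (simp add: L_def)

lemma step_size_le: "\<gamma> \<le> 1 / (3 * L)"
  using step_size(2) by (simp add: L_def)

definition f :: "'a \<Rightarrow> real" where
  "f a = (1 / real n) * (\<Sum>j=1..n. \<psi> j a) + \<omega> a"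

definition estimator :: "(nat \<Rightarrow> 'a) \<Rightarrow> 'a \<Rightarrow> nat \<Rightarrow> 'a" where
  "estimator \<beta> w i = gradient (\<psi> i) w - \<beta> i + (1 / real n) *\<^sub>R (\<Sum>j=1..n. \<beta> j) + gradient \<omega> w"

lemma smooth_f: "smooth L f"
  unfolding f_def[abs_def] L_def using \<psi> n by (intro smooth_add smooth_mean \<omega>) auto

lemma gradient_f: "gradient f a = (1 / real n) *\<^sub>R (\<Sum>j=1..n. gradient (\<psi> j) a) + gradient \<omega> a"
proof -
  have \<psi>': "\<And>j. j \<in> {1..n} \<Longrightarrow> smooth L\<^sub>\<psi> (\<psi> j)"
    using \<psi> by blast
  have "gradient f a = gradient (\<lambda>a. (1 / real n) * (\<Sum>j=1..n. \<psi> j a)) a + gradient \<omega> a"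
    unfolding f_def[abs_def] by (rule smooth_add(2)[OF smooth_mean(1)[OF n \<psi>'] \<omega>(2)])
  then show ?thesis
    using smooth_mean(2)[OF n \<psi>', where x = a] by simp
qed

lemma convex_f: "convex_on UNIV f"
  unfolding f_def[abs_def]
  using \<psi> by (intro convex_on_add convex_on_cmul convex_on_sum_functions \<omega>) auto

lemma smooth_component:
  assumes "i \<in> {1..n}"
  shows "convex_on UNIV (\<psi> i)" "smooth L (\<psi> i)"
  using \<psi>[OF assms] smooth_weaken[of L\<^sub>\<psi> "\<psi> i" L] smooth_nonneg[OF \<omega>(2)] by (auto simp: L_def)

lemma sum_estimator: "(\<Sum>i=1..n. estimator \<beta> w i) = real n *\<^sub>R gradient f w"
  using n by (simp add: estimator_def gradient_f sum.distrib sum_subtractf scaleR_add_right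
      sum_constant_scaleR)

lemma v_estimator: "\<xi> \<in> space M \<Longrightarrow> v t \<xi> = estimator (\<lambda>j. \<alpha> j t \<xi>) (z t \<xi>) (I t \<xi>)"
  by (simp add: v_step estimator_def)

lemma z_subgradient: "\<xi> \<in> space M \<Longrightarrow> subgradient h (u t \<xi>) (z t \<xi>)"
  using prox_subgradient[OF h step_size(1), of "y t \<xi>"] by (simp add: z_step u_step)

lemma y_eq: "\<xi> \<in> space M \<Longrightarrow> y t \<xi> = z t \<xi> + \<gamma> *\<^sub>R u t \<xi>"
  using step_size(1) by (simp add: u_step)

lemma x_subgradient:
  assumes "\<xi> \<in> space M"
  shows "subgradient g (- (u t \<xi> + v t \<xi>) - (1 / \<gamma>) *\<^sub>R (x t \<xi> - z t \<xi>)) (x t \<xi>)"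
proof -
  have "(1 / \<gamma>) *\<^sub>R (2 *\<^sub>R z t \<xi> - y t \<xi> - \<gamma> *\<^sub>R v t \<xi> - x t \<xi>)
      = - (u t \<xi> + v t \<xi>) - (1 / \<gamma>) *\<^sub>R (x t \<xi> - z t \<xi>)"
    using step_size(1) by (simp add: y_eq[OF assms] algebra_simps scaleR_2)
  then show ?thesis
    using prox_subgradient[OF g step_size(1), of "2 *\<^sub>R z t \<xi> - y t \<xi> - \<gamma> *\<^sub>R v t \<xi>"]
    by (simp add: x_step[OF assms])
qed

text \<open>
  The memory is compared only on the indices \<open>1, \<dots>, n\<close>, as it is unconstrained elsewhere.
\<close>

lemma state_determined_by_history:
  assumes "\<xi> \<in> space M" "\<eta> \<in> space M" "history I J t \<xi> = history I J t \<eta>"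
  shows "y t \<xi> = y t \<eta> \<and> (\<forall>j\<in>{1..n}. \<alpha> j t \<xi> = \<alpha> j t \<eta>)"
  using assms(3)
proof (induction t)
  case 0
  then show ?case
    using assms(1,2) by (simp add: y_init \<alpha>_init)
next
  case (Suc t)
  then have IJ: "I t \<xi> = I t \<eta>" "J t \<xi> = J t \<eta>"
    and IH: "y t \<xi> = y t \<eta>" "\<And>j. j \<in> {1..n} \<Longrightarrow> \<alpha> j t \<xi> = \<alpha> j t \<eta>"
    by (simp_all add: history_Suc_eq)
  have z: "z t \<xi> = z t \<eta>"
    using assms(1,2) IH by (simp add: z_step)
  have "(\<Sum>j=1..n. \<alpha> j t \<xi>) = (\<Sum>j=1..n. \<alpha> j t \<eta>)"
    using IH by (intro sum.cong) auto
  then have "v t \<xi> = v t \<eta>"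
    using IH(2)[OF I_range[OF assms(1), of t]] IJ z assms(1,2) by (simp add: v_step)
  then show ?case
    using assms(1,2) z IH IJ by (simp add: y_step x_step \<alpha>_step)
qed

lemma adapted_state:
  "adapted t (\<lambda>\<xi>. F (y t \<xi>) (z t \<xi>) (u t \<xi>) (\<lambda>j\<in>{1..n}. \<alpha> j t \<xi>))"
  unfolding adapted_def
proof (intro ballI impI)
  fix \<xi> \<eta>
  assume \<xi>: "\<xi> \<in> space M" "\<eta> \<in> space M" "history I J t \<xi> = history I J t \<eta>"
  have y: "y t \<xi> = y t \<eta>" and \<alpha>: "(\<lambda>j\<in>{1..n}. \<alpha> j t \<xi>) = (\<lambda>j\<in>{1..n}. \<alpha> j t \<eta>)"
    using state_determined_by_history[OF \<xi>] by (auto simp: restrict_def)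
  have z: "z t \<xi> = z t \<eta>"
    using \<xi> y by (simp add: z_step)
  have u: "u t \<xi> = u t \<eta>"
    using \<xi> y z by (simp add: u_step)
  show "F (y t \<xi>) (z t \<xi>) (u t \<xi>) (\<lambda>j\<in>{1..n}. \<alpha> j t \<xi>) = F (y t \<eta>) (z t \<eta>) (u t \<eta>) (\<lambda>j\<in>{1..n}. \<alpha> j t \<eta>)"
    unfolding y z u \<alpha> ..
qed

lemma estimator_restrict:
  assumes "i \<in> {1..n}"
  shows "estimator (\<lambda>j\<in>{1..n}. \<beta> j) w i = estimator \<beta> w i"
proof -
  have "(\<Sum>j=1..n. (\<lambda>j\<in>{1..n}. \<beta> j) j) = (\<Sum>j=1..n. \<beta> j)"
    by (intro sum.cong) auto
  then show ?thesis
    using assms by (simp only: estimator_def restrict_apply') 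
qed

lemma adapted_y: "adapted t (\<lambda>\<xi>. F (y t \<xi>))"
  using adapted_state[of t "\<lambda>a _ _ _. F a"] by simp

lemma adapted_z: "adapted t (\<lambda>\<xi>. F (z t \<xi>))"
  using adapted_state[of t "\<lambda>_ a _ _. F a"] by simp

lemma adapted_estimator:
  assumes "i \<in> {1..n}"
  shows "adapted t (\<lambda>\<xi>. F (z t \<xi>) (estimator (\<lambda>j. \<alpha> j t \<xi>) (z t \<xi>) i))"
  using adapted_state[of t "\<lambda>_ a _ \<beta>. F a (estimator \<beta> a i)"]
  by (simp only: estimator_restrict[OF assms])

lemma adapted_memory:
  assumes "j \<in> {1..n}"
  shows "adapted t (\<lambda>\<xi>. F (\<alpha> j t \<xi>))"
  using adapted_state[of t "\<lambda>_ _ _ \<beta>. F (\<beta> j)"] assms by simp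

lemma adapted_iterates:
  "k \<le> t \<Longrightarrow> adapted (Suc t) (\<lambda>\<xi>. (x k \<xi>, z k \<xi>, u k \<xi>))"
proof (induction t rule: dec_induct)
  case base
  show ?case
    unfolding adapted_def
  proof (intro ballI impI)
    fix \<xi> \<eta>
    assume \<xi>: "\<xi> \<in> space M" "\<eta> \<in> space M" "history I J (Suc k) \<xi> = history I J (Suc k) \<eta>"
    then have "history I J k \<xi> = history I J k \<eta>"
      by (simp add: history_Suc_eq)
    then have y: "y k \<xi> = y k \<eta>"
      using state_determined_by_history \<xi> by blast
    moreover have "y (Suc k) \<xi> = y (Suc k) \<eta>"
      using state_determined_by_history \<xi> by blast
    moreover have "z k \<xi> = z k \<eta>"
      using \<xi> y by (simp add: z_step)
    ultimately show "(x k \<xi>, z k \<xi>, u k \<xi>) = (x k \<eta>, z k \<eta>, u k \<eta>)"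
      using \<xi> by (simp add: y_step u_step)
  qed
next
  case (step t)
  then show ?case
    using adapted_Suc by blast
qed

text \<open>
  The Lagrangian gap at the current iterates, with \<open>h*(u\<^sub>t) - h*(b)\<close> replaced by its upper bound \<open>\<langle>z\<^sub>t, u\<^sub>t - b\<rangle>\<close> from the
  Fenchel-Young inequality; in this form \<open>h\<close> no longer occurs.
\<close>

definition step_gap where
  "step_gap a b t \<xi> = f (x t \<xi>) + real_of_ereal (g (x t \<xi>)) + x t \<xi> \<bullet> b
     - (f a + real_of_ereal (g a) + a \<bullet> u t \<xi>) + z t \<xi> \<bullet> (u t \<xi> - b)"

lemma adapted_step_gap: "k \<le> t \<Longrightarrow> adapted (Suc t) (step_gap a b k)"
  using adapted_comp[OF adapted_iterates[of k t], where K = "\<lambda>(x, z, u). f x + real_of_ereal (g x) + x \<bullet> b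
     - (f a + real_of_ereal (g a) + a \<bullet> u) + z \<bullet> (u - b)"]
  by (simp add: step_gap_def[abs_def])

lemma adapted_averages:
  "adapted (Suc t) (\<lambda>\<xi>. (average t (\<lambda>k. x k \<xi>), average t (\<lambda>k. u k \<xi>)))"
  unfolding adapted_def
proof (intro ballI impI)
  fix \<xi> \<eta>
  assume \<xi>: "\<xi> \<in> space M" "\<eta> \<in> space M" "history I J (Suc t) \<xi> = history I J (Suc t) \<eta>"
  have "x k \<xi> = x k \<eta> \<and> u k \<xi> = u k \<eta>" if "k \<le> t" for k
    using adapted_iterates[OF that] \<xi> unfolding adapted_def by blast
  then show "(average t (\<lambda>k. x k \<xi>), average t (\<lambda>k. u k \<xi>)) = (average t (\<lambda>k. x k \<eta>), average t (\<lambda>k. u k \<eta>))"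
    by (simp add: average_def)
qed

lemma iterates_in_domain:
  assumes "\<xi> \<in> space M"
  shows "x t \<xi> \<in> domain_of g" "z t \<xi> \<in> domain_of h" "u t \<xi> \<in> domain_of (fenchel_conjugate h)"
    and "real_of_ereal (fenchel_conjugate h (u t \<xi>)) = z t \<xi> \<bullet> u t \<xi> - real_of_ereal (h (z t \<xi>))"
  using subgradient_domain[OF x_subgradient[OF assms]] subgradient_domain[OF z_subgradient[OF assms]]
    fenchel_conjugate_subgradient[OF h(1) z_subgradient[OF assms]]
  by (auto simp: domain_of_def)

lemma lagrangian_gap_real:
  assumes "\<xi> \<in> space M" "a \<in> domain_of g" "b \<in> domain_of (fenchel_conjugate h)"
  shows "lagrangian f g h (average t (\<lambda>k. x k \<xi>)) b - lagrangian f g h a (average t (\<lambda>k. u k \<xi>))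
    = ereal (f (average t (\<lambda>k. x k \<xi>)) + real_of_ereal (g (average t (\<lambda>k. x k \<xi>)))
        + average t (\<lambda>k. x k \<xi>) \<bullet> b - real_of_ereal (fenchel_conjugate h b)
        - (f a + real_of_ereal (g a) + a \<bullet> average t (\<lambda>k. u k \<xi>)
            - real_of_ereal (fenchel_conjugate h (average t (\<lambda>k. u k \<xi>)))))"
  using assms iterates_in_domain[OF assms(1)]
    jensen_average(1)[OF ereal_convex_real[OF g(1,3)], of "\<lambda>k. x k \<xi>" t]
    jensen_average(1)[OF fenchel_conjugate_convex[OF h(1)], of "\<lambda>k. u k \<xi>" t]
  by (simp add: lagrangian_real[OF g(1) h(1)])

lemma averaged_gap_le:
  assumes "\<xi> \<in> space M" "a \<in> domain_of g" "b \<in> domain_of (fenchel_conjugate h)"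
  shows "f (average t (\<lambda>k. x k \<xi>)) + real_of_ereal (g (average t (\<lambda>k. x k \<xi>)))
        + average t (\<lambda>k. x k \<xi>) \<bullet> b - real_of_ereal (fenchel_conjugate h b)
        - (f a + real_of_ereal (g a) + a \<bullet> average t (\<lambda>k. u k \<xi>)
            - real_of_ereal (fenchel_conjugate h (average t (\<lambda>k. u k \<xi>))))
    \<le> 1 / real (t + 1) * (\<Sum>k=0..t. step_gap a b k \<xi>)"
proof -
  let ?m = "1 / real (t + 1)" and ?c = "\<lambda>u. real_of_ereal (fenchel_conjugate h u)"
  have const: "r = ?m * (\<Sum>k=0..t. r)" for r :: real
    by simp
  have "f (average t (\<lambda>k. x k \<xi>)) \<le> ?m * (\<Sum>k=0..t. f (x k \<xi>))"
    using convex_f by (intro jensen_average(2)) auto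
  moreover have "real_of_ereal (g (average t (\<lambda>k. x k \<xi>))) \<le> ?m * (\<Sum>k=0..t. real_of_ereal (g (x k \<xi>)))"
    by (intro jensen_average(2)[OF ereal_convex_real[OF g(1,3)]] iterates_in_domain assms)
  moreover have "?c (average t (\<lambda>k. u k \<xi>)) \<le> ?m * (\<Sum>k=0..t. ?c (u k \<xi>))"
    by (intro jensen_average(2)[OF fenchel_conjugate_convex[OF h(1)]] iterates_in_domain assms)
  moreover have "?c b = ?m * (\<Sum>k=0..t. ?c b)" "f a = ?m * (\<Sum>k=0..t. f a)"
      "real_of_ereal (g a) = ?m * (\<Sum>k=0..t. real_of_ereal (g a))"
    by (rule const)+
  moreover have "a \<bullet> average t (\<lambda>k. u k \<xi>) = ?m * (\<Sum>k=0..t. a \<bullet> u k \<xi>)"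
    by (simp add: average_def inner_sum_right)
  moreover have "?m * ((\<Sum>k=0..t. f (x k \<xi>)) + (\<Sum>k=0..t. real_of_ereal (g (x k \<xi>))) + (\<Sum>k=0..t. x k \<xi> \<bullet> b)
      - (\<Sum>k=0..t. ?c b) - ((\<Sum>k=0..t. f a) + (\<Sum>k=0..t. real_of_ereal (g a)) + (\<Sum>k=0..t. a \<bullet> u k \<xi>)
      - (\<Sum>k=0..t. ?c (u k \<xi>)))) \<le> ?m * (\<Sum>k=0..t. step_gap a b k \<xi>)"
    unfolding sum.distrib[symmetric] sum_subtractf[symmetric]
  proof (intro mult_left_mono sum_mono)
    fix k
    have "z k \<xi> \<bullet> b - real_of_ereal (h (z k \<xi>)) \<le> ?c b"
      using assms iterates_in_domain by (intro fenchel_young_real h)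
    then show "f (x k \<xi>) + real_of_ereal (g (x k \<xi>)) + x k \<xi> \<bullet> b - ?c b
        - (f a + real_of_ereal (g a) + a \<bullet> u k \<xi> - ?c (u k \<xi>)) \<le> step_gap a b k \<xi>"
      unfolding iterates_in_domain(4)[OF assms(1)] step_gap_def by (simp add: inner_diff_right)
  qed simp
  ultimately show ?thesis
    unfolding average_inner_left[of t _ b] right_diff_distrib distrib_left by linarith
qed

lemma sum_displacements: "\<xi> \<in> space M \<Longrightarrow> (\<Sum>k=0..t. x k \<xi> - z k \<xi>) = y (Suc t) \<xi> - y\<^sub>0"
  by (induction t) (simp_all add: y_step y_init)

text \<open>
  The step gap with dual point \<open>0\<close> compares the objectives with \<open>h\<close> evaluated at \<open>z\<^sub>t\<close> instead of \<open>x\<^sub>t\<close>. The averages of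
  the \<open>x\<close> and of the \<open>z\<close> differ by the displacement of \<open>y\<close> divided by the number of iterations.
\<close>

lemma averaged_objective_gap_le:
  assumes \<xi>: "\<xi> \<in> space M" and a: "a \<in> domain_of g" and lip: "ereal_lipschitz \<beta> h"
  shows "f (average t (\<lambda>k. x k \<xi>)) + real_of_ereal (g (average t (\<lambda>k. x k \<xi>)))
        + real_of_ereal (h (average t (\<lambda>k. x k \<xi>))) - (f a + real_of_ereal (g a) + real_of_ereal (h a))
    \<le> 1 / real (t + 1) * ((\<Sum>k=0..t. step_gap a 0 k \<xi>) + \<beta> * norm (y (Suc t) \<xi> - y\<^sub>0))"
proof -
  let ?m = "1 / real (t + 1)" and ?G = "\<lambda>x. real_of_ereal (g x)" and ?H = "\<lambda>x. real_of_ereal (h x)"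
  let ?x = "average t (\<lambda>k. x k \<xi>)" and ?z = "average t (\<lambda>k. z k \<xi>)"
  have const: "r = ?m * (\<Sum>k=0..t. r)" for r :: real
    by simp
  have "f ?x \<le> ?m * (\<Sum>k=0..t. f (x k \<xi>))"
    using convex_f by (intro jensen_average(2)) auto
  moreover have "?G ?x \<le> ?m * (\<Sum>k=0..t. ?G (x k \<xi>))"
    by (intro jensen_average(2)[OF ereal_convex_real[OF g(1,3)]] iterates_in_domain \<xi>)
  moreover have "?H ?z \<le> ?m * (\<Sum>k=0..t. ?H (z k \<xi>))"
    by (intro jensen_average(2)[OF ereal_convex_real[OF h(1,3)]] iterates_in_domain \<xi>)
  moreover have "?H ?x \<le> ?H ?z + ?m * (\<beta> * norm (y (Suc t) \<xi> - y\<^sub>0))"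
  proof -
    have "?x - ?z = ?m *\<^sub>R (y (Suc t) \<xi> - y\<^sub>0)"
      unfolding average_def scaleR_diff_right[symmetric] sum_subtractf[symmetric] sum_displacements[OF \<xi>] ..
    then have "norm (?x - ?z) = ?m * norm (y (Suc t) \<xi> - y\<^sub>0)"
      by simp
    moreover have "\<bar>?H ?x - ?H ?z\<bar> \<le> \<beta> * norm (?x - ?z)"
      using lip lipschitz_onD[of \<beta> UNIV ?H ?x ?z] by (simp add: ereal_lipschitz_def dist_norm)
    ultimately show ?thesis
      by (simp only: mult.left_commute)
  qed
  moreover have "f a = ?m * (\<Sum>k=0..t. f a)" "?G a = ?m * (\<Sum>k=0..t. ?G a)" "?H a = ?m * (\<Sum>k=0..t. ?H a)"
    by (rule const)+
  moreover have "?m * ((\<Sum>k=0..t. f (x k \<xi>)) + (\<Sum>k=0..t. ?G (x k \<xi>)) + (\<Sum>k=0..t. ?H (z k \<xi>))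
      - ((\<Sum>k=0..t. f a) + (\<Sum>k=0..t. ?G a) + (\<Sum>k=0..t. ?H a))) \<le> ?m * (\<Sum>k=0..t. step_gap a 0 k \<xi>)"
    unfolding sum.distrib[symmetric] sum_subtractf[symmetric]
  proof (intro mult_left_mono sum_mono)
    fix k
    have "?H (z k \<xi>) + u k \<xi> \<bullet> (a - z k \<xi>) \<le> ?H a"
      using ereal_lipschitz_finite[OF lip] by (intro subgradient_le h z_subgradient \<xi>) simp
    then show "f (x k \<xi>) + ?G (x k \<xi>) + ?H (z k \<xi>) - (f a + ?G a + ?H a) \<le> step_gap a 0 k \<xi>"
      unfolding step_gap_def by (simp add: inner_diff_right inner_commute)
  qed simp
  ultimately show ?thesis
    unfolding right_diff_distrib distrib_left by linarith
qed

end

section \<open>Expected progress relative to a primal-dual solution\<close>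

locale vr_tos_solution = vr_tos +
  fixes xs us
  assumes sol_g: "subgradient g (- (us + gradient f xs)) xs"
    and sol_h: "subgradient h us xs"
begin

definition ys where "ys = xs + \<gamma> *\<^sub>R us"

text \<open>
  The symmetrized Bregman distance of \<open>f\<close> between \<open>w\<close> and the solution.
\<close>

definition smoothness_gap where
  "smoothness_gap w = (w - xs) \<bullet> (gradient f w - gradient f xs)"

definition memory_error :: "(nat \<Rightarrow> _) \<Rightarrow> real" where
  "memory_error \<beta> = 1 / (2 * real n * L) * (\<Sum>j=1..n. (norm (\<beta> j - gradient (\<psi> j) xs))\<^sup>2)"

lemma smoothness_gap_nonneg: "0 \<le> smoothness_gap w"
  using convex_gradient_monotone[OF convex_f smooth_f, of w xs]
  by (simp add: smoothness_gap_def inner_commute)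

lemma memory_error_nonneg: "0 \<le> memory_error \<beta>"
  unfolding memory_error_def using L_gt_0 by (intro mult_nonneg_nonneg sum_nonneg) auto

lemma smoothness_gap_mean:
  "smoothness_gap w = (1 / real n) * (\<Sum>j=1..n.
     (gradient (\<psi> j) w + gradient \<omega> w - (gradient (\<psi> j) xs + gradient \<omega> xs)) \<bullet> (w - xs))"
proof -
  have "(\<Sum>j=1..n. gradient (\<psi> j) w + gradient \<omega> w - (gradient (\<psi> j) xs + gradient \<omega> xs))
      = real n *\<^sub>R (gradient f w - gradient f xs)"
    using n by (simp add: gradient_f sum.distrib sum_subtractf sum_constant_scaleR algebra_simps)
  then have "(\<Sum>j=1..n. (gradient (\<psi> j) w + gradient \<omega> w - (gradient (\<psi> j) xs + gradient \<omega> xs)) \<bullet> (w - xs))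
      = real n * smoothness_gap w"
    by (simp only: inner_sum_left[symmetric] inner_scaleR_left smoothness_gap_def inner_commute[of "w - xs"])
  then show ?thesis
    using n by simp
qed

text \<open>
  Each summand \<open>\<psi> j + \<omega>\<close> is convex and \<open>L\<close>-smooth, so cocoercivity applies to it before averaging.
\<close>

lemma mean_summand_gradient_gap:
  "(1 / real n) * (\<Sum>j=1..n. (norm (gradient (\<psi> j) w + gradient \<omega> w - (gradient (\<psi> j) xs + gradient \<omega> xs)))\<^sup>2)
    \<le> L * smoothness_gap w"
proof -
  have "(norm (gradient (\<psi> j) w + gradient \<omega> w - (gradient (\<psi> j) xs + gradient \<omega> xs)))\<^sup>2
      \<le> L * ((gradient (\<psi> j) w + gradient \<omega> w - (gradient (\<psi> j) xs + gradient \<omega> xs)) \<bullet> (w - xs))"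
    if j: "j \<in> {1..n}" for j
    using convex_smooth_cocoercive[OF _ smooth_add(1)[OF conjunct2[OF \<psi>[OF j]] \<omega>(2)], of w xs] L_gt_0
      convex_on_add[OF conjunct1[OF \<psi>[OF j]] \<omega>(1)]
    by (simp add: L_def smooth_add(2)[OF conjunct2[OF \<psi>[OF j]] \<omega>(2)])
  then have "(1 / real n) * (\<Sum>j=1..n. (norm (gradient (\<psi> j) w + gradient \<omega> w - (gradient (\<psi> j) xs + gradient \<omega> xs)))\<^sup>2)
      \<le> (1 / real n) * (\<Sum>j=1..n.
        L * ((gradient (\<psi> j) w + gradient \<omega> w - (gradient (\<psi> j) xs + gradient \<omega> xs)) \<bullet> (w - xs)))"
    by (intro mult_left_mono sum_mono) auto
  also have "\<dots> = L * smoothness_gap w"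
    unfolding smoothness_gap_mean by (simp only: sum_distrib_left mult.left_commute)
  finally show ?thesis .
qed

text \<open>
  Cocoercivity is applied to \<open>\<psi> j\<close> alone; monotonicity of the gradient of \<open>\<omega>\<close> then fills up the product to that of
  \<open>f\<close>.
\<close>

lemma mean_component_gradient_gap:
  "(1 / real n) * (\<Sum>j=1..n. (norm (gradient (\<psi> j) w - gradient (\<psi> j) xs))\<^sup>2) \<le> L * smoothness_gap w"
proof -
  have "(norm (gradient (\<psi> j) w - gradient (\<psi> j) xs))\<^sup>2
      \<le> L * ((gradient (\<psi> j) w + gradient \<omega> w - (gradient (\<psi> j) xs + gradient \<omega> xs)) \<bullet> (w - xs))"
    if j: "j \<in> {1..n}" for j
  proof -
    have "(norm (gradient (\<psi> j) w - gradient (\<psi> j) xs))\<^sup>2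
        \<le> L * ((gradient (\<psi> j) w - gradient (\<psi> j) xs) \<bullet> (w - xs))"
      using smooth_component[OF j] L_gt_0 by (rule convex_smooth_cocoercive)
    also have "\<dots> \<le> L * ((gradient (\<psi> j) w - gradient (\<psi> j) xs) \<bullet> (w - xs) + (gradient \<omega> w - gradient \<omega> xs) \<bullet> (w - xs))"
      using convex_gradient_monotone[OF \<omega>, of w xs] L_gt_0 by (intro mult_left_mono) auto
    finally show ?thesis
      by (simp add: algebra_simps)
  qed
  then have "(1 / real n) * (\<Sum>j=1..n. (norm (gradient (\<psi> j) w - gradient (\<psi> j) xs))\<^sup>2)
      \<le> (1 / real n) * (\<Sum>j=1..n.
        L * ((gradient (\<psi> j) w + gradient \<omega> w - (gradient (\<psi> j) xs + gradient \<omega> xs)) \<bullet> (w - xs)))"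
    by (intro mult_left_mono sum_mono) auto
  also have "\<dots> = L * smoothness_gap w"
    unfolding smoothness_gap_mean by (simp only: sum_distrib_left mult.left_commute)
  finally show ?thesis .
qed

lemma mean_memory_error:
  "(1 / real n) * (\<Sum>j=1..n. (norm (\<beta> j - gradient (\<psi> j) xs))\<^sup>2) = 2 * L * memory_error \<beta>"
proof -
  have "1 / real n * s = 2 * l * (1 / (2 * real n * l) * s)" if "0 < l" for l s :: real
    using that by (simp add: field_simps)
  then show ?thesis
    unfolding memory_error_def using L_gt_0 .
qed

text \<open>
  The estimator is unbiased, so its variance is at most the second moment of \<open>\<nabla>\<psi>\<^sub>i(w) - \<beta>\<^sub>i\<close>, which is split at the
  component gradients of the solution.
\<close>

lemma mean_estimator_variance:
  "(1 / real n) * (\<Sum>i=1..n. (norm (gradient f w - estimator \<beta> w i))\<^sup>2)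
    \<le> 2 * L * smoothness_gap w + 4 * L * memory_error \<beta>"
proof -
  let ?X = "\<lambda>i. gradient (\<psi> i) w - \<beta> i"
  let ?A = "\<lambda>i. gradient (\<psi> i) w - gradient (\<psi> i) xs" and ?B = "\<lambda>i. \<beta> i - gradient (\<psi> i) xs"
  have "norm (gradient f w - estimator \<beta> w i) = norm (?X i - (1 / real n) *\<^sub>R (\<Sum>j=1..n. ?X j))" for i
    by (subst norm_minus_commute) (simp add: gradient_f estimator_def sum_subtractf algebra_simps)
  then have "(1 / real n) * (\<Sum>i=1..n. (norm (gradient f w - estimator \<beta> w i))\<^sup>2)
      \<le> (1 / real n) * (\<Sum>i=1..n. (norm (?X i))\<^sup>2)"
    using variance_le_second_moment[OF n, of ?X] by (simp only:)
  also have "\<dots> \<le> (1 / real n) * (\<Sum>i=1..n. 2 * (norm (?A i))\<^sup>2 + 2 * (norm (?B i))\<^sup>2)"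
  proof (intro mult_left_mono sum_mono)
    fix i
    show "(norm (?X i))\<^sup>2 \<le> 2 * (norm (?A i))\<^sup>2 + 2 * (norm (?B i))\<^sup>2"
      using norm_diff_squared_le[of "?A i" "?B i"] by simp
  qed simp
  also have "\<dots> = 2 * ((1 / real n) * (\<Sum>i=1..n. (norm (?A i))\<^sup>2)) + 2 * ((1 / real n) * (\<Sum>i=1..n. (norm (?B i))\<^sup>2))"
    by (simp only: sum.distrib sum_distrib_left[symmetric] distrib_left mult.left_commute)
  also have "\<dots> \<le> 2 * (L * smoothness_gap w) + 2 * (2 * L * memory_error \<beta>)"
    unfolding mean_memory_error[of \<beta>]
    by (intro add_right_mono mult_left_mono mean_component_gradient_gap) simp
  finally show ?thesis
    by simp
qed

text \<open>
  Here \<open>\<nabla>\<omega>\<close> belongs to the part that is controlled by \<open>smoothness_gap\<close>, and centring removes the mean of the memory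
  from the other part.
\<close>

lemma mean_estimator_error:
  "(1 / real n) * (\<Sum>i=1..n. (norm (estimator \<beta> w i - gradient f xs))\<^sup>2)
    \<le> 2 * L * smoothness_gap w + 4 * L * memory_error \<beta>"
proof -
  let ?A = "\<lambda>i. gradient (\<psi> i) w + gradient \<omega> w - (gradient (\<psi> i) xs + gradient \<omega> xs)"
  let ?B = "\<lambda>i. \<beta> i - gradient (\<psi> i) xs"
  let ?C = "\<lambda>i. ?B i - (1 / real n) *\<^sub>R (\<Sum>j=1..n. ?B j)"
  have split: "estimator \<beta> w i - gradient f xs = ?A i - ?C i" for i
    by (simp add: gradient_f estimator_def sum_subtractf algebra_simps)
  have "(1 / real n) * (\<Sum>i=1..n. (norm (estimator \<beta> w i - gradient f xs))\<^sup>2)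
      \<le> (1 / real n) * (\<Sum>i=1..n. 2 * (norm (?A i))\<^sup>2 + 2 * (norm (?C i))\<^sup>2)"
    unfolding split by (intro mult_left_mono sum_mono norm_diff_squared_le) simp
  also have "\<dots> = 2 * ((1 / real n) * (\<Sum>i=1..n. (norm (?A i))\<^sup>2)) + 2 * ((1 / real n) * (\<Sum>i=1..n. (norm (?C i))\<^sup>2))"
    by (simp only: sum.distrib sum_distrib_left[symmetric] distrib_left mult.left_commute)
  also have "\<dots> \<le> 2 * (L * smoothness_gap w) + 2 * (2 * L * memory_error \<beta>)"
    unfolding mean_memory_error[of \<beta>, symmetric]
    by (intro add_mono mult_left_mono mean_summand_gradient_gap variance_le_second_moment n) simp_all
  finally show ?thesis
    by simp
qed

abbreviation memory where "memory t \<xi> \<equiv> \<lambda>j. \<alpha> j t \<xi>"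

definition expected_gap :: "nat \<Rightarrow> real" where
  "expected_gap t = expectation (\<lambda>\<xi>. smoothness_gap (z t \<xi>))"

definition expected_memory_error :: "nat \<Rightarrow> real" where
  "expected_memory_error t = expectation (\<lambda>\<xi>. memory_error (memory t \<xi>))"

definition expected_sq_dist where
  "expected_sq_dist a t = expectation (\<lambda>\<xi>. (norm (y t \<xi> - a))\<^sup>2)"

lemma adapted_memory_error: "adapted t (\<lambda>\<xi>. memory_error (memory t \<xi>))"
  unfolding memory_error_def by (intro adapted_comp[where K = "\<lambda>s. _ * s"] adapted_sum adapted_memory)

lemma integrable_smoothness_gap [simp]: "integrable M (\<lambda>\<xi>. smoothness_gap (z t \<xi>))"
  by (rule integrable_adapted[OF adapted_z])

lemma integrable_memory_error [simp]: "integrable M (\<lambda>\<xi>. memory_error (memory t \<xi>))"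
  by (rule integrable_adapted[OF adapted_memory_error])

lemma integrable_sq_dist [simp]: "integrable M (\<lambda>\<xi>. (norm (y t \<xi> - a))\<^sup>2)"
  by (rule integrable_adapted[OF adapted_y])

lemma expected_gap_nonneg: "0 \<le> expected_gap t"
  unfolding expected_gap_def using smoothness_gap_nonneg by (intro Bochner_Integration.integral_nonneg)

lemma expected_memory_error_nonneg: "0 \<le> expected_memory_error t"
  unfolding expected_memory_error_def using memory_error_nonneg by (intro Bochner_Integration.integral_nonneg)

lemma expected_sq_dist_nonneg: "0 \<le> expected_sq_dist a t"
  unfolding expected_sq_dist_def by (intro Bochner_Integration.integral_nonneg) auto

lemma expected_sq_dist_0: "expected_sq_dist a 0 = (norm (y\<^sub>0 - a))\<^sup>2"
proof -
  have "expected_sq_dist a 0 = expectation (\<lambda>\<xi>. (norm (y\<^sub>0 - a))\<^sup>2)"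
    unfolding expected_sq_dist_def by (intro Bochner_Integration.integral_cong refl) (simp add: y_init)
  then show ?thesis
    by (simp add: prob_space)
qed

lemma expected_memory_error_0: "expected_memory_error 0 = memory_error \<alpha>\<^sub>0"
proof -
  have "memory_error (memory 0 \<xi>) = memory_error \<alpha>\<^sub>0" if "\<xi> \<in> space M" for \<xi>
    unfolding memory_error_def using that by (intro arg_cong2[where f = "(*)"] sum.cong refl) (simp add: \<alpha>_init)
  then have "expected_memory_error 0 = expectation (\<lambda>\<xi>. memory_error \<alpha>\<^sub>0)"
    unfolding expected_memory_error_def by (intro Bochner_Integration.integral_cong refl)
  then show ?thesis
    by (simp add: prob_space)
qed

text \<open>
  Bounds that hold for the average over the sampled index, with the state frozen, pass to the expectation.
\<close>

lemma expectation_estimator_le: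
  fixes F :: "_ \<Rightarrow> _ \<Rightarrow> real"
  assumes "\<And>w \<beta>. (1 / real n) * (\<Sum>i=1..n. F w (estimator \<beta> w i)) \<le> c * smoothness_gap w + d * memory_error \<beta>"
  shows "integrable M (\<lambda>\<xi>. F (z t \<xi>) (v t \<xi>))"
    and "expectation (\<lambda>\<xi>. F (z t \<xi>) (v t \<xi>)) \<le> c * expected_gap t + d * expected_memory_error t"
proof -
  let ?F = "\<lambda>i \<xi>. F (z t \<xi>) (estimator (memory t \<xi>) (z t \<xi>) i)"
  have ad: "adapted t (?F i)" if "i \<in> {1..n}" for i
    using that by (rule adapted_estimator)
  have v: "F (z t \<xi>) (v t \<xi>) = ?F (I t \<xi>) \<xi>" if "\<xi> \<in> space M" for \<xi>
    by (simp add: v_estimator[OF that])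
  have "integrable M (\<lambda>\<xi>. ?F (I t \<xi>) \<xi>)"
    by (rule integrable_adapted[OF adapted_sampled]) (rule ad)
  then show "integrable M (\<lambda>\<xi>. F (z t \<xi>) (v t \<xi>))"
    using v by (subst Bochner_Integration.integrable_cong[OF refl]) auto
  have "expectation (\<lambda>\<xi>. F (z t \<xi>) (v t \<xi>)) = expectation (\<lambda>\<xi>. ?F (I t \<xi>) \<xi>)"
    using v by (intro Bochner_Integration.integral_cong refl)
  also have "\<dots> = expectation (\<lambda>\<xi>. (1 / real n) * (\<Sum>i=1..n. ?F i \<xi>))"
    using ad by (rule expectation_sampled)
  also have "\<dots> \<le> expectation (\<lambda>\<xi>. c * smoothness_gap (z t \<xi>) + d * memory_error (memory t \<xi>))"
    using assms ad
    by (intro integral_mono integrable_adapted[OF adapted_comp[where K = "\<lambda>s. _ * s"]] adapted_sum) auto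
  also have "\<dots> = c * expected_gap t + d * expected_memory_error t"
    by (simp add: expected_gap_def expected_memory_error_def)
  finally show "expectation (\<lambda>\<xi>. F (z t \<xi>) (v t \<xi>)) \<le> c * expected_gap t + d * expected_memory_error t" .
qed

text \<open>
  The product with \<open>z - xs\<close> has the smoothness gap as its mean, and since \<open>\<gamma> L \<le> 1/3\<close> the squared error costs
  only a third of it, plus two thirds of the memory error.
\<close>

lemma expected_distance_step:
  "1 / (2 * \<gamma>) * expected_sq_dist ys (Suc t)
    \<le> 1 / (2 * \<gamma>) * expected_sq_dist ys t - 2 / 3 * expected_gap t + 2 / 3 * expected_memory_error t"
proof -
  define F where "F = (\<lambda>w e. - ((w - xs) \<bullet> (e - gradient f xs)) + \<gamma> / 2 * (norm (e - gradient f xs))\<^sup>2)"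
  have mean: "(1 / real n) * (\<Sum>i=1..n. F w (estimator \<beta> w i))
      \<le> (- 2 / 3) * smoothness_gap w + 2 / 3 * memory_error \<beta>" for w \<beta>
  proof -
    have "(\<Sum>i=1..n. (w - xs) \<bullet> (estimator \<beta> w i - gradient f xs)) = real n * smoothness_gap w"
      by (simp add: sum_estimator[of \<beta> w, simplified] sum_subtractf smoothness_gap_def
          inner_diff_right sum_constant_scaleR right_diff_distrib flip: inner_sum_right)
    then have "(\<Sum>i=1..n. F w (estimator \<beta> w i))
        = - (real n * smoothness_gap w) + \<gamma> / 2 * (\<Sum>i=1..n. (norm (estimator \<beta> w i - gradient f xs))\<^sup>2)"
      by (simp only: F_def sum.distrib sum_negf sum_distrib_left[symmetric])
    then have "(1 / real n) * (\<Sum>i=1..n. F w (estimator \<beta> w i))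
        = - smoothness_gap w + \<gamma> / 2 * ((1 / real n) * (\<Sum>i=1..n. (norm (estimator \<beta> w i - gradient f xs))\<^sup>2))"
      using n by (simp add: distrib_left diff_divide_distrib)
    also have "\<dots> \<le> - smoothness_gap w + \<gamma> / 2 * (2 * L * smoothness_gap w + 4 * L * memory_error \<beta>)"
      using mean_estimator_error step_size(1) by (intro add_left_mono mult_left_mono) auto
    also have "\<dots> = - smoothness_gap w + (\<gamma> * L) * smoothness_gap w + 2 * ((\<gamma> * L) * memory_error \<beta>)"
      by (simp add: algebra_simps)
    also have "\<dots> \<le> - smoothness_gap w + 1 / 3 * smoothness_gap w + 2 * (1 / 3 * memory_error \<beta>)"
      using step_size(1) step_size_le L_gt_0 smoothness_gap_nonneg memory_error_nonneg
      by (intro add_mono mult_left_mono mult_right_mono) (auto simp: field_simps)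
    finally show ?thesis
      by simp
  qed
  have "1 / (2 * \<gamma>) * expected_sq_dist ys (Suc t)
      = expectation (\<lambda>\<xi>. 1 / (2 * \<gamma>) * (norm (y (Suc t) \<xi> - ys))\<^sup>2)"
    by (simp add: expected_sq_dist_def)
  also have "\<dots> \<le> expectation (\<lambda>\<xi>. 1 / (2 * \<gamma>) * (norm (y t \<xi> - ys))\<^sup>2 + F (z t \<xi>) (v t \<xi>))"
  proof (rule integral_mono)
    fix \<xi>
    assume \<xi>: "\<xi> \<in> space M"
    show "1 / (2 * \<gamma>) * (norm (y (Suc t) \<xi> - ys))\<^sup>2
        \<le> 1 / (2 * \<gamma>) * (norm (y t \<xi> - ys))\<^sup>2 + F (z t \<xi>) (v t \<xi>)"
      using splitting_step_contraction[OF g(1) h(1) step_size(1) x_subgradient[OF \<xi>]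
          z_subgradient[OF \<xi>] y_eq[OF \<xi>] sol_g sol_h, of t]
      by (simp add: y_step[OF \<xi>] ys_def F_def)
  qed (intro integrable_mult_right Bochner_Integration.integrable_add integrable_sq_dist
      expectation_estimator_le(1)[where c = "- 2 / 3" and d = "2 / 3"] mean)+
  also have "\<dots> = 1 / (2 * \<gamma>) * expected_sq_dist ys t + expectation (\<lambda>\<xi>. F (z t \<xi>) (v t \<xi>))"
    using expectation_estimator_le(1)[of F, OF mean]
    by (simp add: expected_sq_dist_def)
  finally show ?thesis
    using expectation_estimator_le(2)[of F, OF mean, of t] by simp
qed

text \<open>
  A memory entry is replaced with probability \<open>q/n\<close> independently of the past; the new entries have error at most half of
  the smoothness gap.
\<close>

lemma expected_memory_error_step:
  "expected_memory_error (Suc t)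
    \<le> expected_memory_error t + q / real n * (expected_gap t / 2 - expected_memory_error t)"
proof -
  let ?c = "1 / (2 * real n * L)"
  define \<Delta> where "\<Delta> = (\<lambda>j \<xi>. (norm (gradient (\<psi> j) (z t \<xi>) - gradient (\<psi> j) xs))\<^sup>2
    - (norm (\<alpha> j t \<xi> - gradient (\<psi> j) xs))\<^sup>2)"
  have \<Delta>: "adapted t (\<Delta> j)" if "j \<in> {1..n}" for j
    unfolding \<Delta>_def by (rule adapted_comp2[OF adapted_z adapted_memory[OF that]])
  have "memory_error (memory (Suc t) \<xi>)
      = memory_error (memory t \<xi>) + ?c * (\<Sum>j=1..n. if j \<in> J t \<xi> then \<Delta> j \<xi> else 0)" if \<xi>: "\<xi> \<in> space M" for \<xi>
  proof -
    have "(\<Sum>j=1..n. (norm (\<alpha> j (Suc t) \<xi> - gradient (\<psi> j) xs))\<^sup>2)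
        = (\<Sum>j=1..n. (norm (\<alpha> j t \<xi> - gradient (\<psi> j) xs))\<^sup>2 + (if j \<in> J t \<xi> then \<Delta> j \<xi> else 0))"
      using \<xi> by (intro sum.cong refl) (simp add: \<alpha>_step \<Delta>_def)
    then show ?thesis
      by (simp only: memory_error_def sum.distrib distrib_left)
  qed
  then have "expected_memory_error (Suc t)
      = expectation (\<lambda>\<xi>. memory_error (memory t \<xi>) + ?c * (\<Sum>j=1..n. if j \<in> J t \<xi> then \<Delta> j \<xi> else 0))"
    unfolding expected_memory_error_def by (intro Bochner_Integration.integral_cong refl)
  also have "\<dots> = expected_memory_error t
      + ?c * (\<Sum>j=1..n. expectation (\<lambda>\<xi>. if j \<in> J t \<xi> then \<Delta> j \<xi> else 0))"
  proof -
    have int: "integrable M (\<lambda>\<xi>. if j \<in> J t \<xi> then \<Delta> j \<xi> else 0)" if "j \<in> {1..n}" for j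
      using that by (intro integrable_adapted[OF adapted_memorized] \<Delta>)
    then have "integrable M (\<lambda>\<xi>. \<Sum>j=1..n. if j \<in> J t \<xi> then \<Delta> j \<xi> else 0)"
      by (intro Bochner_Integration.integrable_sum)
    then show ?thesis
      using int by (simp add: expected_memory_error_def del: One_nat_def)
  qed
  also have "(\<Sum>j=1..n. expectation (\<lambda>\<xi>. if j \<in> J t \<xi> then \<Delta> j \<xi> else 0)) = (\<Sum>j=1..n. q / real n * expectation (\<Delta> j))"
    using expectation_memorized[OF \<Delta>] by (intro sum.cong) auto
  also have "?c * (\<Sum>j=1..n. q / real n * expectation (\<Delta> j))
      = q / real n * (?c * (\<Sum>j=1..n. expectation (\<Delta> j)))"
    by (simp only: sum_distrib_left[symmetric] mult.left_commute)
  also have "?c * (\<Sum>j=1..n. expectation (\<Delta> j)) = expectation (\<lambda>\<xi>. ?c * (\<Sum>j=1..n. \<Delta> j \<xi>))"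
    using integrable_adapted[OF \<Delta>]
    by (simp only: integral_mult_right_zero Bochner_Integration.integral_sum)
  finally have step: "expected_memory_error (Suc t) = expected_memory_error t
      + q / real n * expectation (\<lambda>\<xi>. ?c * (\<Sum>j=1..n. \<Delta> j \<xi>))" .
  have "expectation (\<lambda>\<xi>. ?c * (\<Sum>j=1..n. \<Delta> j \<xi>))
      \<le> expectation (\<lambda>\<xi>. smoothness_gap (z t \<xi>) / 2 - memory_error (memory t \<xi>))"
  proof (rule integral_mono)
    fix \<xi>
    assume "\<xi> \<in> space M"
    let ?s = "\<Sum>j=1..n. (norm (gradient (\<psi> j) (z t \<xi>) - gradient (\<psi> j) xs))\<^sup>2"
    have "?c * ?s = 1 / (2 * L) * ((1 / real n) * ?s)"
      by simp
    also have "\<dots> \<le> 1 / (2 * L) * (L * smoothness_gap (z t \<xi>))"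
      using mean_component_gradient_gap L_gt_0 by (intro mult_left_mono) auto
    also have "\<dots> = smoothness_gap (z t \<xi>) / 2"
      using L_gt_0 by simp
    finally show "?c * (\<Sum>j=1..n. \<Delta> j \<xi>) \<le> smoothness_gap (z t \<xi>) / 2 - memory_error (memory t \<xi>)"
      by (simp only: \<Delta>_def sum_subtractf right_diff_distrib memory_error_def)
  next
    show "integrable M (\<lambda>\<xi>. ?c * (\<Sum>j=1..n. \<Delta> j \<xi>))"
      by (intro integrable_adapted[of t, OF adapted_comp[where K = "\<lambda>s. ?c * s"]] adapted_sum \<Delta>)
  qed simp
  also have "\<dots> = expected_gap t / 2 - expected_memory_error t"
    by (simp add: expected_gap_def expected_memory_error_def)
  finally show ?thesis
    unfolding step using q by (intro add_left_mono mult_left_mono) auto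
qed

lemma sum_expected_memory_error:
  "q / real n * (\<Sum>k<T. expected_memory_error k) + expected_memory_error T
    \<le> memory_error \<alpha>\<^sub>0 + q / real n * ((\<Sum>k<T. expected_gap k) / 2)"
proof (induction T)
  case (Suc T)
  then show ?case
    using expected_memory_error_step[of T] by (simp add: algebra_simps add_divide_distrib)
qed (simp add: expected_memory_error_0)

lemma sum_expected_distance:
  "1 / (2 * \<gamma>) * expected_sq_dist ys T + 2 / 3 * (\<Sum>k<T. expected_gap k)
    \<le> 1 / (2 * \<gamma>) * (norm (y\<^sub>0 - ys))\<^sup>2 + 2 / 3 * (\<Sum>k<T. expected_memory_error k)"
proof (induction T)
  case (Suc T)
  then show ?case
    using expected_distance_step[of T] unfolding sum.lessThan_Suc distrib_left by linarith
qed (simp add: expected_sq_dist_0)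

lemma total_memory_error_le:
  "(\<Sum>k<T. expected_memory_error k) \<le> real n / q * memory_error \<alpha>\<^sub>0 + (\<Sum>k<T. expected_gap k) / 2"
proof -
  have "q / real n * (\<Sum>k<T. expected_memory_error k)
      \<le> memory_error \<alpha>\<^sub>0 + q / real n * ((\<Sum>k<T. expected_gap k) / 2)"
    using sum_expected_memory_error[of T] expected_memory_error_nonneg[of T] by linarith
  then have "real n / q * (q / real n * (\<Sum>k<T. expected_memory_error k))
      \<le> real n / q * (memory_error \<alpha>\<^sub>0 + q / real n * ((\<Sum>k<T. expected_gap k) / 2))"
    using q by (intro mult_left_mono) auto
  then show ?thesis
    using q n by (simp add: distrib_left)
qed

text \<open>
  The memory errors return only half of the smoothness gaps, with the factor 2/3, so one third of the total smoothness gap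
  is left over.
\<close>

lemma expected_distance_le:
  "1 / (2 * \<gamma>) * expected_sq_dist ys T + 1 / 3 * (\<Sum>k<T. expected_gap k)
    \<le> 1 / (2 * \<gamma>) * (norm (y\<^sub>0 - ys))\<^sup>2 + 2 / 3 * (real n / q * memory_error \<alpha>\<^sub>0)"
proof -
  define K where "K = real n / q * memory_error \<alpha>\<^sub>0"
  show ?thesis
    using sum_expected_distance[of T] total_memory_error_le[of T] unfolding K_def[symmetric] by linarith
qed

lemma total_noise_le:
  "1 / 2 * (\<Sum>k<T. expected_gap k) + (\<Sum>k<T. expected_memory_error k)
    \<le> 3 * (1 / (2 * \<gamma>) * (norm (y\<^sub>0 - ys))\<^sup>2) + 3 * (real n / q * memory_error \<alpha>\<^sub>0)"
proof -
  define K where "K = real n / q * memory_error \<alpha>\<^sub>0"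
  have "0 \<le> 1 / (2 * \<gamma>) * expected_sq_dist ys T"
    using expected_sq_dist_nonneg step_size(1) by simp
  then show ?thesis
    using expected_distance_le[of T] total_memory_error_le[of T] unfolding K_def[symmetric] by linarith
qed

text \<open>
  The noise is orthogonal in mean to \<open>z\<^sub>t - a\<close> because \<open>a\<close> is deterministic; only its variance survives.
\<close>

lemma expected_step_gap_le:
  assumes a: "a \<in> domain_of g"
  shows "expectation (step_gap a b t)
    \<le> 1 / 2 * expected_gap t + expected_memory_error t
      + 1 / (2 * \<gamma>) * (expected_sq_dist (a + \<gamma> *\<^sub>R b) t - expected_sq_dist (a + \<gamma> *\<^sub>R b) (Suc t))"
proof -
  let ?Y = "a + \<gamma> *\<^sub>R b"
  define F where "F = (\<lambda>w e. (gradient f w - e) \<bullet> (w - a) + 1 / (4 * L) * (norm (gradient f w - e))\<^sup>2)"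
  have mean: "(1 / real n) * (\<Sum>i=1..n. F w (estimator \<beta> w i))
      \<le> 1 / 2 * smoothness_gap w + 1 * memory_error \<beta>" for w \<beta>
  proof -
    have "(\<Sum>i=1..n. gradient f w - estimator \<beta> w i) = 0"
      unfolding sum_subtractf sum_estimator by (simp add: sum_constant_scaleR)
    then have "(\<Sum>i=1..n. (gradient f w - estimator \<beta> w i) \<bullet> (w - a)) = 0"
      by (simp only: inner_sum_left[symmetric] inner_zero_left)
    then have "(\<Sum>i=1..n. F w (estimator \<beta> w i))
        = 1 / (4 * L) * (\<Sum>i=1..n. (norm (gradient f w - estimator \<beta> w i))\<^sup>2)"
      by (simp only: F_def sum.distrib sum_distrib_left[symmetric] add_0)
    then have "(1 / real n) * (\<Sum>i=1..n. F w (estimator \<beta> w i))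
        = 1 / (4 * L) * ((1 / real n) * (\<Sum>i=1..n. (norm (gradient f w - estimator \<beta> w i))\<^sup>2))"
      by (simp only: mult.left_commute)
    also have "\<dots> \<le> 1 / (4 * L) * (2 * L * smoothness_gap w + 4 * L * memory_error \<beta>)"
      using L_gt_0 by (intro mult_left_mono mean_estimator_variance) auto
    also have "\<dots> = 1 / 2 * smoothness_gap w + 1 * memory_error \<beta>"
      using L_gt_0 by (simp add: field_simps)
    finally show ?thesis .
  qed
  have F_int: "integrable M (\<lambda>\<xi>. F (z t \<xi>) (v t \<xi>))"
    by (rule expectation_estimator_le(1)[OF mean])
  have "expectation (step_gap a b t)
      \<le> expectation (\<lambda>\<xi>. F (z t \<xi>) (v t \<xi>)
          + 1 / (2 * \<gamma>) * ((norm (y t \<xi> - ?Y))\<^sup>2 - (norm (y (Suc t) \<xi> - ?Y))\<^sup>2))"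
  proof (rule integral_mono)
    fix \<xi>
    assume \<xi>: "\<xi> \<in> space M"
    show "step_gap a b t \<xi> \<le> F (z t \<xi>) (v t \<xi>)
        + 1 / (2 * \<gamma>) * ((norm (y t \<xi> - ?Y))\<^sup>2 - (norm (y (Suc t) \<xi> - ?Y))\<^sup>2)"
      using splitting_step_gap[OF convex_f smooth_f L_gt_0 g(1) step_size(1) step_size_le
          x_subgradient[OF \<xi>] y_eq[OF \<xi>] a, of t b]
      unfolding step_gap_def F_def y_step[OF \<xi>] by simp
  next
    show "integrable M (step_gap a b t)"
      by (rule integrable_adapted[OF adapted_step_gap[OF order_refl]])
  qed (intro integrable_mult_right Bochner_Integration.integrable_add
      Bochner_Integration.integrable_diff integrable_sq_dist F_int)
  also have "\<dots> = expectation (\<lambda>\<xi>. F (z t \<xi>) (v t \<xi>))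
      + 1 / (2 * \<gamma>) * (expected_sq_dist ?Y t - expected_sq_dist ?Y (Suc t))"
    using F_int by (simp add: expected_sq_dist_def)
  finally show ?thesis
    using expectation_estimator_le(2)[of F, OF mean, of t] by simp
qed

lemma total_step_gap_le:
  assumes a: "a \<in> domain_of g"
  shows "(\<Sum>k=0..t. expectation (step_gap a b k))
    \<le> 1 / (2 * \<gamma>) * (norm (y\<^sub>0 - (a + \<gamma> *\<^sub>R b)))\<^sup>2
      + 3 * (1 / (2 * \<gamma>) * (norm (y\<^sub>0 - ys))\<^sup>2) + 3 * (real n / q * memory_error \<alpha>\<^sub>0)"
proof -
  let ?Y = "a + \<gamma> *\<^sub>R b"
  have "(\<Sum>k<T. expectation (step_gap a b k)) + 1 / (2 * \<gamma>) * expected_sq_dist ?Y T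
      \<le> 1 / (2 * \<gamma>) * (norm (y\<^sub>0 - ?Y))\<^sup>2 + (1 / 2 * (\<Sum>k<T. expected_gap k) + (\<Sum>k<T. expected_memory_error k))" for T
  proof (induction T)
    case (Suc T)
    then show ?case
      using expected_step_gap_le[OF a, of b T]
      unfolding sum.lessThan_Suc distrib_left right_diff_distrib by linarith
  qed (simp add: expected_sq_dist_0)
  moreover have "0 \<le> 1 / (2 * \<gamma>) * expected_sq_dist ?Y T" for T
    using expected_sq_dist_nonneg step_size(1) by simp
  ultimately have "(\<Sum>k<T. expectation (step_gap a b k))
      \<le> 1 / (2 * \<gamma>) * (norm (y\<^sub>0 - ?Y))\<^sup>2
        + (3 * (1 / (2 * \<gamma>) * (norm (y\<^sub>0 - ys))\<^sup>2) + 3 * (real n / q * memory_error \<alpha>\<^sub>0))" for T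
    using total_noise_le[of T] by (meson add_left_mono add_increasing2 order_trans le_add_same_cancel1 add_le_cancel_left)
  from this[of "Suc t"] show ?thesis
    by (simp add: atLeast0AtMost lessThan_Suc_atMost add.assoc)
qed

theorem expected_lagrangian_gap_le:
  assumes a: "a \<in> domain_of g" and b: "b \<in> domain_of (fenchel_conjugate h)"
  shows "ereal_expectation M (\<lambda>\<xi>. lagrangian f g h (average t (\<lambda>k. x k \<xi>)) b
      - lagrangian f g h a (average t (\<lambda>k. u k \<xi>)))
    \<le> ereal (1 / real (t + 1) * (1 / (2 * \<gamma>) * (norm (y\<^sub>0 - (a + \<gamma> *\<^sub>R b)))\<^sup>2
      + 3 * (1 / (2 * \<gamma>) * (norm (y\<^sub>0 - ys))\<^sup>2) + 3 * (real n / q * memory_error \<alpha>\<^sub>0)))"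
proof -
  let ?x = "\<lambda>\<xi>. average t (\<lambda>k. x k \<xi>)" and ?u = "\<lambda>\<xi>. average t (\<lambda>k. u k \<xi>)"
  let ?c = "\<lambda>u. real_of_ereal (fenchel_conjugate h u)"
  let ?X = "\<lambda>\<xi>. f (?x \<xi>) + real_of_ereal (g (?x \<xi>)) + ?x \<xi> \<bullet> b - ?c b
        - (f a + real_of_ereal (g a) + a \<bullet> ?u \<xi> - ?c (?u \<xi>))"
  have X: "adapted (Suc t) ?X"
    using adapted_comp[OF adapted_averages[of t], where K = "\<lambda>(x, u). f x + real_of_ereal (g x) + x \<bullet> b - ?c b
        - (f a + real_of_ereal (g a) + a \<bullet> u - ?c u)"] by simp
  have int: "integrable M (step_gap a b k)" for k
    by (rule integrable_adapted[OF adapted_step_gap[OF order_refl]])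
  have "expectation ?X \<le> expectation (\<lambda>\<xi>. 1 / real (t + 1) * (\<Sum>k=0..t. step_gap a b k \<xi>))"
    using a b int
    by (intro integral_mono integrable_adapted[OF X] averaged_gap_le integrable_mult_right
        Bochner_Integration.integrable_sum)
  also have "\<dots> = 1 / real (t + 1) * (\<Sum>k=0..t. expectation (step_gap a b k))"
    using int by (simp only: integral_mult_right_zero Bochner_Integration.integral_sum)
  also have "\<dots> \<le> 1 / real (t + 1) * (1 / (2 * \<gamma>) * (norm (y\<^sub>0 - (a + \<gamma> *\<^sub>R b)))\<^sup>2
      + 3 * (1 / (2 * \<gamma>) * (norm (y\<^sub>0 - ys))\<^sup>2) + 3 * (real n / q * memory_error \<alpha>\<^sub>0))"
    using total_step_gap_le[OF a] by (intro mult_left_mono) auto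
  finally show ?thesis
    using ereal_expectation_adapted[OF X lagrangian_gap_real[OF _ a b]] by simp
qed

text \<open>
  The starting point splits into its proximal point and \<open>\<gamma>\<close> times a subgradient of \<open>h\<close>, whose norm is at most \<open>\<beta>\<close>.
\<close>

lemma initial_distance_le:
  assumes "ereal_lipschitz \<beta> h"
  shows "1 / (2 * \<gamma>) * (norm (y\<^sub>0 - a))\<^sup>2 \<le> 1 / \<gamma> * (norm (prox \<gamma> h y\<^sub>0 - a))\<^sup>2 + \<gamma> * \<beta>\<^sup>2"
proof -
  let ?z = "prox \<gamma> h y\<^sub>0"
  let ?u = "(1 / \<gamma>) *\<^sub>R (y\<^sub>0 - ?z)"
  have "norm ?u \<le> \<beta>"
    using assms prox_subgradient[OF h step_size(1)] by (rule subgradient_norm_le_lipschitz)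
  then have u: "(norm ?u)\<^sup>2 \<le> \<beta>\<^sup>2"
    by (intro power_mono) auto
  have "y\<^sub>0 - a = (?z - a) + \<gamma> *\<^sub>R ?u"
    using step_size(1) by simp
  then have "(norm (y\<^sub>0 - a))\<^sup>2 \<le> 2 * (norm (?z - a))\<^sup>2 + 2 * (norm (\<gamma> *\<^sub>R ?u))\<^sup>2"
    by (simp only: norm_add_squared_le)
  also have "(norm (\<gamma> *\<^sub>R ?u))\<^sup>2 = \<gamma>\<^sup>2 * (norm ?u)\<^sup>2"
    by (simp only: norm_scaleR power_mult_distrib power2_abs)
  also have "2 * (norm (?z - a))\<^sup>2 + 2 * (\<gamma>\<^sup>2 * (norm ?u)\<^sup>2) \<le> 2 * (norm (?z - a))\<^sup>2 + 2 * (\<gamma>\<^sup>2 * \<beta>\<^sup>2)"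
    using u by (intro add_left_mono mult_left_mono) auto
  finally have "1 / (2 * \<gamma>) * (norm (y\<^sub>0 - a))\<^sup>2 \<le> 1 / (2 * \<gamma>) * (2 * (norm (?z - a))\<^sup>2 + 2 * (\<gamma>\<^sup>2 * \<beta>\<^sup>2))"
    using step_size(1) by (intro mult_left_mono) auto
  also have "\<dots> = 1 / \<gamma> * (norm (?z - a))\<^sup>2 + \<gamma> * \<beta>\<^sup>2"
    using step_size(1) by (simp add: field_simps power2_eq_square)
  finally show ?thesis .
qed

lemma expected_displacement_le:
  "1 / (4 * \<gamma>) * expected_sq_dist y\<^sub>0 T
    \<le> 2 * (1 / (2 * \<gamma>) * (norm (y\<^sub>0 - ys))\<^sup>2) + 2 / 3 * (real n / q * memory_error \<alpha>\<^sub>0)"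
proof -
  have "expected_sq_dist y\<^sub>0 T \<le> expectation (\<lambda>\<xi>. 2 * (norm (y T \<xi> - ys))\<^sup>2 + 2 * (norm (y\<^sub>0 - ys))\<^sup>2)"
    unfolding expected_sq_dist_def
  proof (rule integral_mono)
    fix \<xi>
    show "(norm (y T \<xi> - y\<^sub>0))\<^sup>2 \<le> 2 * (norm (y T \<xi> - ys))\<^sup>2 + 2 * (norm (y\<^sub>0 - ys))\<^sup>2"
      using norm_diff_squared_le[of "y T \<xi> - ys" "y\<^sub>0 - ys"] by simp
  qed simp_all
  also have "\<dots> = 2 * expected_sq_dist ys T + 2 * (norm (y\<^sub>0 - ys))\<^sup>2"
    by (simp add: expected_sq_dist_def prob_space)
  finally have "1 / (4 * \<gamma>) * expected_sq_dist y\<^sub>0 T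
      \<le> 1 / (4 * \<gamma>) * (2 * expected_sq_dist ys T + 2 * (norm (y\<^sub>0 - ys))\<^sup>2)"
    using step_size(1) by (intro mult_left_mono) auto
  also have "\<dots> = 1 / (2 * \<gamma>) * expected_sq_dist ys T + 1 / (2 * \<gamma>) * (norm (y\<^sub>0 - ys))\<^sup>2"
    using step_size(1) by (simp add: field_simps)
  finally show ?thesis
    using expected_distance_le[of T] sum_nonneg[of "{..<T}" expected_gap] expected_gap_nonneg by fastforce
qed

theorem expected_objective_gap_le:
  assumes lip: "ereal_lipschitz \<beta> h" and a: "a \<in> domain_of g"
  shows "ereal_expectation M (\<lambda>\<xi>. ereal (f (average t (\<lambda>k. x k \<xi>))) + g (average t (\<lambda>k. x k \<xi>))
        + h (average t (\<lambda>k. x k \<xi>))) - (ereal (f a) + g a + h a)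
    \<le> ereal (1 / real (t + 1) * (1 / \<gamma> * (norm (prox \<gamma> h y\<^sub>0 - a))\<^sup>2 + 2 * \<gamma> * \<beta>\<^sup>2
        + 5 * (1 / (2 * \<gamma>) * (norm (y\<^sub>0 - ys))\<^sup>2) + 11 / 3 * (real n / q * memory_error \<alpha>\<^sub>0)))"
    (is "_ \<le> ereal (1 / real (t + 1) * ?B)")
proof -
  let ?x = "\<lambda>\<xi>. average t (\<lambda>k. x k \<xi>)"
  let ?P = "\<lambda>w. f w + real_of_ereal (g w) + real_of_ereal (h w)"
  have P: "ereal (f w) + g w + h w = ereal (?P w)" if wd: "w \<in> domain_of g" for w
  proof -
    obtain r s where "g w = ereal r" "h w = ereal s"
      using proper_domain_real[OF g(1) wd, symmetric]
        proper_domain_real[OF h(1), of w, symmetric] ereal_lipschitz_finite(1)[OF lip] by auto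
    then show ?thesis
      by simp
  qed
  have xd: "?x \<xi> \<in> domain_of g" if "\<xi> \<in> space M" for \<xi>
    using iterates_in_domain(1)[OF that] by (intro jensen_average(1)[OF ereal_convex_real[OF g(1,3)]])
  have X: "adapted (Suc t) (\<lambda>\<xi>. ?P (?x \<xi>))"
    using adapted_comp[OF adapted_averages[of t], where K = "\<lambda>(x, u). ?P x"] by simp
  have int: "integrable M (step_gap a 0 k)" for k
    by (rule integrable_adapted[OF adapted_step_gap[OF order_refl]])
  have "expectation (\<lambda>\<xi>. ?P (?x \<xi>)) \<le> expectation (\<lambda>\<xi>. ?P a + 1 / real (t + 1) *
      ((\<Sum>k=0..t. step_gap a 0 k \<xi>) + (\<gamma> * \<beta>\<^sup>2 + 1 / (4 * \<gamma>) * (norm (y (Suc t) \<xi> - y\<^sub>0))\<^sup>2)))"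
  proof (rule integral_mono)
    fix \<xi>
    assume \<xi>: "\<xi> \<in> space M"
    let ?d = "norm (y (Suc t) \<xi> - y\<^sub>0)"
    \<comment> \<open>The weight is chosen such that the \<open>\<beta>\<close>-terms of this step and of \<open>initial_distance_le\<close> add up to \<open>2 \<gamma> \<beta>\<^sup>2\<close>.\<close>
    have "0 \<le> (2 * \<gamma> * \<beta> - ?d)\<^sup>2"
      by simp
    then have "\<beta> * ?d \<le> \<gamma> * \<beta>\<^sup>2 + 1 / (4 * \<gamma>) * ?d\<^sup>2"
      using step_size(1) by (simp add: field_simps power2_eq_square)
    then have "1 / real (t + 1) * ((\<Sum>k=0..t. step_gap a 0 k \<xi>) + \<beta> * ?d)
        \<le> 1 / real (t + 1) * ((\<Sum>k=0..t. step_gap a 0 k \<xi>) + (\<gamma> * \<beta>\<^sup>2 + 1 / (4 * \<gamma>) * ?d\<^sup>2))"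
      by (intro mult_left_mono add_left_mono) auto
    then show "?P (?x \<xi>) \<le> ?P a + 1 / real (t + 1) *
        ((\<Sum>k=0..t. step_gap a 0 k \<xi>) + (\<gamma> * \<beta>\<^sup>2 + 1 / (4 * \<gamma>) * ?d\<^sup>2))"
      using averaged_objective_gap_le[OF \<xi> a lip, of t] by linarith
  next
    show "integrable M (\<lambda>\<xi>. ?P (?x \<xi>))"
      by (rule integrable_adapted[OF X])
  qed (intro integrable_mult_right Bochner_Integration.integrable_add Bochner_Integration.integrable_sum
      integrable_const integrable_sq_dist int)
  also have "\<dots> = ?P a + 1 / real (t + 1) * ((\<Sum>k=0..t. expectation (step_gap a 0 k))
      + (\<gamma> * \<beta>\<^sup>2 + 1 / (4 * \<gamma>) * expected_sq_dist y\<^sub>0 (Suc t)))"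
    using int by (simp add: expected_sq_dist_def prob_space del: One_nat_def)
  also have "\<dots> \<le> ?P a + 1 / real (t + 1) * ?B"
  proof (intro add_left_mono mult_left_mono)
    \<comment> \<open>The step gaps contribute three multiples of the distance term, the displacement of \<open>y\<close> two more.\<close>
    define K where "K = real n / q * memory_error \<alpha>\<^sub>0"
    show "(\<Sum>k=0..t. expectation (step_gap a 0 k))
        + (\<gamma> * \<beta>\<^sup>2 + 1 / (4 * \<gamma>) * expected_sq_dist y\<^sub>0 (Suc t)) \<le> ?B"
      using total_step_gap_le[OF a, of 0 t] initial_distance_le[OF lip, of a]
        expected_displacement_le[of "Suc t"]
      unfolding K_def[symmetric] scaleR_zero_right add_0_right by linarith
  qed simp
  finally show ?thesis
    using ereal_expectation_adapted[OF X P[OF xd]] P[OF a] by simp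
qed

text \<open>
  Comparing the objective at a minimizer with the subgradient inequalities at \<open>xs\<close> shows that the Bregman distance of \<open>f\<close>
  between the two points vanishes. It is the mean of those of the \<open>\<psi> j\<close> plus that of \<open>\<omega>\<close>, all nonnegative, so each of them vanishes,
  and the one of \<open>\<psi> j\<close> dominates the squared distance of the gradients of \<open>\<psi> j\<close>.
\<close>

lemma minimizer_gradients_agree:
  assumes min: "is_arg_min (\<lambda>a. ereal (f a) + g a + h a) (\<lambda>_. True) p" and j: "j \<in> {1..n}"
  shows "gradient (\<psi> j) p = gradient (\<psi> j) xs"
proof -
  have xs: "xs \<in> domain_of g" "xs \<in> domain_of h"
    using sol_g sol_h by (auto dest: subgradient_domain)
  note p = composite_minimizer_real[OF g(1) h(1) xs min]
  have "f p + real_of_ereal (g p) + real_of_ereal (h p) \<le> f xs + real_of_ereal (g xs) + real_of_ereal (h xs)"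
    using xs by (rule p(3))
  moreover have "real_of_ereal (g xs) + (- (us + gradient f xs)) \<bullet> (p - xs) \<le> real_of_ereal (g p)"
    using g(1) sol_g p(1) by (rule subgradient_le)
  moreover have "real_of_ereal (h xs) + us \<bullet> (p - xs) \<le> real_of_ereal (h p)"
    using h(1) sol_h p(2) by (rule subgradient_le)
  moreover have "(- (us + gradient f xs)) \<bullet> (p - xs) = - (us \<bullet> (p - xs)) - gradient f xs \<bullet> (p - xs)"
    by (simp add: inner_simps)
  ultimately have fp: "f p \<le> f xs + gradient f xs \<bullet> (p - xs)"
    by linarith
  define e where "e = (\<lambda>j. \<psi> j p - \<psi> j xs - gradient (\<psi> j) xs \<bullet> (p - xs))"
  have e_ge: "1 / (2 * L) * (norm (gradient (\<psi> j) p - gradient (\<psi> j) xs))\<^sup>2 \<le> e j" if "j \<in> {1..n}" for j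
    using convex_smooth_lower_bound[OF smooth_component[OF that] L_gt_0, of xs p] by (simp add: e_def)
  have e_nonneg: "0 \<le> e j" if "j \<in> {1..n}" for j
    using convex_gradient_le[OF smooth_component[OF that], of xs p] by (simp add: e_def)
  have "\<omega> xs + gradient \<omega> xs \<bullet> (p - xs) \<le> \<omega> p"
    using \<omega> by (rule convex_gradient_le)
  moreover have "1 / real n * (\<Sum>j=1..n. e j) = f p - f xs - gradient f xs \<bullet> (p - xs)
      - (\<omega> p - \<omega> xs - gradient \<omega> xs \<bullet> (p - xs))"
    by (simp add: e_def f_def gradient_f sum_subtractf inner_add_left inner_sum_left diff_divide_distrib)
  ultimately have "1 / real n * (\<Sum>j=1..n. e j) \<le> 0"
    using fp by linarith
  then have "(\<Sum>j=1..n. e j) \<le> 0"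
    using n by (simp add: field_simps)
  then have "(\<Sum>j=1..n. e j) = 0"
    using e_nonneg by (intro antisym sum_nonneg)
  then have "e j = 0"
    using e_nonneg j by (subst (asm) sum_nonneg_eq_0_iff) auto
  then have "(norm (gradient (\<psi> j) p - gradient (\<psi> j) xs))\<^sup>2 \<le> 0"
    using e_ge[OF j] L_gt_0 by (simp add: divide_le_0_iff)
  then show ?thesis
    by simp
qed

lemma memory_error_minimizer:
  assumes "is_arg_min (\<lambda>a. ereal (f a) + g a + h a) (\<lambda>_. True) p"
  shows "memory_error \<beta> = 1 / (2 * real n * L) * (\<Sum>j=1..n. (norm (\<beta> j - gradient (\<psi> j) p))\<^sup>2)"
  using minimizer_gradients_agree[OF assms] by (simp add: memory_error_def)

end

section \<open>Convergence of VR-TOS\<close>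

theorem theorem1:
  fixes \<psi> :: "nat \<Rightarrow> real ^ 'p \<Rightarrow> real" and \<omega> :: "real ^ 'p \<Rightarrow> real"
    and g h :: "real ^ 'p \<Rightarrow> ereal"
    and n :: nat and L\<^sub>\<psi> L\<^sub>\<omega> \<gamma> q :: real
    and M :: "'w measure" and I :: "nat \<Rightarrow> 'w \<Rightarrow> nat" and J :: "nat \<Rightarrow> 'w \<Rightarrow> nat set"
    and y\<^sub>0 :: "real ^ 'p" and \<alpha>\<^sub>0 :: "nat \<Rightarrow> real ^ 'p"
    and x y z u v :: "nat \<Rightarrow> 'w \<Rightarrow> real ^ 'p" and \<alpha> :: "nat \<Rightarrow> nat \<Rightarrow> 'w \<Rightarrow> real ^ 'p"
    and xstar :: "real ^ 'p"
    and f :: "real ^ 'p \<Rightarrow> real" and P :: "real ^ 'p \<Rightarrow> ereal"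
    and L :: "real ^ 'p \<Rightarrow> real ^ 'p \<Rightarrow> ereal"
    and xbar ubar :: "nat \<Rightarrow> 'w \<Rightarrow> real ^ 'p" and L\<^sub>f H\<^sub>0 :: real
  defines "f \<equiv> \<lambda>a. (1 / real n) * (\<Sum>j=1..n. \<psi> j a) + \<omega> a"
    and "L\<^sub>f \<equiv> L\<^sub>\<psi> + L\<^sub>\<omega>"
    and "P \<equiv> \<lambda>a. ereal (f a) + g a + h a"
    and "L \<equiv> lagrangian f g h"
    and "xbar \<equiv> \<lambda>t \<xi>. (1 / real (t + 1)) *\<^sub>R (\<Sum>k=0..t. x k \<xi>)"
    and "ubar \<equiv> \<lambda>t \<xi>. (1 / real (t + 1)) *\<^sub>R (\<Sum>k=0..t. u k \<xi>)"
    and "H\<^sub>0 \<equiv> 1 / (2 * real n * L\<^sub>f) * (\<Sum>j=1..n. (norm (\<alpha>\<^sub>0 j - gradient (\<psi> j) xstar))\<^sup>2)"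
  assumes n: "1 \<le> n"
    and \<psi>: "\<And>j. j \<in> {1..n} \<Longrightarrow> convex_on UNIV (\<psi> j) \<and> smooth L\<^sub>\<psi> (\<psi> j)"
    and \<omega>: "convex_on UNIV \<omega>" "smooth L\<^sub>\<omega> \<omega>"
    and g: "proper g" "lower_semicontinuous g" "ereal_convex g"
    and h: "proper h" "lower_semicontinuous h" "ereal_convex h"
    and qualification: "rel_interior (domain_of g) \<inter> rel_interior (domain_of h) \<noteq> {}"
    and minimizer: "is_arg_min P (\<lambda>_. True) xstar"
    and L\<^sub>f_pos: "0 < L\<^sub>f"
    and step_size: "0 < \<gamma>" "\<gamma> \<le> 1 / (3 * L\<^sub>f)"
    and q: "0 < q"
    and M: "prob_space M"
    and sampling: "uniform_sampling M n I J"
    and memorization: "uniform_memorization M n q I J"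
    and y_init: "\<And>\<xi>. \<xi> \<in> space M \<Longrightarrow> y 0 \<xi> = y\<^sub>0"
    and \<alpha>_init: "\<And>j \<xi>. j \<in> {1..n} \<Longrightarrow> \<xi> \<in> space M \<Longrightarrow> \<alpha> j 0 \<xi> = \<alpha>\<^sub>0 j"
    and z_step: "\<And>t \<xi>. \<xi> \<in> space M \<Longrightarrow> z t \<xi> = prox \<gamma> h (y t \<xi>)"
    and u_step: "\<And>t \<xi>. \<xi> \<in> space M \<Longrightarrow> u t \<xi> = (1 / \<gamma>) *\<^sub>R (y t \<xi> - z t \<xi>)"
    and v_step: "\<And>t \<xi>. \<xi> \<in> space M \<Longrightarrow>
          v t \<xi> = gradient (\<psi> (I t \<xi>)) (z t \<xi>) - \<alpha> (I t \<xi>) t \<xi>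
                  + (1 / real n) *\<^sub>R (\<Sum>j=1..n. \<alpha> j t \<xi>) + gradient \<omega> (z t \<xi>)"
    and x_step: "\<And>t \<xi>. \<xi> \<in> space M \<Longrightarrow>
          x t \<xi> = prox \<gamma> g (2 *\<^sub>R z t \<xi> - y t \<xi> - \<gamma> *\<^sub>R v t \<xi>)"
    and y_step: "\<And>t \<xi>. \<xi> \<in> space M \<Longrightarrow> y (Suc t) \<xi> = y t \<xi> + x t \<xi> - z t \<xi>"
    and \<alpha>_step: "\<And>j t \<xi>. j \<in> {1..n} \<Longrightarrow> \<xi> \<in> space M \<Longrightarrow>
          \<alpha> j (Suc t) \<xi> = (if j \<in> J t \<xi> then gradient (\<psi> j) (z t \<xi>) else \<alpha> j t \<xi>)"
  shows
    "(\<forall>a \<in> domain_of g. \<forall>b \<in> domain_of (fenchel_conjugate h).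
        limsup (\<lambda>t. ereal_expectation M (\<lambda>\<xi>. L (xbar t \<xi>) b - L a (ubar t \<xi>))) \<le> 0)
     \<and> (\<gamma> = 1 / (3 * L\<^sub>f) \<longrightarrow>
        (\<forall>t. \<forall>a \<in> domain_of g. \<forall>b \<in> domain_of (fenchel_conjugate h).
           \<forall>ystar \<in> fixed_points (tos_operator \<gamma> f g h).
             ereal_expectation M (\<lambda>\<xi>. L (xbar t \<xi>) b - L a (ubar t \<xi>))
               \<le> ereal (10 * real n / (q * real (t + 1)) *
                    (3 * L\<^sub>f * q / (20 * real n) * (norm (y\<^sub>0 - (a + \<gamma> *\<^sub>R b)))\<^sup>2
                     + 3 * L\<^sub>f * q / (2 * real n) * (norm (y\<^sub>0 - ystar))\<^sup>2
                     + H\<^sub>0))))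
     \<and> (\<forall>\<beta>\<^sub>h. \<gamma> = 1 / (3 * L\<^sub>f) \<and> ereal_lipschitz \<beta>\<^sub>h h \<longrightarrow>
        (\<forall>t. \<forall>ystar \<in> fixed_points (tos_operator \<gamma> f g h).
             ereal_expectation M (\<lambda>\<xi>. P (xbar t \<xi>)) - P xstar
               \<le> ereal (10 * real n / (q * real (t + 1)) *
                    (6 * L\<^sub>f * q / (20 * real n) * (norm (prox \<gamma> h y\<^sub>0 - xstar))\<^sup>2
                     + 3 * L\<^sub>f * q / (2 * real n) * (norm (y\<^sub>0 - ystar))\<^sup>2
                     + q / (15 * real n * L\<^sub>f) * \<beta>\<^sub>h\<^sup>2
                     + H\<^sub>0))))"
proof -
  interpret V: vr_tos M n q I J \<psi> \<omega> g h L\<^sub>\<psi> L\<^sub>\<omega> \<gamma> y\<^sub>0 \<alpha>\<^sub>0 x y z u v \<alpha>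
    using n \<psi> \<omega> g h L\<^sub>f_pos step_size q M sampling memorization
      y_init \<alpha>_init z_step u_step v_step x_step y_step \<alpha>_step
    unfolding L\<^sub>f_def vr_tos_def vr_tos_axioms_def index_process_def index_process_axioms_def by blast
  have f: "V.f = f"
    unfolding f_def V.f_def ..
  have Lf: "V.L = L\<^sub>f"
    unfolding L\<^sub>f_def V.L_def ..
  have xbar: "average t (\<lambda>k. x k \<xi>) = xbar t \<xi>" and ubar: "average t (\<lambda>k. u k \<xi>) = ubar t \<xi>" for t \<xi>
    unfolding average_def xbar_def ubar_def by simp_all
  have min: "is_arg_min (\<lambda>a. ereal (V.f a) + g a + h a) (\<lambda>_. True) xstar"
    using minimizer unfolding f P_def .
  \<comment> \<open>The gradients at every primal-dual solution are those at \<open>xstar\<close>.\<close>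
  have H0: "vr_tos_solution.memory_error n \<psi> L\<^sub>\<psi> L\<^sub>\<omega> xs \<alpha>\<^sub>0 = H\<^sub>0"
    if "vr_tos_solution M n q I J \<psi> \<omega> g h L\<^sub>\<psi> L\<^sub>\<omega> \<gamma> y\<^sub>0 \<alpha>\<^sub>0 x y z u v \<alpha> xs us" for xs us
  proof -
    interpret S: vr_tos_solution M n q I J \<psi> \<omega> g h L\<^sub>\<psi> L\<^sub>\<omega> \<gamma> y\<^sub>0 \<alpha>\<^sub>0 x y z u v \<alpha> xs us
      by (rule that)
    show ?thesis
      using S.memory_error_minimizer[OF min, of \<alpha>\<^sub>0] by (simp add: H\<^sub>0_def Lf)
  qed
  have H0_nonneg: "0 \<le> H\<^sub>0"
    unfolding H\<^sub>0_def using L\<^sub>f_pos by (intro mult_nonneg_nonneg sum_nonneg) auto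
  have fixed_point: "vr_tos_solution M n q I J \<psi> \<omega> g h L\<^sub>\<psi> L\<^sub>\<omega> \<gamma> y\<^sub>0 \<alpha>\<^sub>0 x y z u v \<alpha>
      (prox \<gamma> h w) ((1 / \<gamma>) *\<^sub>R (w - prox \<gamma> h w))"
    if w: "w \<in> fixed_points (tos_operator \<gamma> f g h)" for w
  proof
    let ?z = "prox \<gamma> h w"
    let ?u = "(1 / \<gamma>) *\<^sub>R (w - ?z)"
    show "subgradient h ?u ?z"
      using h step_size(1) by (rule prox_subgradient)
    \<comment> \<open>The fixed point equation says that both proximal points of the operator coincide.\<close>
    have "prox \<gamma> g (2 *\<^sub>R ?z - w - \<gamma> *\<^sub>R gradient f ?z) = ?z"
      using w by (simp add: fixed_points_def tos_operator_def Let_def)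
    then have "subgradient g ((1 / \<gamma>) *\<^sub>R (2 *\<^sub>R ?z - w - \<gamma> *\<^sub>R gradient f ?z - ?z)) ?z"
      using prox_subgradient[OF g step_size(1)] by metis
    moreover have "(1 / \<gamma>) *\<^sub>R (2 *\<^sub>R ?z - w - \<gamma> *\<^sub>R gradient f ?z - ?z) = - (?u + gradient f ?z)"
      using step_size(1) by (simp add: algebra_simps scaleR_2)
    ultimately show "subgradient g (- (?u + gradient V.f ?z)) ?z"
      by (simp add: f)
  qed
  have fixed_point_eq: "prox \<gamma> h w + \<gamma> *\<^sub>R ((1 / \<gamma>) *\<^sub>R (w - prox \<gamma> h w)) = w" for w
    using step_size(1) by simp
  have bound_mono: "1 / real (t + 1) * r \<le> 10 * real n / (q * real (t + 1)) * s"
    if "r \<le> 10 * real n / q * s" for r s t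
  proof -
    have "1 / real (t + 1) * r \<le> 1 / real (t + 1) * (10 * real n / q * s)"
      using that by (intro mult_left_mono) auto
    then show ?thesis
      by (simp add: mult_ac)
  qed
  show ?thesis
  proof (intro conjI ballI allI impI)
    fix a b
    assume a: "a \<in> domain_of g" and b: "b \<in> domain_of (fenchel_conjugate h)"
    obtain us where us: "subgradient g (- (us + gradient V.f xstar)) xstar" "subgradient h us xstar"
      using minimizer_with_smooth_term_subgradients[OF V.smooth_f g(1,3) h(1,3) qualification min] by blast
    interpret S: vr_tos_solution M n q I J \<psi> \<omega> g h L\<^sub>\<psi> L\<^sub>\<omega> \<gamma> y\<^sub>0 \<alpha>\<^sub>0 x y z u v \<alpha> xstar us
      by unfold_locales (use us in auto)
    define C where "C = 1 / (2 * \<gamma>) * (norm (y\<^sub>0 - (a + \<gamma> *\<^sub>R b)))\<^sup>2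
      + 3 * (1 / (2 * \<gamma>) * (norm (y\<^sub>0 - S.ys))\<^sup>2) + 3 * (real n / q * S.memory_error \<alpha>\<^sub>0)"
    have "limsup (\<lambda>t. ereal_expectation M (\<lambda>\<xi>. L (xbar t \<xi>) b - L a (ubar t \<xi>)))
        \<le> limsup (\<lambda>t. ereal (1 / real (t + 1) * C))"
      using S.expected_lagrangian_gap_le[OF a b]
      by (intro Limsup_mono always_eventually allI) (simp only: C_def L_def f xbar ubar)
    also have "\<dots> = ereal 0"
    proof (rule lim_imp_Limsup)
      have "(\<lambda>t. 1 / real (t + 1)) \<longlonglongrightarrow> 0"
        using LIMSEQ_inverse_real_of_nat by (simp add: inverse_eq_divide)
      then show "(\<lambda>t. ereal (1 / real (t + 1) * C)) \<longlonglongrightarrow> ereal 0"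
        by (intro tendsto_ereal tendsto_mult_left_zero)
    qed simp
    finally show "limsup (\<lambda>t. ereal_expectation M (\<lambda>\<xi>. L (xbar t \<xi>) b - L a (ubar t \<xi>))) \<le> 0"
      by (simp add: zero_ereal_def)
  next
    fix t a b ystar
    assume \<gamma>: "\<gamma> = 1 / (3 * L\<^sub>f)" and a: "a \<in> domain_of g" and b: "b \<in> domain_of (fenchel_conjugate h)"
      and ystar: "ystar \<in> fixed_points (tos_operator \<gamma> f g h)"
    interpret S: vr_tos_solution M n q I J \<psi> \<omega> g h L\<^sub>\<psi> L\<^sub>\<omega> \<gamma> y\<^sub>0 \<alpha>\<^sub>0 x y z u v \<alpha>
        "prox \<gamma> h ystar" "(1 / \<gamma>) *\<^sub>R (ystar - prox \<gamma> h ystar)"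
      using ystar by (rule fixed_point)
    let ?A = "(norm (y\<^sub>0 - (a + \<gamma> *\<^sub>R b)))\<^sup>2" and ?R = "(norm (y\<^sub>0 - ystar))\<^sup>2"
    have "1 / (2 * \<gamma>) * ?A + 3 * (1 / (2 * \<gamma>) * ?R) + 3 * (real n / q * H\<^sub>0)
        = 3 * L\<^sub>f / 2 * ?A + 9 * L\<^sub>f / 2 * ?R + 3 * (real n / q * H\<^sub>0)"
      by (simp add: \<gamma>)
    also have "\<dots> \<le> 3 * L\<^sub>f / 2 * ?A + 15 * L\<^sub>f * ?R + 10 * (real n / q * H\<^sub>0)"
      using L\<^sub>f_pos H0_nonneg q by (intro add_mono mult_right_mono order_refl) auto
    also have "\<dots> = 10 * real n / q * (3 * L\<^sub>f * q / (20 * real n) * ?A + 3 * L\<^sub>f * q / (2 * real n) * ?R + H\<^sub>0)"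
      using n q by (simp add: distrib_left)
    finally have "1 / (2 * \<gamma>) * ?A + 3 * (1 / (2 * \<gamma>) * ?R) + 3 * (real n / q * H\<^sub>0)
        \<le> 10 * real n / q * (3 * L\<^sub>f * q / (20 * real n) * ?A + 3 * L\<^sub>f * q / (2 * real n) * ?R + H\<^sub>0)" .
    from bound_mono[OF this, of t]
    show "ereal_expectation M (\<lambda>\<xi>. L (xbar t \<xi>) b - L a (ubar t \<xi>))
        \<le> ereal (10 * real n / (q * real (t + 1)) * (3 * L\<^sub>f * q / (20 * real n) * ?A
            + 3 * L\<^sub>f * q / (2 * real n) * ?R + H\<^sub>0))"
      using S.expected_lagrangian_gap_le[OF a b, of t]
      unfolding S.ys_def fixed_point_eq H0[OF S.vr_tos_solution_axioms] f xbar ubar L_def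
      by (meson ereal_less_eq(3) order_trans)
  next
    fix \<beta>\<^sub>h t ystar
    assume \<gamma>': "\<gamma> = 1 / (3 * L\<^sub>f) \<and> ereal_lipschitz \<beta>\<^sub>h h"
      and ystar: "ystar \<in> fixed_points (tos_operator \<gamma> f g h)"
    then have \<gamma>: "\<gamma> = 1 / (3 * L\<^sub>f)" and lip: "ereal_lipschitz \<beta>\<^sub>h h"
      by auto
    interpret S: vr_tos_solution M n q I J \<psi> \<omega> g h L\<^sub>\<psi> L\<^sub>\<omega> \<gamma> y\<^sub>0 \<alpha>\<^sub>0 x y z u v \<alpha>
        "prox \<gamma> h ystar" "(1 / \<gamma>) *\<^sub>R (ystar - prox \<gamma> h ystar)"
      using ystar by (rule fixed_point)
    have a: "xstar \<in> domain_of g"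
      using composite_minimizer_real(1)[OF g(1) h(1) _ _ min] qualification rel_interior_subset by blast
    let ?Z = "(norm (prox \<gamma> h y\<^sub>0 - xstar))\<^sup>2" and ?R = "(norm (y\<^sub>0 - ystar))\<^sup>2"
    have "1 / \<gamma> * ?Z + 2 * \<gamma> * \<beta>\<^sub>h\<^sup>2 + 5 * (1 / (2 * \<gamma>) * ?R) + 11 / 3 * (real n / q * H\<^sub>0)
        = 3 * L\<^sub>f * ?Z + 2 / (3 * L\<^sub>f) * \<beta>\<^sub>h\<^sup>2 + 15 * L\<^sub>f / 2 * ?R + 11 / 3 * (real n / q * H\<^sub>0)"
      by (simp add: \<gamma>)
    also have "\<dots> \<le> 3 * L\<^sub>f * ?Z + 2 / (3 * L\<^sub>f) * \<beta>\<^sub>h\<^sup>2 + 15 * L\<^sub>f * ?R + 10 * (real n / q * H\<^sub>0)"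
      using L\<^sub>f_pos H0_nonneg q by (intro add_mono mult_right_mono order_refl) auto
    also have "\<dots> = 10 * real n / q * (6 * L\<^sub>f * q / (20 * real n) * ?Z + 3 * L\<^sub>f * q / (2 * real n) * ?R
        + q / (15 * real n * L\<^sub>f) * \<beta>\<^sub>h\<^sup>2 + H\<^sub>0)"
      using n q by (simp add: distrib_left)
    finally have "1 / \<gamma> * ?Z + 2 * \<gamma> * \<beta>\<^sub>h\<^sup>2 + 5 * (1 / (2 * \<gamma>) * ?R) + 11 / 3 * (real n / q * H\<^sub>0)
        \<le> 10 * real n / q * (6 * L\<^sub>f * q / (20 * real n) * ?Z + 3 * L\<^sub>f * q / (2 * real n) * ?R
        + q / (15 * real n * L\<^sub>f) * \<beta>\<^sub>h\<^sup>2 + H\<^sub>0)" .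
    from bound_mono[OF this, of t]
    show "ereal_expectation M (\<lambda>\<xi>. P (xbar t \<xi>)) - P xstar
        \<le> ereal (10 * real n / (q * real (t + 1)) * (6 * L\<^sub>f * q / (20 * real n) * ?Z
            + 3 * L\<^sub>f * q / (2 * real n) * ?R + q / (15 * real n * L\<^sub>f) * \<beta>\<^sub>h\<^sup>2 + H\<^sub>0))"
      using S.expected_objective_gap_le[OF lip a, of t]
      unfolding S.ys_def fixed_point_eq H0[OF S.vr_tos_solution_axioms] f xbar P_def
      by (meson ereal_less_eq(3) order_trans)
  qed
qed

end
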